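(* Let $\Gamma$ be a discrete group and let $\pi,\sigma$ be unitary representations of $\Gamma$ that are weakly equivalent, i.e. $\pi\prec\sigma$ and $\sigma\prec\pi$. Then their Furstenberg--Hamana boundaries coincide: there is a $\Gamma$-isomorphism $\mathcal{B}_\pi\cong\mathcal{B}_\sigma$. (That is, $\mathcal{B}_\pi$ is determined, up to $\Gamma$-isomorphism, by the weak equivalence class of $\pi$.)
   Context: An operator system is a norm-closed self-adjoint subspace of some $B(\mathcal{H})$ containing the identity. For a unitary representation $\pi:\Gamma\to\mathcal{U}(\mathcal{H}_\pi)$, $\Gamma$ acts on $B(\mathcal{H}_\pi)$ by $g\cdot x=\pi(g)x\pi(g^{-1})$. A $\Gamma$-map between operator systems carrying $\Gamma$-actions is a unital completely positive $\Gamma$-equivariant linear map; a $\Gamma$-isomorphism is a bijective completely isometric $\Gamma$-map (between $\Gamma$-$C^*$-algebras it is automatically a $*$-isomorphism). Furstenberg--Hamana (FH) boundary: on the set $\mathcal{G}$ of all $\Gamma$-maps $\phi:B(\mathcal{H}_\pi)\to B(\mathcal{H}_\pi)$ put the preorder $\phi\le\psi$ iff $\|\phi(x)\|\le\|\psi(x)\|$ for all $x$. Then $\mathcal{G}$ has minimal elements, every minimal element is idempotent, and its image is unique up to $\Gamma$-isomorphism. $\mathcal{B}_\pi$ is the image $\operatorname{Im}(\phi)$ of a minimal $\phi\in\mathcal{G}$, with the Choi--Effros product $a\cdot b=\phi(ab)$ and the restricted $\Gamma$-action; it is a $\Gamma$-$C^*$-algebra. $C^*_\pi(\Gamma)\subseteq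 B(\mathcal{H}_\pi)$ is the norm-closed span of $\pi(\Gamma)$. Weak containment $\pi\prec\sigma$ means that $\sigma(g)\mapsto\pi(g)$ extends to a $*$-homomorphism $C^*_\sigma(\Gamma)\to C^*_\pi(\Gamma)$. *)

theory Defs
  imports "HOL-Analysis.Analysis" "HOL-Algebra.Group"
begin

section \<open>Complex Hilbert spaces\<close>

text \<open>The inner product is conjugate-linear in the first argument. The real scalar multiplication,
  norm and completeness inherited from \<^class>\<open>banach\<close> are tied to it by the axioms, so that
  the type of operators \<open>'h \<Rightarrow>\<^sub>L 'h\<close> with its norm is available.\<close>

class complex_hilbert = banach +
  fixes scaleC :: "complex \<Rightarrow> 'a \<Rightarrow> 'a"
    and cinner :: "'a \<Rightarrow> 'a \<Rightarrow> complex"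
  assumes scaleC_add_right: "scaleC c (x + y) = scaleC c x + scaleC c y"
    and scaleC_add_left: "scaleC (c + d) x = scaleC c x + scaleC d x"
    and scaleC_scaleC: "scaleC c (scaleC d x) = scaleC (c * d) x"
    and scaleR_eq_scaleC: "scaleR r x = scaleC (complex_of_real r) x"
    and cinner_commute: "cinner x y = cnj (cinner y x)"
    and cinner_add_right: "cinner x (y + z) = cinner x y + cinner x z"
    and cinner_scaleC_right: "cinner x (scaleC c y) = c * cinner x y"
    and cinner_self: "cinner x x = complex_of_real ((norm x)\<^sup>2)"

lemma norm_scaleC: "norm (scaleC c x) = cmod c * norm (x :: 'h::complex_hilbert)"
proof -
  have "cinner (scaleC c x) (scaleC c x) = c * cnj (c * cinner x x)"
    by (metis cinner_commute cinner_scaleC_right)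
  also have "\<dots> = complex_of_real ((cmod c)\<^sup>2 * (norm x)\<^sup>2)"
    by (simp only: cinner_self complex_cnj_mult complex_cnj_complex_of_real of_real_mult
        complex_norm_square[of c] mult.assoc)
  finally have "complex_of_real ((norm (scaleC c x))\<^sup>2) = complex_of_real ((cmod c * norm x)\<^sup>2)"
    by (simp only: cinner_self power_mult_distrib)
  then have "(norm (scaleC c x))\<^sup>2 = (cmod c * norm x)\<^sup>2"
    using of_real_eq_iff by blast
  then show ?thesis
    by (simp add: power2_eq_iff_nonneg)
qed

lemma bounded_linear_scaleC: "bounded_linear (scaleC c :: 'h::complex_hilbert \<Rightarrow> 'h)"
  by (rule bounded_linear_intro[where K = "cmod c"])
     (simp_all add: scaleC_add_right scaleR_eq_scaleC scaleC_scaleC norm_scaleC mult.commute)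


section \<open>Bounded operators\<close>

text \<open>\<^typ>\<open>'h \<Rightarrow>\<^sub>L 'h\<close> consists of the bounded \<^emph>\<open>real\<close>-linear maps, so \<open>B(H)\<close> is the following
  subset of it.\<close>

definition bounded_ops :: "('h::complex_hilbert \<Rightarrow>\<^sub>L 'h) set" where
  "bounded_ops = {T. \<forall>c x. blinfun_apply T (scaleC c x) = scaleC c (blinfun_apply T x)}"

definition scale_op :: "complex \<Rightarrow> ('h::complex_hilbert \<Rightarrow>\<^sub>L 'h) \<Rightarrow> ('h \<Rightarrow>\<^sub>L 'h)" where
  "scale_op c T = Blinfun (scaleC c) o\<^sub>L T"

lemma scale_op_apply: "blinfun_apply (scale_op c T) x = scaleC c (blinfun_apply T x)"
  by (simp add: scale_op_def bounded_linear_Blinfun_apply[OF bounded_linear_scaleC])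

text \<open>Existence of the adjoint of an element of \<^const>\<open>bounded_ops\<close> is the Riesz representation
  theorem.\<close>

definition adj_op :: "('h::complex_hilbert \<Rightarrow>\<^sub>L 'h) \<Rightarrow> ('h \<Rightarrow>\<^sub>L 'h)" where
  "adj_op T = (THE S. \<forall>x y. cinner (blinfun_apply S x) y = cinner x (blinfun_apply T y))"

definition unitary_group :: "('h::complex_hilbert \<Rightarrow>\<^sub>L 'h) monoid" where
  "unitary_group =
    \<lparr>carrier = {U \<in> bounded_ops. adj_op U o\<^sub>L U = id_blinfun \<and> U o\<^sub>L adj_op U = id_blinfun},
     mult = (o\<^sub>L), one = id_blinfun\<rparr>"


section \<open>Operator systems and matrices over them\<close>

definition op_subspace :: "('h::complex_hilbert \<Rightarrow>\<^sub>L 'h) set \<Rightarrow> bool" where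
  "op_subspace S \<longleftrightarrow> S \<subseteq> bounded_ops \<and> 0 \<in> S \<and> (\<forall>x\<in>S. \<forall>y\<in>S. x + y \<in> S) \<and>
    (\<forall>c. \<forall>x\<in>S. scale_op c x \<in> S)"

definition operator_system :: "('h::complex_hilbert \<Rightarrow>\<^sub>L 'h) set \<Rightarrow> bool" where
  "operator_system S \<longleftrightarrow> op_subspace S \<and> closed S \<and> (\<forall>x\<in>S. adj_op x \<in> S) \<and> id_blinfun \<in> S"

text \<open>A function \<open>a :: nat \<Rightarrow> nat \<Rightarrow> ('h \<Rightarrow>\<^sub>L 'h)\<close>, restricted to indices below \<open>n\<close>, is an
  \<open>n \<times> n\<close> matrix and acts as an operator on the \<open>n\<close>-fold direct sum of the Hilbert space, whose
  vectors are functions \<open>\<xi> :: nat \<Rightarrow> 'h\<close> restricted to indices below \<open>n\<close>.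
  \<open>mat_positive\<close> and \<open>mat_norm\<close> are positivity and the operator norm there.\<close>

definition mat_over :: "nat \<Rightarrow> ('h::complex_hilbert \<Rightarrow>\<^sub>L 'h) set \<Rightarrow> (nat \<Rightarrow> nat \<Rightarrow> ('h \<Rightarrow>\<^sub>L 'h)) set" where
  "mat_over n S = {a. \<forall>i<n. \<forall>j<n. a i j \<in> S}"

definition mat_apply :: "nat \<Rightarrow> (nat \<Rightarrow> nat \<Rightarrow> ('h::complex_hilbert \<Rightarrow>\<^sub>L 'h)) \<Rightarrow> (nat \<Rightarrow> 'h) \<Rightarrow> nat \<Rightarrow> 'h" where
  "mat_apply n a \<xi> i = (\<Sum>j<n. blinfun_apply (a i j) (\<xi> j))"

definition mat_positive :: "nat \<Rightarrow> (nat \<Rightarrow> nat \<Rightarrow> ('h::complex_hilbert \<Rightarrow>\<^sub>L 'h)) \<Rightarrow> bool" where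
  "mat_positive n a \<longleftrightarrow> (\<forall>\<xi>. (\<Sum>i<n. cinner (\<xi> i) (mat_apply n a \<xi> i)) \<in> \<real>\<^sub>\<ge>\<^sub>0)"

definition mat_norm :: "nat \<Rightarrow> (nat \<Rightarrow> nat \<Rightarrow> ('h::complex_hilbert \<Rightarrow>\<^sub>L 'h)) \<Rightarrow> real" where
  "mat_norm n a =
    (SUP \<xi>\<in>{\<xi>. L2_set (\<lambda>j. norm (\<xi> j)) {..<n} \<le> 1}. L2_set (\<lambda>i. norm (mat_apply n a \<xi> i)) {..<n})"

definition linear_on_ops ::
    "('h::complex_hilbert \<Rightarrow>\<^sub>L 'h) set \<Rightarrow> (('h \<Rightarrow>\<^sub>L 'h) \<Rightarrow> ('k::complex_hilbert \<Rightarrow>\<^sub>L 'k)) \<Rightarrow> bool" where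
  "linear_on_ops S \<phi> \<longleftrightarrow> (\<forall>x\<in>S. \<forall>y\<in>S. \<phi> (x + y) = \<phi> x + \<phi> y) \<and>
    (\<forall>c. \<forall>x\<in>S. \<phi> (scale_op c x) = scale_op c (\<phi> x))"

definition completely_positive_on ::
    "('h::complex_hilbert \<Rightarrow>\<^sub>L 'h) set \<Rightarrow> (('h \<Rightarrow>\<^sub>L 'h) \<Rightarrow> ('k::complex_hilbert \<Rightarrow>\<^sub>L 'k)) \<Rightarrow> bool" where
  "completely_positive_on S \<phi> \<longleftrightarrow>
    (\<forall>n. \<forall>a\<in>mat_over n S. mat_positive n a \<longrightarrow> mat_positive n (\<lambda>i j. \<phi> (a i j)))"

definition completely_isometric_on ::
    "('h::complex_hilbert \<Rightarrow>\<^sub>L 'h) set \<Rightarrow> (('h \<Rightarrow>\<^sub>L 'h) \<Rightarrow> ('k::complex_hilbert \<Rightarrow>\<^sub>L 'k)) \<Rightarrow> bool" where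
  "completely_isometric_on S \<phi> \<longleftrightarrow>
    (\<forall>n. \<forall>a\<in>mat_over n S. mat_norm n (\<lambda>i j. \<phi> (a i j)) = mat_norm n a)"


section \<open>Unitary representations and equivariant maps\<close>

definition unitary_rep :: "('g, 'm) monoid_scheme \<Rightarrow> ('g \<Rightarrow> ('h::complex_hilbert \<Rightarrow>\<^sub>L 'h)) \<Rightarrow> bool" where
  "unitary_rep G \<pi> \<longleftrightarrow> \<pi> \<in> hom G unitary_group"

definition rep_act ::
    "('g, 'm) monoid_scheme \<Rightarrow> ('g \<Rightarrow> ('h::complex_hilbert \<Rightarrow>\<^sub>L 'h)) \<Rightarrow> 'g \<Rightarrow> ('h \<Rightarrow>\<^sub>L 'h) \<Rightarrow> ('h \<Rightarrow>\<^sub>L 'h)" where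
  "rep_act G \<pi> g x = \<pi> g o\<^sub>L x o\<^sub>L \<pi> (inv\<^bsub>G\<^esub> g)"

definition gamma_operator_system ::
    "('g, 'm) monoid_scheme \<Rightarrow> ('g \<Rightarrow> ('h::complex_hilbert \<Rightarrow>\<^sub>L 'h)) \<Rightarrow> ('h \<Rightarrow>\<^sub>L 'h) set \<Rightarrow> bool" where
  "gamma_operator_system G \<pi> S \<longleftrightarrow>
    operator_system S \<and> (\<forall>g\<in>carrier G. \<forall>x\<in>S. rep_act G \<pi> g x \<in> S)"

definition gamma_map ::
    "('g, 'm) monoid_scheme \<Rightarrow> ('g \<Rightarrow> ('h::complex_hilbert \<Rightarrow>\<^sub>L 'h)) \<Rightarrow> ('h \<Rightarrow>\<^sub>L 'h) set \<Rightarrow>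
      ('g \<Rightarrow> ('k::complex_hilbert \<Rightarrow>\<^sub>L 'k)) \<Rightarrow> ('k \<Rightarrow>\<^sub>L 'k) set \<Rightarrow>
      (('h \<Rightarrow>\<^sub>L 'h) \<Rightarrow> ('k \<Rightarrow>\<^sub>L 'k)) \<Rightarrow> bool" where
  "gamma_map G \<pi> S \<sigma> T \<phi> \<longleftrightarrow>
    gamma_operator_system G \<pi> S \<and> gamma_operator_system G \<sigma> T \<and> \<phi> ` S \<subseteq> T \<and>
    linear_on_ops S \<phi> \<and> \<phi> id_blinfun = id_blinfun \<and> completely_positive_on S \<phi> \<and>
    (\<forall>g\<in>carrier G. \<forall>x\<in>S. \<phi> (rep_act G \<pi> g x) = rep_act G \<sigma> g (\<phi> x))"

definition gamma_isomorphism ::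
    "('g, 'm) monoid_scheme \<Rightarrow> ('g \<Rightarrow> ('h::complex_hilbert \<Rightarrow>\<^sub>L 'h)) \<Rightarrow> ('h \<Rightarrow>\<^sub>L 'h) set \<Rightarrow>
      ('g \<Rightarrow> ('k::complex_hilbert \<Rightarrow>\<^sub>L 'k)) \<Rightarrow> ('k \<Rightarrow>\<^sub>L 'k) set \<Rightarrow>
      (('h \<Rightarrow>\<^sub>L 'h) \<Rightarrow> ('k \<Rightarrow>\<^sub>L 'k)) \<Rightarrow> bool" where
  "gamma_isomorphism G \<pi> S \<sigma> T \<theta> \<longleftrightarrow>
    gamma_map G \<pi> S \<sigma> T \<theta> \<and> bij_betw \<theta> S T \<and> completely_isometric_on S \<theta>"


section \<open>The Furstenberg--Hamana boundary\<close>

definition gamma_self_maps ::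
    "('g, 'm) monoid_scheme \<Rightarrow> ('g \<Rightarrow> ('h::complex_hilbert \<Rightarrow>\<^sub>L 'h)) \<Rightarrow> (('h \<Rightarrow>\<^sub>L 'h) \<Rightarrow> ('h \<Rightarrow>\<^sub>L 'h)) set" where
  "gamma_self_maps G \<pi> = {\<phi>. gamma_map G \<pi> bounded_ops \<pi> bounded_ops \<phi>}"

definition norm_below ::
    "(('h::complex_hilbert \<Rightarrow>\<^sub>L 'h) \<Rightarrow> ('h \<Rightarrow>\<^sub>L 'h)) \<Rightarrow> (('h \<Rightarrow>\<^sub>L 'h) \<Rightarrow> ('h \<Rightarrow>\<^sub>L 'h)) \<Rightarrow> bool" where
  "norm_below \<phi> \<psi> \<longleftrightarrow> (\<forall>x\<in>bounded_ops. norm (\<phi> x) \<le> norm (\<psi> x))"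

definition minimal_gamma_map ::
    "('g, 'm) monoid_scheme \<Rightarrow> ('g \<Rightarrow> ('h::complex_hilbert \<Rightarrow>\<^sub>L 'h)) \<Rightarrow> (('h \<Rightarrow>\<^sub>L 'h) \<Rightarrow> ('h \<Rightarrow>\<^sub>L 'h)) \<Rightarrow> bool" where
  "minimal_gamma_map G \<pi> \<phi> \<longleftrightarrow> \<phi> \<in> gamma_self_maps G \<pi> \<and>
    (\<forall>\<psi>\<in>gamma_self_maps G \<pi>. norm_below \<psi> \<phi> \<longrightarrow> norm_below \<phi> \<psi>)"

text \<open>\<open>is_FH_boundary G \<pi> B\<close> says that \<open>B\<close> is a realization of the Furstenberg--Hamana boundary of
  \<open>\<pi>\<close>; realizations are unique up to \<^const>\<open>gamma_isomorphism\<close>, not on the nose. The Choi--Effros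
  product \<open>a \<cdot> b = \<phi> (a o\<^sub>L b)\<close> is not recorded: its involution, norm and matrix norms are
  those of \<open>B\<close> as an operator system, and a \<^const>\<open>gamma_isomorphism\<close> refers only to these.\<close>

definition is_FH_boundary ::
    "('g, 'm) monoid_scheme \<Rightarrow> ('g \<Rightarrow> ('h::complex_hilbert \<Rightarrow>\<^sub>L 'h)) \<Rightarrow> ('h \<Rightarrow>\<^sub>L 'h) set \<Rightarrow> bool" where
  "is_FH_boundary G \<pi> B \<longleftrightarrow> (\<exists>\<phi>. minimal_gamma_map G \<pi> \<phi> \<and> B = \<phi> ` bounded_ops)"


section \<open>Weak containment\<close>

definition group_Cstar ::
    "('g, 'm) monoid_scheme \<Rightarrow> ('g \<Rightarrow> ('h::complex_hilbert \<Rightarrow>\<^sub>L 'h)) \<Rightarrow> ('h \<Rightarrow>\<^sub>L 'h) set" where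
  "group_Cstar G \<pi> =
    closure {\<Sum>g\<in>F. scale_op (c g) (\<pi> g) | F c. finite F \<and> F \<subseteq> carrier G}"

definition star_homomorphism ::
    "('h::complex_hilbert \<Rightarrow>\<^sub>L 'h) set \<Rightarrow> ('k::complex_hilbert \<Rightarrow>\<^sub>L 'k) set \<Rightarrow> (('h \<Rightarrow>\<^sub>L 'h) \<Rightarrow> ('k \<Rightarrow>\<^sub>L 'k)) \<Rightarrow> bool" where
  "star_homomorphism A B \<rho> \<longleftrightarrow> \<rho> ` A \<subseteq> B \<and> linear_on_ops A \<rho> \<and>
    (\<forall>x\<in>A. \<forall>y\<in>A. \<rho> (x o\<^sub>L y) = \<rho> x o\<^sub>L \<rho> y) \<and> (\<forall>x\<in>A. \<rho> (adj_op x) = adj_op (\<rho> x))"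

definition weakly_contained ::
    "('g, 'm) monoid_scheme \<Rightarrow> ('g \<Rightarrow> ('h::complex_hilbert \<Rightarrow>\<^sub>L 'h)) \<Rightarrow>
      ('g \<Rightarrow> ('k::complex_hilbert \<Rightarrow>\<^sub>L 'k)) \<Rightarrow> bool" where
  "weakly_contained G \<pi> \<sigma> \<longleftrightarrow>
    (\<exists>\<rho>. star_homomorphism (group_Cstar G \<sigma>) (group_Cstar G \<pi>) \<rho> \<and>
         (\<forall>g\<in>carrier G. \<rho> (\<sigma> g) = \<pi> g))"

end

theory Submission
  imports Defs
begin

text \<open>The proof has two halves.

  The first half (\<open>gamma_map_from_weak_containment\<close>) produces from \<open>\<pi> \<prec> \<sigma>\<close> a \<open>\<Gamma>\<close>-map
  \<open>\<Phi> : B(H\<^sub>\<sigma>) \<rightarrow> B(H\<^sub>\<pi>)\<close>. Instead of extending the homomorphism \<open>\<rho> : \<sigma>(g) \<mapsto> \<pi>(g)\<close> of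
  C*-algebras by Arveson's theorem and using multiplicative domains, one works with scalar functionals only.
  For a vector \<open>x\<close> of \<open>H\<^sub>\<pi>\<close> the functional \<open>a \<mapsto> \<langle>x, \<rho>(a) x\<rangle>\<close> on the C*-algebra of \<open>\<sigma>\<close> has norm
  \<open>\<parallel>x\<parallel>\<^sup>2\<close>, because \<open>\<rho>\<close> is contractive (\<open>star_homomorphism_norm_le\<close>). By the Hahn-Banach theorem it
  extends to \<open>B(H\<^sub>\<sigma>)\<close> with the same norm, and the extension \<open>f\<^sub>x\<close> is positive since it attains its
  norm at the identity (\<open>positive_functional_extension\<close>). By Zorn's lemma \<open>H\<^sub>\<pi>\<close> is the closed span of
  vectors \<open>\<pi>(g) x\<close>, with \<open>x\<close> in a set \<open>X\<close> that generates pairwise orthogonal cyclic subspaces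
  (\<open>cyclic_decomposition\<close>). The formula
    \<open>\<langle>\<pi>(g) x, \<Phi>(a) \<pi>(h) y\<rangle> = f\<^sub>x(\<sigma>(g)\<^sup>-\<^sup>1 a \<sigma>(h))\<close> if \<open>x = y\<close>, and \<open>0\<close> otherwise,
  then defines a unital completely positive map (\<open>ucp_map_from_kernel\<close>), and its equivariance is visible
  from the formula.

  The second half is Hamana's rigidity argument. If \<open>\<phi>\<close> is a minimal \<open>\<Gamma>\<close>-map and \<open>\<tau>\<close> is any \<open>\<Gamma>\<close>-map
  of the same \<open>B(H)\<close> into itself, then \<open>\<phi> \<tau> \<phi> = \<phi>\<close> (\<open>minimal_gamma_map_absorbs\<close>). With \<open>\<phi>\<close>, \<open>\<psi>\<close>
  minimal for \<open>\<pi>\<close>, \<open>\<sigma>\<close> and \<open>\<Phi>\<close>, \<open>\<Psi>\<close> the maps given by the two weak containments, this applies to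
  \<open>\<tau> = \<Phi> \<psi> \<Psi>\<close> and to \<open>\<tau> = \<Psi> \<phi> \<Phi>\<close>, and shows that \<open>\<psi> \<Psi>\<close> and \<open>\<phi> \<Phi>\<close> restrict to mutually
  inverse \<open>\<Gamma>\<close>-maps between the two boundaries. Unital completely positive maps are completely
  contractive (\<open>ucp_mat_norm_le\<close>), so these inverse maps are completely isometric.\<close>

section \<open>Geometry of complex Hilbert spaces\<close>

lemma cinner_add_left: "cinner (x + y) (z::'h::complex_hilbert) = cinner x z + cinner y z"
  by (metis cinner_commute cinner_add_right complex_cnj_add)

lemma cinner_scaleC_left: "cinner (scaleC c x) (y::'h::complex_hilbert) = cnj c * cinner x y"
  by (metis cinner_commute cinner_scaleC_right complex_cnj_mult)

lemma norm_add_scaleC_sq: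
  fixes x y :: "'h::complex_hilbert"
  shows "(norm (x + scaleC c y))\<^sup>2 = (norm x)\<^sup>2 + 2 * Re (c * cinner x y) + (cmod c)\<^sup>2 * (norm y)\<^sup>2"
proof -
  have "cinner (x + scaleC c y) (x + scaleC c y)
      = cinner x x + (c * cinner x y + cnj (c * cinner x y)) + (c * cnj c) * cinner y y"
    by (simp add: cinner_add_left cinner_add_right cinner_scaleC_left cinner_scaleC_right
        cinner_commute[of y x] algebra_simps)
  then have "complex_of_real ((norm (x + scaleC c y))\<^sup>2)
      = complex_of_real ((norm x)\<^sup>2 + 2 * Re (c * cinner x y) + (cmod c)\<^sup>2 * (norm y)\<^sup>2)"
    by (simp only: cinner_self complex_add_cnj of_real_add of_real_mult
        complex_norm_square[symmetric])
  then show ?thesis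
    using of_real_eq_iff by blast
qed

text \<open>The discriminant argument behind every Cauchy-Schwarz inequality below.\<close>

lemma quadratic_nonneg_imp_cauchy_schwarz:
  fixes A D :: real and B :: complex
  assumes "A \<ge> 0" "D \<ge> 0" and nonneg: "\<And>t. A + 2 * Re (t * B) + (cmod t)\<^sup>2 * D \<ge> 0"
  shows "(cmod B)\<^sup>2 \<le> A * D"
proof -
  have q: "A - 2 * s * (cmod B)\<^sup>2 + s\<^sup>2 * (cmod B)\<^sup>2 * D \<ge> 0" for s :: real
  proof -
    have "cnj B * B = complex_of_real ((cmod B)\<^sup>2)"
      by (metis complex_norm_square mult.commute of_real_power)
    then have "(- complex_of_real s * cnj B) * B = complex_of_real (- s * (cmod B)\<^sup>2)"
      by (simp add: mult.assoc)
    then have "Re ((- complex_of_real s * cnj B) * B) = - s * (cmod B)\<^sup>2"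
      by (metis Re_complex_of_real)
    then show ?thesis
      using nonneg[of "- complex_of_real s * cnj B"]
      by (simp add: norm_mult power_mult_distrib)
  qed
  \<comment> \<open>\<open>q\<close> is the hypothesis along the line of those \<open>t\<close> for which \<open>t * B\<close> is real; its minimum is at \<open>s = 1 / D\<close>.\<close>
  show ?thesis
  proof (cases "D = 0")
    case True
    have "(cmod B)\<^sup>2 = 0"
    proof (rule ccontr)
      assume "(cmod B)\<^sup>2 \<noteq> 0"
      then show False
        using q[of "(A + 1) / (2 * (cmod B)\<^sup>2)"] True by (simp add: field_simps)
    qed
    then show ?thesis using True by simp
  next
    case False
    then have "D > 0" using assms by simp
    then show ?thesis
      using q[of "1 / D"] by (simp add: field_simps power2_eq_square)
  qed
qed

lemma cinner_Cauchy_Schwarz: "cmod (cinner x y) \<le> norm x * norm (y::'h::complex_hilbert)"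
proof -
  have "(cmod (cinner x y))\<^sup>2 \<le> (norm x)\<^sup>2 * (norm y)\<^sup>2"
  proof (rule quadratic_nonneg_imp_cauchy_schwarz)
    fix t :: complex
    have "0 \<le> (norm (x + scaleC t y))\<^sup>2" by simp
    then show "0 \<le> (norm x)\<^sup>2 + 2 * Re (t * cinner x y) + (cmod t)\<^sup>2 * (norm y)\<^sup>2"
      by (simp only: norm_add_scaleC_sq)
  qed simp_all
  then show ?thesis
    by (metis abs_le_square_iff abs_mult abs_norm_cancel power_mult_distrib)
qed

lemma cinner_scaleR_left: "cinner (scaleR r x) (y::'h::complex_hilbert) = scaleR r (cinner x y)"
  by (simp add: scaleR_eq_scaleC cinner_scaleC_left scaleR_conv_of_real)

lemma cinner_scaleR_right: "cinner x (scaleR r (y::'h::complex_hilbert)) = scaleR r (cinner x y)"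
  by (simp add: scaleR_eq_scaleC cinner_scaleC_right scaleR_conv_of_real)

lemma bounded_bilinear_cinner:
  "bounded_bilinear (cinner :: 'h::complex_hilbert \<Rightarrow> 'h \<Rightarrow> complex)"
proof
  show "\<exists>K. \<forall>(a::'h) b. norm (cinner a b) \<le> norm a * norm b * K"
    by (rule exI[of _ 1]) (simp add: cinner_Cauchy_Schwarz)
qed (simp_all add: cinner_add_left cinner_add_right cinner_scaleR_left cinner_scaleR_right)

lemmas cinner_diff_left = bounded_bilinear.diff_left[OF bounded_bilinear_cinner]
  and cinner_diff_right = bounded_bilinear.diff_right[OF bounded_bilinear_cinner]
  and cinner_zero_left [simp] = bounded_bilinear.zero_left[OF bounded_bilinear_cinner]
  and cinner_zero_right [simp] = bounded_bilinear.zero_right[OF bounded_bilinear_cinner]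
  and cinner_sum_left = bounded_bilinear.sum_left[OF bounded_bilinear_cinner]
  and cinner_sum_right = bounded_bilinear.sum_right[OF bounded_bilinear_cinner]
  and tendsto_cinner = bounded_bilinear.tendsto[OF bounded_bilinear_cinner]
  and continuous_on_cinner = bounded_bilinear.continuous_on[OF bounded_bilinear_cinner]

lemmas scaleC_zero_right [simp] = linear_0[OF bounded_linear.linear[OF bounded_linear_scaleC]]
  and scaleC_sum_right = linear_sum[OF bounded_linear.linear[OF bounded_linear_scaleC]]

lemma scaleC_one [simp]: "scaleC 1 (x::'h::complex_hilbert) = x"
  using scaleR_eq_scaleC[of 1 x] by simp

lemma scaleC_zero_left [simp]: "scaleC 0 (x::'h::complex_hilbert) = 0"
  using scaleR_eq_scaleC[of 0 x] by simp

lemma scaleC_minus_one: "scaleC (- 1) (x::'h::complex_hilbert) = - x"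
  using scaleR_eq_scaleC[of "-1" x] by simp

lemma cinner_self_eq_0: "cinner x x = 0 \<longleftrightarrow> (x::'h::complex_hilbert) = 0"
  by (simp add: cinner_self)

lemma cinner_eqI_right: "(\<And>z. cinner z x = cinner z y) \<Longrightarrow> x = (y::'h::complex_hilbert)"
  by (metis cinner_diff_right cinner_self_eq_0 right_minus_eq)

lemma parallelogram:
  fixes x y :: "'h::complex_hilbert"
  shows "(norm (x + y))\<^sup>2 + (norm (x - y))\<^sup>2 = 2 * (norm x)\<^sup>2 + 2 * (norm y)\<^sup>2"
  using norm_add_scaleC_sq[of x 1 y] norm_add_scaleC_sq[of x "-1" y]
  by (simp add: scaleC_minus_one)

lemma nearest_point_exists:
  fixes M :: "'h::complex_hilbert set"
  assumes "subspace M" "closed M"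
  shows "\<exists>m\<in>M. \<forall>m'\<in>M. norm (v - m) \<le> norm (v - m')"
proof -
  define d where "d = infdist v M"
  have ne: "M \<noteq> {}" using assms subspace_0 by blast
  have dle: "d \<le> norm (v - m)" if "m \<in> M" for m
    unfolding d_def using infdist_le[OF that, of v] by (simp add: dist_norm)
  have d0: "d \<ge> 0" unfolding d_def by (rule infdist_nonneg)
  have "\<exists>m\<in>M. norm (v - m) < d + 1 / Suc n" for n
  proof -
    have "infdist v M < d + 1 / Suc n" by (simp add: d_def)
    then show ?thesis
      using infdist_notempty[OF ne] cINF_less_iff[of M "dist v"] ne
      by (metis bdd_belowI2 dist_norm zero_le_dist)
  qed
  then obtain m where mM: "\<And>n. m n \<in> M" and m: "\<And>n. norm (v - m n) < d + 1 / Suc n"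
    by metis
  \<comment> \<open>The parallelogram law, since the midpoint of \<open>m i\<close> and \<open>m j\<close> has distance at least \<open>d\<close> from \<open>v\<close>.\<close>
  have key: "(norm (m i - m j))\<^sup>2 \<le> 2 * (d + 1 / Suc i)\<^sup>2 + 2 * (d + 1 / Suc j)\<^sup>2 - 4 * d\<^sup>2" for i j
  proof -
    have mid: "(1/2) *\<^sub>R (m i + m j) \<in> M"
      using assms mM by (simp add: subspace_add subspace_scale)
    have "(v - m i) + (v - m j) = 2 *\<^sub>R (v - (1/2) *\<^sub>R (m i + m j))"
      by (simp add: algebra_simps scaleR_2)
    then have "norm ((v - m i) + (v - m j)) = 2 * norm (v - (1/2) *\<^sub>R (m i + m j))"
      by (metis abs_numeral norm_scaleR)
    then have a: "norm ((v - m i) + (v - m j)) \<ge> 2 * d"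
      using dle[OF mid] by simp
    have "(2 * d)\<^sup>2 \<le> (norm ((v - m i) + (v - m j)))\<^sup>2"
      using a d0 by (intro power_mono) auto
    moreover have "(norm (v - m i))\<^sup>2 \<le> (d + 1 / Suc i)\<^sup>2" "(norm (v - m j))\<^sup>2 \<le> (d + 1 / Suc j)\<^sup>2"
      using m[of i] m[of j] by (intro power_mono; simp)+
    moreover have "norm ((v - m i) - (v - m j)) = norm (m i - m j)"
      by (simp add: norm_minus_commute)
    ultimately show ?thesis
      using parallelogram[of "v - m i" "v - m j"] by (simp add: power_mult_distrib)
  qed
  have key2: "(norm (m i - m j))\<^sup>2 \<le> (8 * d + 4) / Suc N" if "i \<ge> N" "j \<ge> N" for i j N
  proof -
    have *: "(d + 1 / Suc k)\<^sup>2 \<le> d\<^sup>2 + (2 * d + 1) / Suc N" if "k \<ge> N" for k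
    proof -
      have "1 / Suc k \<le> 1 / Suc N" using that by (simp add: frac_le)
      then have "(d + 1 / Suc k)\<^sup>2 \<le> (d + 1 / Suc N)\<^sup>2"
        using d0 by (intro power_mono) auto
      also have "(d + q)\<^sup>2 = d\<^sup>2 + 2 * d * q + q * q" for q
        by (simp add: power2_eq_square algebra_simps)
      also have "(1 / Suc N) * (1 / Suc N) \<le> 1 * (1 / real (Suc N))"
        by (intro mult_right_mono) auto
      finally show ?thesis by (simp add: add_divide_distrib)
    qed
    show ?thesis
      using key[of i j] *[OF that(1)] *[OF that(2)] by (simp add: add_divide_distrib)
  qed
  have "Cauchy m"
  proof (rule CauchyI)
    fix e :: real assume "e > 0"
    then obtain N where N: "(8 * d + 4) / e\<^sup>2 < real N"
      using reals_Archimedean2 by blast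
    have "norm (m i - m j) < e" if "i \<ge> N" "j \<ge> N" for i j
    proof -
      have "(8 * d + 4) < e\<^sup>2 * real N"
        using N \<open>e > 0\<close> by (simp add: field_simps)
      also have "\<dots> \<le> e\<^sup>2 * Suc N" by (intro mult_left_mono) auto
      finally have "(8 * d + 4) / Suc N < e\<^sup>2"
        by (simp add: divide_less_eq)
      then have "(norm (m i - m j))\<^sup>2 < e\<^sup>2" using key2[OF that] by linarith
      then show ?thesis using \<open>e > 0\<close> by (simp add: power_less_imp_less_base)
    qed
    then show "\<exists>N. \<forall>i\<ge>N. \<forall>j\<ge>N. norm (m i - m j) < e" by blast
  qed
  then obtain l where l: "m \<longlonglongrightarrow> l" using Cauchy_convergent convergent_def by blast
  have "l \<in> M" using closed_sequentially[OF assms(2)] mM l by blast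
  moreover have "norm (v - l) \<le> d"
  proof (rule LIMSEQ_le)
    show "(\<lambda>n. norm (v - m n)) \<longlonglongrightarrow> norm (v - l)" by (intro tendsto_intros l)
    show "(\<lambda>n. d + 1 / Suc n) \<longlonglongrightarrow> d"
      using tendsto_add[OF tendsto_const LIMSEQ_inverse_real_of_nat, of d]
      by (simp add: inverse_eq_divide)
    show "\<exists>N. \<forall>n\<ge>N. norm (v - m n) \<le> d + 1 / real (Suc n)" using m less_imp_le by blast
  qed
  ultimately show ?thesis using dle by (meson order_trans)
qed

text \<open>The subspace is only assumed to be real, so orthogonality refers to the real inner product.\<close>

lemma orthogonal_projection_exists:
  fixes M :: "'h::complex_hilbert set"
  assumes "subspace M" "closed M"
  shows "\<exists>m\<in>M. \<forall>u\<in>M. Re (cinner u (v - m)) = 0"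
proof -
  obtain m where m: "m \<in> M" "\<And>m'. m' \<in> M \<Longrightarrow> norm (v - m) \<le> norm (v - m')"
    using nearest_point_exists[OF assms] by blast
  have "Re (cinner (v - m) u) = 0" if u: "u \<in> M" for u
  proof -
    define r where "r = Re (cinner (v - m) u)"
    have le: "0 \<le> 2 * (t * r) + t\<^sup>2 * (norm u)\<^sup>2" for t :: real
    proof -
      have "m - t *\<^sub>R u \<in> M" using m u assms by (simp add: subspace_diff subspace_scale)
      then have "norm (v - m) \<le> norm (v - m + scaleC (of_real t) u)"
        using m(2)[of "m - t *\<^sub>R u"] by (simp add: scaleR_eq_scaleC algebra_simps)
      then have "(norm (v - m))\<^sup>2 \<le> (norm (v - m + scaleC (of_real t) u))\<^sup>2"
        by (intro power_mono) auto
      then show ?thesis by (simp add: norm_add_scaleC_sq r_def)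
    qed
    show "r = 0"
    proof (cases "u = 0")
      case True then show ?thesis by (simp add: r_def)
    next
      case False
      then obtain N where N: "N = (norm u)\<^sup>2" "N > 0" by simp
      have "0 \<le> - r\<^sup>2 / N"
        using le[of "- r / N", folded N(1)] N(2) by (simp add: field_simps power2_eq_square)
      then show ?thesis using N by (simp add: divide_le_0_iff)
    qed
  qed
  moreover have "Re (cinner u (v - m)) = Re (cinner (v - m) u)" for u
    by (subst cinner_commute) simp
  ultimately have "\<forall>u\<in>M. Re (cinner u (v - m)) = 0" by simp
  then show ?thesis using m(1) by blast
qed

lemma riesz_representation_real:
  fixes f :: "'h::complex_hilbert \<Rightarrow> real"
  assumes f: "bounded_linear f"
  shows "\<exists>w. \<forall>x. f x = Re (cinner x w)"
proof (cases "\<forall>x. f x = 0")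
  case True then show ?thesis by (intro exI[of _ 0]) simp
next
  case False
  then obtain v where v: "f v \<noteq> 0" by blast
  interpret f: bounded_linear f by fact
  define M where "M = {x. f x = 0}"
  have "subspace M" by (auto simp: M_def subspace_def f.add f.scaleR f.zero)
  moreover have "closed M"
    unfolding M_def by (intro closed_Collect_eq continuous_intros f.continuous_on)
  ultimately obtain m where m: "m \<in> M" "\<And>u. u \<in> M \<Longrightarrow> Re (cinner u (v - m)) = 0"
    using orthogonal_projection_exists by metis
  define z where "z = v - m"
  have fz: "f z \<noteq> 0" using m v by (simp add: z_def M_def f.diff)
  then have "z \<noteq> 0" using f.zero by auto
  define w where "w = (f z / (norm z)\<^sup>2) *\<^sub>R z"
  have "f x = Re (cinner x w)" for x
  proof -
    have "x - (f x / f z) *\<^sub>R z \<in> M" using fz by (simp add: M_def f.diff f.scaleR)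
    from m(2)[OF this] have "Re (cinner x z) = f x / f z * (norm z)\<^sup>2"
      by (simp add: z_def[symmetric] cinner_diff_left cinner_scaleR_left cinner_self)
    then show ?thesis using \<open>z \<noteq> 0\<close> fz
      by (simp add: w_def cinner_scaleR_right)
  qed
  then show ?thesis by blast
qed

section \<open>The Hahn-Banach theorem and functionals given on a family of vectors\<close>

text \<open>The functional to be extended is given by its graph, a subspace \<open>R0\<close> of the product with the reals.
  Single-valuedness of the graph is not a separate hypothesis: it follows from the bound at the zero
  vector.\<close>

lemma hahn_banach_norm:
  fixes R0 :: "('a::real_normed_vector \<times> real) set"
  assumes M: "M \<ge> 0" and R0: "subspace R0" and bound0: "\<And>x r. (x, r) \<in> R0 \<Longrightarrow> r \<le> M * norm x"
  shows "\<exists>g. linear g \<and> (\<forall>(x, r) \<in> R0. g x = r) \<and> (\<forall>x. g x \<le> M * norm x)"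
proof -
  define P where "P = {R. subspace R \<and> R0 \<subseteq> R \<and> (\<forall>(x, r) \<in> R. r \<le> M * norm x)}"
  have "\<exists>R\<in>P. \<forall>X\<in>P. R \<subseteq> X \<longrightarrow> X = R"
  proof (rule subset_Zorn_nonempty)
    show "P \<noteq> {}" using R0 bound0 by (auto simp: P_def)
    fix C assume ne: "C \<noteq> {}" and C: "subset.chain P C"
    have CP: "C \<subseteq> P" and tot: "\<And>A B. A \<in> C \<Longrightarrow> B \<in> C \<Longrightarrow> A \<subseteq> B \<or> B \<subseteq> A"
      using C by (auto simp: subset_chain_def)
    have subC: "subspace (\<Union>C)"
      unfolding subspace_def
    proof (intro conjI ballI allI)
      obtain A where "A \<in> C" using ne by blast
      moreover have "0 \<in> A" using \<open>A \<in> C\<close> CP by (intro subspace_0) (auto simp: P_def)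
      ultimately show "0 \<in> \<Union>C" by blast
    next
      fix x y assume "x \<in> \<Union>C" "y \<in> \<Union>C"
      then obtain A B where "A \<in> C" "B \<in> C" "x \<in> A" "y \<in> B" by blast
      then obtain D where "D \<in> C" "x \<in> D" "y \<in> D" using tot by blast
      moreover have "subspace D" using \<open>D \<in> C\<close> CP by (auto simp: P_def)
      ultimately show "x + y \<in> \<Union>C" using subspace_add by blast
    next
      fix c :: real and x assume "x \<in> \<Union>C"
      then obtain A where "A \<in> C" "x \<in> A" by blast
      moreover have "subspace A" using \<open>A \<in> C\<close> CP by (auto simp: P_def)
      ultimately show "c *\<^sub>R x \<in> \<Union>C" using subspace_scale by blast
    qed
    have "R0 \<subseteq> \<Union>C" using ne CP by (auto simp: P_def)
    moreover have "r \<le> M * norm x" if "(x, r) \<in> \<Union>C" for x r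
      using that CP by (auto simp: P_def)
    with subC \<open>R0 \<subseteq> \<Union>C\<close> show "\<Union>C \<in> P" by (simp add: P_def) blast
  qed
  then obtain R where "R \<in> P" and max: "\<And>X. X \<in> P \<Longrightarrow> R \<subseteq> X \<Longrightarrow> X = R" by blast
  then have R: "subspace R" "R0 \<subseteq> R" and bound: "\<And>x r. (x, r) \<in> R \<Longrightarrow> r \<le> M * norm x"
    by (auto simp: P_def)

  have total: "\<exists>r. (x0, r) \<in> R" for x0
  proof -
    \<comment> \<open>The value at \<open>x0\<close> must lie above all elements of \<open>L\<close> and below all right-hand sides of \<open>LU\<close>.\<close>
    define L where "L = (\<lambda>(y, s). s - M * norm (y - x0)) ` R"
    define r where "r = Sup L"
    have LU: "s - M * norm (y - x0) \<le> M * norm (y' + x0) - s'" if "(y, s) \<in> R" "(y', s') \<in> R" for y s y' s'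
    proof -
      have "(y + y', s + s') \<in> R" using subspace_add[OF R(1) that] by simp
      then have "s + s' \<le> M * norm (y + y')" by (rule bound)
      also have "\<dots> \<le> M * (norm (y - x0) + norm (y' + x0))"
        using norm_triangle_ineq[of "y - x0" "y' + x0"] M by (intro mult_left_mono) auto
      finally show ?thesis by (simp add: algebra_simps)
    qed
    have zero: "(0, 0) \<in> R" using subspace_0[OF R(1)] by (simp add: zero_prod_def)
    have bdd: "bdd_above L"
    proof (rule bdd_aboveI)
      fix l assume "l \<in> L"
      then obtain y s where "(y, s) \<in> R" "l = s - M * norm (y - x0)" by (auto simp: L_def)
      then show "l \<le> M * norm (0 + x0) - 0" using LU[OF _ zero] by blast
    qed
    have lower: "s - M * norm (y - x0) \<le> r" if "(y, s) \<in> R" for y s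
      unfolding r_def
    proof (rule cSup_upper[OF _ bdd])
      show "s - M * norm (y - x0) \<in> L"
        unfolding L_def by (rule image_eqI[OF _ that]) simp
    qed
    have upper: "r \<le> M * norm (y + x0) - s" if "(y, s) \<in> R" for y s
      unfolding r_def
    proof (rule cSup_least)
      show "L \<noteq> {}" using zero by (auto simp: L_def)
      fix l assume "l \<in> L"
      then obtain y' s' where "(y', s') \<in> R" "l = s' - M * norm (y' - x0)" by (auto simp: L_def)
      then show "l \<le> M * norm (y + x0) - s" using LU[OF _ that] by blast
    qed
    define R' where "R' = {p + t *\<^sub>R (x0, r) | p t. p \<in> R}"
    have "R' \<in> P"
    proof -
      have "R' = {u + w |u w. u \<in> R \<and> w \<in> span {(x0, r)}}"
        unfolding R'_def span_singleton by blast
      then have subR': "subspace R'" using subspace_sums[OF R(1) subspace_span[of "{(x0, r)}"]] by simp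
      have R0R': "R0 \<subseteq> R'"
      proof
        fix p assume "p \<in> R0"
        then have "p + 0 *\<^sub>R (x0, r) \<in> R'" unfolding R'_def using R(2) by blast
        then show "p \<in> R'" by (simp add: zero_prod_def[symmetric])
      qed
      have bnd: "s + t * r \<le> M * norm (y + t *\<^sub>R x0)" if p: "(y, s) \<in> R" for y s t
      proof -
        consider "t = 0" | "t > 0" | "t < 0" by linarith
        then show ?thesis
        proof cases
          case 1 then show ?thesis using bound[OF p] by simp
        next
          case 2
          have "((1/t) *\<^sub>R y, (1/t) * s) \<in> R" using subspace_scale[OF R(1) p, of "1/t"] by simp
          from upper[OF this] have "t * (s / t + r) \<le> t * (M * norm ((1/t) *\<^sub>R y + x0))"
            using 2 by (intro mult_left_mono) auto
          also have "\<dots> = M * norm (t *\<^sub>R ((1/t) *\<^sub>R y + x0))" using 2 by (simp only: norm_scaleR) simp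
          finally show ?thesis using 2 by (simp add: algebra_simps)
        next
          case 3
          have "((- 1/t) *\<^sub>R y, (- 1/t) * s) \<in> R" using subspace_scale[OF R(1) p, of "- 1/t"] by simp
          from lower[OF this] have "(- t) * (- s / t - r) \<le> (- t) * (M * norm ((- 1/t) *\<^sub>R y - x0))"
            using 3 by (intro mult_left_mono) auto
          also have "\<dots> = M * norm ((- t) *\<^sub>R ((- 1/t) *\<^sub>R y - x0))" using 3 by (simp only: norm_scaleR) simp
          finally show ?thesis using 3 by (simp add: algebra_simps)
        qed
      qed
      have "r' \<le> M * norm x" if x: "(x, r') \<in> R'" for x r'
      proof -
        obtain p t where p: "p \<in> R" "(x, r') = p + t *\<^sub>R (x0, r)" using x unfolding R'_def by blast
        obtain y s where "p = (y, s)" by (cases p)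
        then show ?thesis using bnd[of y s t] p by simp
      qed
      with subR' R0R' show ?thesis unfolding P_def by blast
    qed
    moreover have "R \<subseteq> R'"
    proof
      fix p assume "p \<in> R"
      then have "p + 0 *\<^sub>R (x0, r) \<in> R'" unfolding R'_def by blast
      then show "p \<in> R'" by (simp add: zero_prod_def[symmetric])
    qed
    ultimately have "R' = R" by (rule max)
    moreover have "(0, 0) + 1 *\<^sub>R (x0, r) \<in> R'" unfolding R'_def using zero by blast
    ultimately show ?thesis by auto
  qed
  have unique: "r = r'" if "(x, r) \<in> R" "(x, r') \<in> R" for x r r'
    using bound[of 0 "r - r'"] bound[of 0 "r' - r"]
      subspace_diff[OF R(1) that] subspace_diff[OF R(1) that(2) that(1)] by simp
  define g where "g x = (THE r. (x, r) \<in> R)" for x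
  have g: "(x, g x) \<in> R" for x
  proof -
    obtain r where "(x, r) \<in> R" using total by blast
    then show ?thesis unfolding g_def by (rule theI) (rule unique[OF _ \<open>(x, r) \<in> R\<close>])
  qed
  have eq: "g x = r" if "(x, r) \<in> R" for x r by (rule unique[OF g that])
  have "linear g"
  proof
    show "g (x + y) = g x + g y" for x y
      using subspace_add[OF R(1) g[of x] g[of y]] by (intro eq) simp
    show "g (c *\<^sub>R x) = c *\<^sub>R g x" for c x
      using subspace_scale[OF R(1) g[of x], of c] by (intro eq) simp
  qed
  moreover have "\<forall>(x, r) \<in> R0. g x = r"
  proof
    fix p assume "p \<in> R0"
    then have "(fst p, snd p) \<in> R" using R(2) by auto
    from eq[OF this] show "case p of (x, r) \<Rightarrow> g x = r" by (simp add: case_prod_beta)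
  qed
  moreover have "\<forall>x. g x \<le> M * norm x" using bound[OF g] by simp
  ultimately show ?thesis by blast
qed

text \<open>Linear combinations over two finite index sets are added over the union of the index sets.\<close>

lemma sum_Un_additive:
  fixes F :: "'i \<Rightarrow> complex \<Rightarrow> 'b::ab_group_add"
  assumes "finite S" "finite T" and add: "\<And>i a b. F i (a + b) = F i a + F i b"
  shows "(\<Sum>i\<in>S \<union> T. F i ((if i \<in> S then c i else 0) + (if i \<in> T then d i else 0)))
    = (\<Sum>i\<in>S. F i (c i)) + (\<Sum>i\<in>T. F i (d i))"
proof -
  have F0: "F i 0 = 0" for i using add[of i 0 0] by simp
  have "(\<Sum>i\<in>S. F i (c i)) = (\<Sum>i\<in>S \<union> T. F i (if i \<in> S then c i else 0))"
    "(\<Sum>i\<in>T. F i (d i)) = (\<Sum>i\<in>S \<union> T. F i (if i \<in> T then d i else 0))"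
    by (rule sum.mono_neutral_cong_left; auto simp: assms(1,2) F0)+
  then show ?thesis by (simp only: add sum.distrib)
qed

lemma linear_combinations_subspace:
  fixes v :: "'i \<Rightarrow> 'h::complex_hilbert" and f :: "'i \<Rightarrow> complex"
  shows "subspace {(\<Sum>i\<in>S. scaleC (c i) (v i), Re (\<Sum>i\<in>S. cnj (c i) * f i)) | S c. finite S \<and> S \<subseteq> I}"
    (is "subspace ?R")
  unfolding subspace_def
proof (intro conjI ballI allI)
  show "0 \<in> ?R" by (rule CollectI, rule exI[of _ "{}"]) (simp add: zero_prod_def)
next
  fix x y assume "x \<in> ?R" "y \<in> ?R"
  then obtain S c T d where
    S: "finite S" "S \<subseteq> I" and x: "x = (\<Sum>i\<in>S. scaleC (c i) (v i), Re (\<Sum>i\<in>S. cnj (c i) * f i))"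
    and T: "finite T" "T \<subseteq> I" and y: "y = (\<Sum>i\<in>T. scaleC (d i) (v i), Re (\<Sum>i\<in>T. cnj (d i) * f i))"
    by blast
  define e where "e = (\<lambda>i. (if i \<in> S then c i else 0) + (if i \<in> T then d i else 0))"
  have "x + y = (\<Sum>i\<in>S \<union> T. scaleC (e i) (v i), Re (\<Sum>i\<in>S \<union> T. cnj (e i) * f i))"
  proof -
    have 1: "(\<Sum>i\<in>S \<union> T. scaleC (e i) (v i)) = (\<Sum>i\<in>S. scaleC (c i) (v i)) + (\<Sum>i\<in>T. scaleC (d i) (v i))"
      unfolding e_def by (rule sum_Un_additive[OF S(1) T(1), of "\<lambda>i a. scaleC a (v i)"]) (rule scaleC_add_left)
    have 2: "(\<Sum>i\<in>S \<union> T. cnj (e i) * f i) = (\<Sum>i\<in>S. cnj (c i) * f i) + (\<Sum>i\<in>T. cnj (d i) * f i)"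
      unfolding e_def by (rule sum_Un_additive[OF S(1) T(1), of "\<lambda>i a. cnj a * f i"]) (simp add: distrib_right)
    show ?thesis unfolding x y 1 2 by simp
  qed
  then show "x + y \<in> ?R" using S T by (intro CollectI exI[of _ "S \<union> T"] exI[of _ e]) auto
next
  fix r :: real and x assume "x \<in> ?R"
  then obtain S c where S: "finite S" "S \<subseteq> I"
    and x: "x = (\<Sum>i\<in>S. scaleC (c i) (v i), Re (\<Sum>i\<in>S. cnj (c i) * f i))" by blast
  have "r *\<^sub>R x = (\<Sum>i\<in>S. scaleC (of_real r * c i) (v i), Re (\<Sum>i\<in>S. cnj (of_real r * c i) * f i))"
    by (simp add: x scaleR_eq_scaleC scaleC_sum_right scaleC_scaleC sum_distrib_left algebra_simps)
  then show "r *\<^sub>R x \<in> ?R" using S by (intro CollectI exI[of _ S] exI[of _ "\<lambda>i. of_real r * c i"]) auto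
qed

text \<open>Prescribed inner products \<open>f i\<close> with a family of vectors \<open>v i\<close> are realised by a vector as soon as
  they satisfy a norm bound on linear combinations. The bound makes the functional
  \<open>\<Sum> c\<^sub>i v\<^sub>i \<mapsto> Re (\<Sum> cnj c\<^sub>i f\<^sub>i)\<close> well defined on the span; it is extended to the whole space
  and represented there.\<close>

lemma riesz_representation_on_family:
  fixes v :: "'i \<Rightarrow> 'h::complex_hilbert" and f :: "'i \<Rightarrow> complex"
  assumes M: "M \<ge> 0" and bound: "\<And>S c. finite S \<Longrightarrow> S \<subseteq> I \<Longrightarrow>
    cmod (\<Sum>i\<in>S. cnj (c i) * f i) \<le> M * norm (\<Sum>i\<in>S. scaleC (c i) (v i))"
  shows "\<exists>w. \<forall>i\<in>I. cinner (v i) w = f i"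
proof -
  let ?R = "{(\<Sum>i\<in>S. scaleC (c i) (v i), Re (\<Sum>i\<in>S. cnj (c i) * f i)) | S c. finite S \<and> S \<subseteq> I}"
  have "r \<le> M * norm x" if "(x, r) \<in> ?R" for x r
    using that bound complex_Re_le_cmod order_trans by blast
  from hahn_banach_norm[OF M linear_combinations_subspace this]
  obtain g where g: "linear g" "\<forall>(x, r) \<in> ?R. g x = r" and gM: "\<And>x. g x \<le> M * norm x"
    by blast
  have "\<bar>g x\<bar> \<le> norm x * M" for x
    using gM[of x] gM[of "- x"] linear_neg[OF g(1), of x] by (simp add: mult.commute)
  then have "bounded_linear g"
    using g(1) by (intro bounded_linear_intro[of g M]) (auto simp: linear_add linear_scale)
  then obtain w where w: "\<And>x. g x = Re (cinner x w)" using riesz_representation_real by blast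
  have *: "Re (cnj a * cinner (v i) w) = Re (cnj a * f i)" if i: "i \<in> I" for a i
  proof -
    have "(\<Sum>i\<in>{i}. scaleC a (v i), Re (\<Sum>i\<in>{i}. cnj a * f i)) \<in> ?R"
      using i by (intro CollectI exI[of _ "{i}"] exI[of _ "\<lambda>_. a"]) simp
    then have "g (scaleC a (v i)) = Re (cnj a * f i)" using g(2) by fastforce
    then show ?thesis by (simp only: w cinner_scaleC_left)
  qed
  \<comment> \<open>The coefficients \<open>1\<close> and \<open>\<i>\<close> recover the real and the imaginary part.\<close>
  have "cinner (v i) w = f i" if "i \<in> I" for i
    using *[OF that, of 1] *[OF that, of "\<i>"] by (simp add: complex_eq_iff)
  then show ?thesis by blast
qed

section \<open>Adjoints and the space of bounded operators\<close>

lemma bounded_opsD: "T \<in> bounded_ops \<Longrightarrow> blinfun_apply T (scaleC c x) = scaleC c (blinfun_apply T x)"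
  by (simp add: bounded_ops_def)

lemma bounded_op_from_function:
  fixes W :: "'h::complex_hilbert \<Rightarrow> 'h"
  assumes "\<And>x y. W (x + y) = W x + W y" "\<And>c x. W (scaleC c x) = scaleC c (W x)"
    and "\<And>x. norm (W x) \<le> M * norm x"
  shows "\<exists>T\<in>bounded_ops. \<forall>x. blinfun_apply T x = W x"
proof -
  have "bounded_linear W"
    using assms by (intro bounded_linear_intro[of W M]) (auto simp: scaleR_eq_scaleC mult.commute)
  then have "blinfun_apply (Blinfun W) = W" by (rule bounded_linear_Blinfun_apply)
  then show ?thesis using assms(2) by (intro bexI[of _ "Blinfun W"]) (auto simp: bounded_ops_def)
qed

lemma adjoint_exists:
  fixes T :: "'h::complex_hilbert \<Rightarrow>\<^sub>L 'h"
  assumes T: "T \<in> bounded_ops"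
  shows "\<exists>S\<in>bounded_ops. \<forall>x y. cinner (blinfun_apply S x) y = cinner x (blinfun_apply T y)"
proof -
  have "\<exists>w. \<forall>y\<in>UNIV. cinner y w = cinner (T y) x" for x
  proof (rule riesz_representation_on_family[of "norm T * norm x"])
    fix S :: "'h set" and c assume "finite S"
    have "(\<Sum>y\<in>S. cnj (c y) * cinner (T y) x) = cinner (T (\<Sum>y\<in>S. scaleC (c y) y)) x"
      by (simp add: blinfun.sum_right cinner_sum_left bounded_opsD[OF T] cinner_scaleC_left)
    also have "cmod \<dots> \<le> norm T * norm (\<Sum>y\<in>S. scaleC (c y) y) * norm x"
      by (meson cinner_Cauchy_Schwarz mult_right_mono norm_blinfun norm_ge_zero order_trans)
    finally show "cmod (\<Sum>y\<in>S. cnj (c y) * cinner (T y) x) \<le> norm T * norm x * norm (\<Sum>y\<in>S. scaleC (c y) y)"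
      by (simp add: mult_ac)
  qed simp
  then obtain W where W: "\<And>x y. cinner y (W x) = cinner (T y) x" by (metis UNIV_I)
  have "\<exists>S\<in>bounded_ops. \<forall>x. blinfun_apply S x = W x"
  proof (rule bounded_op_from_function)
    show "W (x + y) = W x + W y" for x y
      by (rule cinner_eqI_right) (simp add: W cinner_add_right)
    show "W (scaleC c x) = scaleC c (W x)" for c x
      by (rule cinner_eqI_right) (simp add: W cinner_scaleC_right)
    show "norm (W x) \<le> norm T * norm x" for x
    proof (cases "W x = 0")
      case False
      have "norm (W x) * norm (W x) = cmod (cinner (W x) (W x))"
        by (simp add: cinner_self power2_eq_square norm_mult)
      also have "\<dots> \<le> norm (T (W x)) * norm x" by (simp only: W cinner_Cauchy_Schwarz)
      also have "\<dots> \<le> norm T * norm (W x) * norm x" by (intro mult_right_mono norm_blinfun) auto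
      finally show ?thesis using False by (simp add: mult_ac)
    qed simp
  qed
  then show ?thesis by (metis W cinner_commute)
qed

lemma adj_op_works:
  assumes T: "T \<in> bounded_ops"
  shows "adj_op T \<in> bounded_ops \<and>
    (\<forall>x y. cinner (blinfun_apply (adj_op T) x) y = cinner x (blinfun_apply T y))"
proof -
  obtain S where S: "S \<in> bounded_ops" "\<forall>x y. cinner (blinfun_apply S x) y = cinner x (blinfun_apply T y)"
    using adjoint_exists[OF T] by blast
  have "adj_op T = S"
    unfolding adj_op_def
  proof (rule the_equality)
    fix S' assume "\<forall>x y. cinner (blinfun_apply S' x) y = cinner x (blinfun_apply T y)"
    with S have "blinfun_apply S' x = blinfun_apply S x" for x
      by (intro cinner_eqI_right) (metis cinner_commute)
    then show "S' = S" by (rule blinfun_eqI)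
  qed (use S in simp)
  then show ?thesis using S by simp
qed

lemma adj_op_bounded_ops [simp]: "T \<in> bounded_ops \<Longrightarrow> adj_op T \<in> bounded_ops"
  using adj_op_works by blast

lemma cinner_adj_op_left:
  "T \<in> bounded_ops \<Longrightarrow> cinner (blinfun_apply (adj_op T) x) y = cinner x (blinfun_apply T y)"
  using adj_op_works by blast

lemma cinner_adj_op_right:
  "T \<in> bounded_ops \<Longrightarrow> cinner x (blinfun_apply (adj_op T) y) = cinner (blinfun_apply T x) y"
  by (metis cinner_adj_op_left cinner_commute)

lemma bounded_ops_eqI:
  fixes S T :: "'h::complex_hilbert \<Rightarrow>\<^sub>L 'h"
  assumes "\<And>x y. cinner x (blinfun_apply S y) = cinner x (blinfun_apply T y)"
  shows "S = T"
  by (rule blinfun_eqI) (rule cinner_eqI_right, rule assms)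

lemma adj_op_eqI:
  assumes T: "T \<in> bounded_ops"
    and "\<And>x y. cinner x (blinfun_apply S y) = cinner (blinfun_apply T x) y"
  shows "adj_op T = S"
  by (rule bounded_ops_eqI) (simp add: cinner_adj_op_right[OF T] assms(2))

lemma
  fixes S T :: "'h::complex_hilbert \<Rightarrow>\<^sub>L 'h"
  shows bounded_ops_add: "S \<in> bounded_ops \<Longrightarrow> T \<in> bounded_ops \<Longrightarrow> S + T \<in> bounded_ops"
    and bounded_ops_zero: "(0 :: 'h \<Rightarrow>\<^sub>L 'h) \<in> bounded_ops"
    and bounded_ops_id: "(id_blinfun :: 'h \<Rightarrow>\<^sub>L 'h) \<in> bounded_ops"
    and bounded_ops_compose: "S \<in> bounded_ops \<Longrightarrow> T \<in> bounded_ops \<Longrightarrow> S o\<^sub>L T \<in> bounded_ops"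
    and bounded_ops_scale_op: "S \<in> bounded_ops \<Longrightarrow> scale_op c S \<in> bounded_ops"
  by (auto simp: bounded_ops_def blinfun.add_left scaleC_add_right scale_op_apply scaleC_scaleC mult.commute)

lemma scaleR_eq_scale_op: "r *\<^sub>R T = scale_op (complex_of_real r) T"
  by (rule blinfun_eqI) (simp add: scale_op_apply scaleR_blinfun.rep_eq scaleR_eq_scaleC)

lemma bounded_ops_scaleR: "T \<in> bounded_ops \<Longrightarrow> r *\<^sub>R T \<in> bounded_ops"
  by (simp add: scaleR_eq_scale_op bounded_ops_scale_op)

lemma subspace_bounded_ops: "subspace bounded_ops"
  by (simp add: subspace_def bounded_ops_add bounded_ops_zero bounded_ops_scaleR)

lemmas bounded_ops_diff = subspace_diff[OF subspace_bounded_ops]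
  and bounded_ops_sum = subspace_sum[OF subspace_bounded_ops]

lemma adj_op_adj_op [simp]: "T \<in> bounded_ops \<Longrightarrow> adj_op (adj_op T) = T"
  by (rule adj_op_eqI) (auto simp: cinner_adj_op_left)

lemma norm_adj_op_apply_sq:
  "T \<in> bounded_ops \<Longrightarrow> cinner x (blinfun_apply (adj_op T) (blinfun_apply T x)) = complex_of_real ((norm (blinfun_apply T x))\<^sup>2)"
  by (simp add: cinner_adj_op_right cinner_self)

lemma closed_bounded_ops: "closed (bounded_ops :: ('h::complex_hilbert \<Rightarrow>\<^sub>L 'h) set)"
proof -
  have "bounded_ops = (\<Inter>c. \<Inter>x. {T :: 'h \<Rightarrow>\<^sub>L 'h. blinfun_apply T (scaleC c x) = scaleC c (blinfun_apply T x)})"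
    by (auto simp: bounded_ops_def)
  moreover have "closed {T :: 'h \<Rightarrow>\<^sub>L 'h. blinfun_apply T (scaleC c x) = scaleC c (blinfun_apply T x)}" for c x
    by (intro closed_Collect_eq continuous_intros bounded_linear.continuous_on[OF bounded_linear_scaleC])
  ultimately show ?thesis by (metis (no_types, lifting) closed_INT)
qed

lemma norm_adj_op_le:
  assumes T: "T \<in> bounded_ops"
  shows "norm (adj_op T) \<le> norm T"
proof (rule norm_blinfun_bound)
  fix x
  let ?y = "blinfun_apply (adj_op T) x"
  show "norm ?y \<le> norm T * norm x"
  proof (cases "?y = 0")
    case False
    have "norm ?y * norm ?y = cmod (cinner ?y ?y)"
      by (simp add: cinner_self power2_eq_square norm_mult)
    also have "\<dots> = cmod (cinner x (blinfun_apply T ?y))" by (simp only: cinner_adj_op_left[OF T])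
    also have "\<dots> \<le> norm x * norm (blinfun_apply T ?y)" by (rule cinner_Cauchy_Schwarz)
    also have "\<dots> \<le> norm x * (norm T * norm ?y)" by (intro mult_left_mono norm_blinfun) auto
    finally show ?thesis using False by (simp add: mult_ac)
  qed simp
qed simp

lemma adj_op_add: "S \<in> bounded_ops \<Longrightarrow> T \<in> bounded_ops \<Longrightarrow> adj_op (S + T) = adj_op S + adj_op T"
  by (rule adj_op_eqI)
     (auto simp: bounded_ops_add blinfun.add_left cinner_add_left cinner_add_right cinner_adj_op_right)

lemma adj_op_scale_op: "T \<in> bounded_ops \<Longrightarrow> adj_op (scale_op c T) = scale_op (cnj c) (adj_op T)"
  by (rule adj_op_eqI)
     (auto simp: bounded_ops_scale_op scale_op_apply cinner_scaleC_left cinner_scaleC_right cinner_adj_op_right)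

lemma adj_op_scaleR: "T \<in> bounded_ops \<Longrightarrow> adj_op (r *\<^sub>R T) = r *\<^sub>R adj_op T"
  by (simp add: scaleR_eq_scale_op adj_op_scale_op)

lemma adj_op_minus: "T \<in> bounded_ops \<Longrightarrow> adj_op (- T) = - adj_op T"
  using adj_op_scaleR[of T "-1"] by simp

lemma adj_op_diff: "S \<in> bounded_ops \<Longrightarrow> T \<in> bounded_ops \<Longrightarrow> adj_op (S - T) = adj_op S - adj_op T"
  using adj_op_add[of S "- T"] adj_op_minus[of T] subspace_neg[OF subspace_bounded_ops, of T] by simp

lemma adj_op_compose:
  "S \<in> bounded_ops \<Longrightarrow> T \<in> bounded_ops \<Longrightarrow> adj_op (S o\<^sub>L T) = adj_op T o\<^sub>L adj_op S"
  by (rule adj_op_eqI) (auto simp: bounded_ops_compose cinner_adj_op_right)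

lemma adj_op_id [simp]: "adj_op id_blinfun = (id_blinfun :: 'h::complex_hilbert \<Rightarrow>\<^sub>L 'h)"
  by (rule adj_op_eqI) (auto simp: bounded_ops_id)

lemma adj_op_sum:
  "(\<And>i. i \<in> S \<Longrightarrow> f i \<in> bounded_ops) \<Longrightarrow> adj_op (\<Sum>i\<in>S. f i) = (\<Sum>i\<in>S. adj_op (f i))"
proof (induction S rule: infinite_finite_induct)
  case (insert x F)
  then show ?case by (simp add: adj_op_add bounded_ops_sum)
qed (rule adj_op_eqI; simp add: bounded_ops_zero)+

lemma tendsto_adj_op:
  assumes "\<And>n. f n \<in> bounded_ops" "l \<in> bounded_ops" "f \<longlonglongrightarrow> l"
  shows "(\<lambda>n. adj_op (f n)) \<longlonglongrightarrow> adj_op l"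
proof (rule tendsto_dist_iff[THEN iffD2], rule Lim_null_comparison)
  have "norm (adj_op (f n) - adj_op l) \<le> norm (f n - l)" for n
    using norm_adj_op_le[of "f n - l"] by (simp add: adj_op_diff assms bounded_ops_diff)
  then show "\<forall>\<^sub>F n in sequentially. norm (dist (adj_op (f n)) (adj_op l)) \<le> norm (f n - l)"
    by (simp add: dist_norm)
  show "(\<lambda>n. norm (f n - l)) \<longlonglongrightarrow> 0"
    using assms(3) tendsto_norm_zero LIM_zero by blast
qed

lemma op_subspace_subspace: "op_subspace A \<Longrightarrow> subspace A"
  by (auto simp: op_subspace_def subspace_def scaleR_eq_scale_op)

section \<open>Square roots and contractivity of *-homomorphisms\<close>

text \<open>A concrete unital C*-algebra: a norm-closed self-adjoint subspace of \<open>B(H)\<close> which contains the identity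
  operator (an operator system) and is closed under composition.\<close>

definition unital_cstar_algebra :: "('h::complex_hilbert \<Rightarrow>\<^sub>L 'h) set \<Rightarrow> bool" where
  "unital_cstar_algebra A \<longleftrightarrow> operator_system A \<and> (\<forall>x\<in>A. \<forall>y\<in>A. x o\<^sub>L y \<in> A)"

text \<open>The conclusion says that \<open>1 - y\<close> is a self-adjoint square root of \<open>1 - h\<close>. It is found inside the
  algebra as the fixed point of \<open>y \<mapsto> (h + y\<^sup>2) / 2\<close>, which maps the ball of radius \<open>\<parallel>h\<parallel>\<close> into
  itself and contracts distances there by the factor \<open>\<parallel>h\<parallel>\<close>.\<close>

lemma self_adjoint_sqrt:
  fixes A :: "('h::complex_hilbert \<Rightarrow>\<^sub>L 'h) set"
  assumes A: "unital_cstar_algebra A" and h: "h \<in> A" "adj_op h = h" "norm h < 1"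
  shows "\<exists>y\<in>A. adj_op y = y \<and> h = 2 *\<^sub>R y - (y o\<^sub>L y)"
proof -
  have sub: "subspace A" and cl: "closed A" and AB: "A \<subseteq> bounded_ops"
    and mult: "\<And>x y. x \<in> A \<Longrightarrow> y \<in> A \<Longrightarrow> x o\<^sub>L y \<in> A"
    using A op_subspace_subspace unfolding unital_cstar_algebra_def operator_system_def op_subspace_def
    by blast+
  define K where "K = {y \<in> A. adj_op y = y \<and> norm y \<le> norm h}"
  define F where "F y = (1/2) *\<^sub>R (h + (y o\<^sub>L y))" for y
  have "closed K"
    unfolding closed_sequential_limits
  proof (intro allI impI, elim conjE)
    fix f l assume f: "\<forall>n. f n \<in> K" and lim: "f \<longlonglongrightarrow> l"
    then have lA: "l \<in> A" using closed_sequentially[OF cl] by (auto simp: K_def)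
    have "(\<lambda>n. adj_op (f n)) \<longlonglongrightarrow> adj_op l"
      using f AB lA lim by (intro tendsto_adj_op) (auto simp: K_def)
    moreover have "(\<lambda>n. adj_op (f n)) = f" using f by (auto simp: K_def)
    ultimately have "adj_op l = l" using lim LIMSEQ_unique by metis
    moreover have "norm l \<le> norm h"
      using f by (intro LIMSEQ_le_const2[OF tendsto_norm[OF lim]]) (auto simp: K_def)
    ultimately show "l \<in> K" using lA by (simp add: K_def)
  qed
  have "\<exists>!y\<in>K. F y = y"
  proof (rule Banach_fix)
    show "complete K" using \<open>closed K\<close> by (simp add: complete_eq_closed)
    show "K \<noteq> {}" using h by (auto simp: K_def)
    show "0 \<le> norm h" "norm h < 1" using h by auto
    show "F ` K \<subseteq> K"
    proof (rule image_subsetI)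
      fix y assume y: "y \<in> K"
      have "norm (y o\<^sub>L y) \<le> norm y * norm y" by (rule norm_blinfun_compose)
      also have "\<dots> \<le> norm h * 1" using y h(3) by (intro mult_mono) (auto simp: K_def)
      finally have "norm (F y) \<le> norm h"
        using norm_triangle_ineq[of h "y o\<^sub>L y"] by (simp add: F_def)
      moreover have "adj_op (F y) = F y"
        using y h AB mult[of y y]
        by (auto simp: F_def K_def adj_op_scaleR adj_op_add bounded_ops_add subset_iff adj_op_compose)
      ultimately show "F y \<in> K"
        using y h sub mult[of y y] by (simp add: F_def K_def subspace_add subspace_scale)
    qed
    fix y z assume yz: "y \<in> K" "z \<in> K"
    have "(y o\<^sub>L y) - (z o\<^sub>L z) = (y o\<^sub>L (y - z)) + ((y - z) o\<^sub>L z)"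
      by (rule blinfun_eqI) (simp add: blinfun.diff_left blinfun.add_left blinfun.diff_right)
    then have "norm ((y o\<^sub>L y) - (z o\<^sub>L z)) \<le> norm (y o\<^sub>L (y - z)) + norm ((y - z) o\<^sub>L z)"
      using norm_triangle_ineq by metis
    also have "\<dots> \<le> norm y * norm (y - z) + norm (y - z) * norm z"
      by (intro add_mono norm_blinfun_compose)
    also have "\<dots> \<le> norm h * norm (y - z) + norm (y - z) * norm h"
      using yz by (intro add_mono mult_left_mono mult_right_mono) (auto simp: K_def)
    finally have "norm ((1/2) *\<^sub>R ((y o\<^sub>L y) - (z o\<^sub>L z))) \<le> norm h * norm (y - z)" by simp
    then show "dist (F y) (F z) \<le> norm h * dist y z"
      by (simp add: F_def dist_norm algebra_simps)
  qed
  then obtain y where "y \<in> K" "F y = y" by blast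
  then have "2 *\<^sub>R y = 2 *\<^sub>R F y" by simp
  then have "2 *\<^sub>R y = h + (y o\<^sub>L y)" by (simp only: F_def) simp
  then show ?thesis using \<open>y \<in> K\<close> by (intro bexI[of _ y]) (auto simp: K_def)
qed

text \<open>Continuity of \<open>\<rho>\<close> is not assumed. For \<open>t > \<parallel>a\<parallel>\<close> the element \<open>1 - a\<^sup>* a / t\<^sup>2\<close> is the
  square of a self-adjoint element of the algebra, hence so is its image \<open>1 - \<rho>(a)\<^sup>* \<rho>(a) / t\<^sup>2\<close>,
  which is therefore positive.\<close>

lemma star_homomorphism_norm_le:
  assumes A: "unital_cstar_algebra A" and B: "B \<subseteq> bounded_ops"
    and \<rho>: "star_homomorphism A B \<rho>" and unit: "\<rho> id_blinfun = id_blinfun" and a: "a \<in> A"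
  shows "norm (\<rho> a) \<le> norm a"
proof -
  have sys: "op_subspace A" and sub: "subspace A" and AB: "A \<subseteq> bounded_ops" and idA: "id_blinfun \<in> A"
    and adjA: "\<And>x. x \<in> A \<Longrightarrow> adj_op x \<in> A"
    and mult: "\<And>x y. x \<in> A \<Longrightarrow> y \<in> A \<Longrightarrow> x o\<^sub>L y \<in> A"
    using A op_subspace_subspace unfolding unital_cstar_algebra_def operator_system_def op_subspace_def
    by blast+
  have \<rho>B: "\<rho> x \<in> bounded_ops" if "x \<in> A" for x using \<rho> B that by (auto simp: star_homomorphism_def)
  have \<rho>add: "\<rho> (x + y) = \<rho> x + \<rho> y" if "x \<in> A" "y \<in> A" for x y
    using \<rho> that by (auto simp: star_homomorphism_def linear_on_ops_def)
  have \<rho>scale: "\<rho> (r *\<^sub>R x) = r *\<^sub>R \<rho> x" if "x \<in> A" for x r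
    using \<rho> that by (auto simp: star_homomorphism_def linear_on_ops_def scaleR_eq_scale_op)
  have \<rho>mult: "\<rho> (x o\<^sub>L y) = \<rho> x o\<^sub>L \<rho> y" if "x \<in> A" "y \<in> A" for x y
    using \<rho> that by (auto simp: star_homomorphism_def)
  have \<rho>adj: "\<rho> (adj_op x) = adj_op (\<rho> x)" if "x \<in> A" for x
    using \<rho> that by (auto simp: star_homomorphism_def)
  have main: "norm (\<rho> a) \<le> t" if t: "t > norm a" for t
  proof (rule norm_blinfun_bound)
    have "t > 0" using t norm_ge_zero[of a] by linarith
    then show "0 \<le> t" by simp
    fix v
    define h where "h = (1 / t\<^sup>2) *\<^sub>R (adj_op a o\<^sub>L a)"
    have aB: "a \<in> bounded_ops" using a AB by auto
    have hA: "h \<in> A" unfolding h_def using a adjA mult sub by (simp add: subspace_scale)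
    have "norm (adj_op a o\<^sub>L a) \<le> norm a * norm a"
      using norm_blinfun_compose[of "adj_op a" a] norm_adj_op_le[OF aB]
      by (meson mult_right_mono norm_ge_zero order_trans)
    also have "\<dots> < t * t" using t by (intro mult_strict_mono') auto
    finally have hn: "norm h < 1" using \<open>t > 0\<close> by (simp add: h_def power2_eq_square)
    have "adj_op h = h"
      using aB by (simp add: h_def adj_op_scaleR bounded_ops_compose adj_op_compose)
    then obtain y where y: "y \<in> A" "adj_op y = y" "h = 2 *\<^sub>R y - (y o\<^sub>L y)"
      using self_adjoint_sqrt[OF A hA _ hn] by blast
    define r where "r = \<rho> y"
    have rB: "r \<in> bounded_ops" and radj: "adj_op r = r"
      using y \<rho>B \<rho>adj by (auto simp: r_def) (metis)
    have "\<rho> h = 2 *\<^sub>R r - (r o\<^sub>L r)"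
      using \<rho>add[of "2 *\<^sub>R y" "(-1) *\<^sub>R (y o\<^sub>L y)"] y sub mult[of y y]
      by (simp add: \<rho>scale \<rho>mult subspace_scale r_def subspace_neg del: scaleR_minus_left)
        (metis \<rho>mult \<rho>scale diff_minus_eq_add minus_diff_eq scaleR_minus1_left uminus_add_conv_diff)
    moreover have "\<rho> h = (1 / t\<^sup>2) *\<^sub>R (adj_op (\<rho> a) o\<^sub>L \<rho> a)"
      using a adjA mult by (simp add: h_def \<rho>scale \<rho>mult \<rho>adj)
    ultimately have eq: "(1 / t\<^sup>2) *\<^sub>R (adj_op (\<rho> a) o\<^sub>L \<rho> a) = 2 *\<^sub>R r - (r o\<^sub>L r)" by simp
    have "cinner v (((1 / t\<^sup>2) *\<^sub>R (adj_op (\<rho> a) o\<^sub>L \<rho> a)) v) = complex_of_real ((1 / t\<^sup>2) * (norm (\<rho> a v))\<^sup>2)"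
      using norm_adj_op_apply_sq[OF \<rho>B[OF a], of v]
      by (simp add: scaleR_blinfun.rep_eq cinner_scaleR_right scaleR_conv_of_real)
    moreover have "cinner v ((2 *\<^sub>R r - (r o\<^sub>L r)) v) = 2 * cinner v (r v) - cinner (r v) (r v)"
      by (simp add: scaleR_blinfun.rep_eq minus_blinfun.rep_eq cinner_scaleR_right cinner_diff_right
          scaleR_conv_of_real cinner_adj_op_right[OF rB, unfolded radj])
    ultimately have "complex_of_real ((1 / t\<^sup>2) * (norm (\<rho> a v))\<^sup>2) = 2 * cinner v (r v) - complex_of_real ((norm (r v))\<^sup>2)"
      using eq cinner_self by metis
    then have "Re (complex_of_real ((1 / t\<^sup>2) * (norm (\<rho> a v))\<^sup>2)) = Re (2 * cinner v (r v) - complex_of_real ((norm (r v))\<^sup>2))"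
      by simp
    then have "(1 / t\<^sup>2) * (norm (\<rho> a v))\<^sup>2 = 2 * Re (cinner v (r v)) - (norm (r v))\<^sup>2" by simp
    \<comment> \<open>Completing the square: this is \<open>\<langle>v, (1 - (1 - r)\<^sup>2) v\<rangle>\<close>.\<close>
    also have "\<dots> = (norm v)\<^sup>2 - (norm (v + scaleC (- 1) (r v)))\<^sup>2"
      unfolding norm_add_scaleC_sq by simp
    also have "\<dots> \<le> (norm v)\<^sup>2" by simp
    finally have "(norm (\<rho> a v))\<^sup>2 \<le> (t * norm v)\<^sup>2"
      using \<open>t > 0\<close> by (simp add: field_simps)
    then show "norm (\<rho> a v) \<le> t * norm v"
      using \<open>t > 0\<close> by (simp add: power2_le_iff_abs_le)
  qed
  show ?thesis
    using main by (meson dense_ge)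
qed

section \<open>Positive operators and extension of positive functionals\<close>

text \<open>Positivity of an operator, expressed by its quadratic form; self-adjointness is a consequence
  (\<open>positive_hermitian\<close>).\<close>

definition op_positive :: "('h::complex_hilbert \<Rightarrow>\<^sub>L 'h) \<Rightarrow> bool" where
  "op_positive a \<longleftrightarrow> (\<forall>v. cinner v (blinfun_apply a v) \<in> \<real>\<^sub>\<ge>\<^sub>0)"

lemma positive_hermitian:
  assumes a: "a \<in> bounded_ops" "op_positive a"
  shows "cinner w (blinfun_apply a v) = cnj (cinner v (blinfun_apply a w))"
proof -
  have real: "cinner u (blinfun_apply a u) \<in> \<real>" for u
    using a(2) by (auto simp: op_positive_def complex_nonneg_Reals_iff complex_is_Real_iff)
  have expand: "cinner (v + scaleC c w) (blinfun_apply a (v + scaleC c w)) =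
      cinner v (blinfun_apply a v) + (c * cinner v (blinfun_apply a w) + cnj c * cinner w (blinfun_apply a v))
       + c * cnj c * cinner w (blinfun_apply a w)" for c
    by (simp add: blinfun.add_right bounded_opsD[OF a(1)] cinner_add_left cinner_add_right
        cinner_scaleC_left cinner_scaleC_right algebra_simps)
  have "c * cinner v (blinfun_apply a w) + cnj c * cinner w (blinfun_apply a v) \<in> \<real>" if "c * cnj c = 1" for c
  proof -
    have "c * cinner v (blinfun_apply a w) + cnj c * cinner w (blinfun_apply a v)
      = cinner (v + scaleC c w) (blinfun_apply a (v + scaleC c w)) - cinner v (blinfun_apply a v) - cinner w (blinfun_apply a w)"
      by (simp add: expand that)
    then show ?thesis by (simp add: real)
  qed
  from this[of 1] this[of \<i>] show ?thesis
    by (auto simp: complex_is_Real_iff complex_eq_iff)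
qed

lemma positive_cauchy_schwarz:
  assumes a: "a \<in> bounded_ops" "op_positive a"
  shows "(cmod (cinner v (blinfun_apply a w)))\<^sup>2 \<le> Re (cinner v (blinfun_apply a v)) * Re (cinner w (blinfun_apply a w))"
proof (rule quadratic_nonneg_imp_cauchy_schwarz)
  show "0 \<le> Re (cinner v (blinfun_apply a v))" "0 \<le> Re (cinner w (blinfun_apply a w))"
    using a(2) by (auto simp: op_positive_def complex_nonneg_Reals_iff)
  fix t
  have real: "Im (cinner u (blinfun_apply a u)) = 0" for u
    using a(2) by (auto simp: op_positive_def complex_nonneg_Reals_iff)
  have "cinner (v + scaleC t w) (blinfun_apply a (v + scaleC t w)) =
      cinner v (blinfun_apply a v) + (t * cinner v (blinfun_apply a w) + cnj (t * cinner v (blinfun_apply a w)))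
       + t * cnj t * cinner w (blinfun_apply a w)"
    by (simp add: blinfun.add_right bounded_opsD[OF a(1)] cinner_add_left cinner_add_right
        cinner_scaleC_left cinner_scaleC_right positive_hermitian[OF a, of w v] algebra_simps)
  then have "Re (cinner (v + scaleC t w) (blinfun_apply a (v + scaleC t w))) =
     Re (cinner v (blinfun_apply a v)) + 2 * Re (t * cinner v (blinfun_apply a w)) + (cmod t)\<^sup>2 * Re (cinner w (blinfun_apply a w))"
    by (simp only: complex_add_cnj complex_norm_square[symmetric]) simp
  moreover have "0 \<le> Re (cinner (v + scaleC t w) (blinfun_apply a (v + scaleC t w)))"
    using a(2) by (auto simp: op_positive_def complex_nonneg_Reals_iff)
  ultimately show "0 \<le> Re (cinner v (blinfun_apply a v)) + 2 * Re (t * cinner v (blinfun_apply a w)) + (cmod t)\<^sup>2 * Re (cinner w (blinfun_apply a w))"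
    by simp
qed

lemma norm_id_minus_positive_le:
  assumes a: "a \<in> bounded_ops" "op_positive a"
  shows "norm (norm a *\<^sub>R id_blinfun - a) \<le> norm a"
proof (rule norm_blinfun_bound)
  fix v
  define t where "t = norm a"
  define b where "b = t *\<^sub>R id_blinfun - a"
  have bB: "b \<in> bounded_ops" by (simp add: b_def bounded_ops_diff bounded_ops_scaleR bounded_ops_id a)
  have bv: "cinner u (blinfun_apply b u) = complex_of_real (t * (norm u)\<^sup>2) - cinner u (blinfun_apply a u)" for u
    by (simp add: b_def blinfun.diff_left scaleR_blinfun.rep_eq cinner_diff_right cinner_scaleR_right
        cinner_self scaleR_conv_of_real)
  have le: "cmod (cinner u (blinfun_apply a u)) \<le> t * (norm u)\<^sup>2" for u
  proof -
    have "cmod (cinner u (blinfun_apply a u)) \<le> norm u * norm (blinfun_apply a u)" by (rule cinner_Cauchy_Schwarz)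
    also have "\<dots> \<le> norm u * (t * norm u)" unfolding t_def by (intro mult_left_mono norm_blinfun) auto
    finally show ?thesis by (simp add: power2_eq_square mult_ac)
  qed
  have bpos: "op_positive b"
    using a(2) le complex_Re_le_cmod order_trans
    unfolding op_positive_def bv complex_nonneg_Reals_iff by fastforce
  have ble: "Re (cinner u (blinfun_apply b u)) \<le> t * (norm u)\<^sup>2" for u
    using a(2) unfolding op_positive_def bv complex_nonneg_Reals_iff by simp
  define w where "w = blinfun_apply b v"
  have "((norm w)\<^sup>2)\<^sup>2 = (cmod (cinner w (blinfun_apply b v)))\<^sup>2"
    by (simp add: w_def cinner_self norm_power)
  also have "\<dots> \<le> Re (cinner w (blinfun_apply b w)) * Re (cinner v (blinfun_apply b v))"
    by (rule positive_cauchy_schwarz[OF bB bpos])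
  also have "\<dots> \<le> (t * (norm w)\<^sup>2) * (t * (norm v)\<^sup>2)"
    using bpos by (intro mult_mono ble) (auto simp: op_positive_def complex_nonneg_Reals_iff t_def)
  finally have "norm w * norm w * (norm w * norm w) \<le> t * norm v * (t * norm v) * (norm w * norm w)"
    by (simp add: power2_eq_square mult_ac)
  then have "w = 0 \<or> norm w * norm w \<le> t * norm v * (t * norm v)"
    by (metis mult_eq_0_iff mult_le_cancel_right norm_eq_zero norm_ge_zero not_less zero_le_mult_iff order_le_less)
  then have "norm w \<le> t * norm v"
  proof
    assume "norm w * norm w \<le> t * norm v * (t * norm v)"
    then have "(norm w)\<^sup>2 \<le> (t * norm v)\<^sup>2" by (simp add: power2_eq_square)
    then show ?thesis by (simp add: power2_le_iff_abs_le t_def)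
  qed (simp add: t_def)
  then show "norm (blinfun_apply (norm a *\<^sub>R id_blinfun - a) v) \<le> norm a * norm v"
    by (simp add: w_def b_def t_def)
qed simp

lemma norm_rotated_positive_le:
  assumes a: "a \<in> bounded_ops" "op_positive a" and c: "c = \<i> \<or> c = - \<i>"
  shows "norm (t *\<^sub>R id_blinfun + scale_op c a) \<le> sqrt (t\<^sup>2 + (norm a)\<^sup>2)"
proof (rule norm_blinfun_bound)
  fix v
  have "Im (cinner v (blinfun_apply a v)) = 0" using a(2) by (auto simp: op_positive_def complex_nonneg_Reals_iff)
  then have "Re (c * cinner (t *\<^sub>R v) (blinfun_apply a v)) = 0"
    using c by (auto simp: cinner_scaleR_left)
  then have "(norm (t *\<^sub>R v + scaleC c (blinfun_apply a v)))\<^sup>2 = t\<^sup>2 * (norm v)\<^sup>2 + (norm (blinfun_apply a v))\<^sup>2"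
    unfolding norm_add_scaleC_sq using c by (auto simp: power_mult_distrib)
  also have "\<dots> \<le> t\<^sup>2 * (norm v)\<^sup>2 + (norm a * norm v)\<^sup>2"
    by (intro add_left_mono power_mono norm_blinfun) auto
  also have "\<dots> = (t\<^sup>2 + (norm a)\<^sup>2) * (norm v)\<^sup>2" by (simp add: power_mult_distrib algebra_simps)
  also have "\<dots> = (sqrt (t\<^sup>2 + (norm a)\<^sup>2) * norm v)\<^sup>2" by (simp add: power_mult_distrib)
  finally show "norm (blinfun_apply (t *\<^sub>R id_blinfun + scale_op c a) v) \<le> sqrt (t\<^sup>2 + (norm a)\<^sup>2) * norm v"
    by (simp add: blinfun.add_left scaleR_blinfun.rep_eq scale_op_apply power2_le_iff_abs_le)
qed simp

text \<open>A functional on a unital subspace that is bounded by its value \<open>C\<close> at the identity extends to a linear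
  functional that is positive on positive operators. With \<open>g\<close> the real part of a norm-preserving
  extension, \<open>\<parallel> \<parallel>x\<parallel> - x \<parallel> \<le> \<parallel>x\<parallel>\<close> gives \<open>g(x) \<ge> 0\<close> for positive \<open>x\<close>, and
  \<open>\<parallel>t + \<i> x\<parallel> \<le> \<surd>(t\<^sup>2 + \<parallel>x\<parallel>\<^sup>2)\<close> gives \<open>g(\<i> x) = 0\<close> on letting \<open>t\<close> tend to infinity.\<close>

lemma positive_functional_extension:
  fixes A :: "('k::complex_hilbert \<Rightarrow>\<^sub>L 'k) set" and f0 :: "('k \<Rightarrow>\<^sub>L 'k) \<Rightarrow> complex"
  assumes A: "op_subspace A" "id_blinfun \<in> A" and C: "C \<ge> 0"
    and add0: "\<And>x y. x \<in> A \<Longrightarrow> y \<in> A \<Longrightarrow> f0 (x + y) = f0 x + f0 y"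
    and scale0: "\<And>c x. x \<in> A \<Longrightarrow> f0 (scale_op c x) = c * f0 x"
    and bound0: "\<And>x. x \<in> A \<Longrightarrow> cmod (f0 x) \<le> C * norm x" and unit0: "f0 id_blinfun = complex_of_real C"
  shows "\<exists>f. (\<forall>x y. f (x + y) = f x + f y) \<and> (\<forall>c x. f (scale_op c x) = c * f x) \<and>
    (\<forall>x\<in>A. f x = f0 x) \<and> (\<forall>x\<in>bounded_ops. op_positive x \<longrightarrow> f x \<in> \<real>\<^sub>\<ge>\<^sub>0)"
proof -
  have sub: "subspace A" using A(1) by (rule op_subspace_subspace)
  have Asc: "scale_op c x \<in> A" if "x \<in> A" for c x using A(1) that by (auto simp: op_subspace_def)
  have f00: "f0 0 = 0" using add0[of 0 0] subspace_0[OF sub] by simp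
  define R0 where "R0 = {(x, Re (f0 x)) | x. x \<in> A}"
  have "subspace R0"
    unfolding subspace_def R0_def
    using subspace_0[OF sub] f00 subspace_add[OF sub] subspace_scale[OF sub] add0 scale0
    by (fastforce simp: zero_prod_def scaleR_eq_scale_op)
  moreover have "r \<le> C * norm x" if "(x, r) \<in> R0" for x r
    using that bound0[of x] complex_Re_le_cmod[of "f0 x"] by (auto simp: R0_def)
  ultimately obtain g where g: "linear g" "\<forall>(x, r) \<in> R0. g x = r" and gC: "\<And>x. g x \<le> C * norm x"
    using hahn_banach_norm[OF C, of R0] by blast
  have gA: "g x = Re (f0 x)" if "x \<in> A" for x using g(2) that by (auto simp: R0_def)
  \<comment> \<open>The complex-linear functional with real part \<open>g\<close>.\<close>
  define f where "f x = Complex (g x) (- g (scale_op \<i> x))" for x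
  have sc: "scale_op c x = Re c *\<^sub>R x + Im c *\<^sub>R scale_op \<i> x" for c and x :: "'k \<Rightarrow>\<^sub>L 'k"
  proof -
    have "c = complex_of_real (Re c) + complex_of_real (Im c) * \<i>" by (simp add: complex_eq_iff)
    then have "scaleC c (blinfun_apply x u) = scaleC (complex_of_real (Re c)) (blinfun_apply x u)
        + scaleC (complex_of_real (Im c)) (scaleC \<i> (blinfun_apply x u))" for u
      by (metis scaleC_add_left scaleC_scaleC)
    then show ?thesis
      by (intro blinfun_eqI)
        (simp add: scale_op_apply blinfun.add_left scaleR_blinfun.rep_eq scaleR_eq_scaleC)
  qed
  have sci: "scale_op \<i> (scale_op c x) = Re c *\<^sub>R scale_op \<i> x - Im c *\<^sub>R x" for c and x :: "'k \<Rightarrow>\<^sub>L 'k"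
  proof -
    have "scale_op \<i> (scale_op c x) = scale_op (\<i> * c) x"
      by (rule blinfun_eqI) (simp add: scale_op_apply scaleC_scaleC)
    then show ?thesis using sc[of "\<i> * c" x] by simp
  qed
  have add: "f (x + y) = f x + f y" for x y
  proof -
    have "scale_op \<i> (x + y) = scale_op \<i> x + scale_op \<i> y"
      by (rule blinfun_eqI) (simp add: scale_op_apply blinfun.add_left scaleC_add_right)
    then show ?thesis using g(1) by (simp add: f_def linear_add complex_eq_iff)
  qed
  have scale: "f (scale_op c x) = c * f x" for c x
  proof -
    have "g (scale_op c x) = Re c * g x + Im c * g (scale_op \<i> x)"
      by (subst sc) (simp add: linear_add[OF g(1)] linear_scale[OF g(1)])
    moreover have "g (scale_op \<i> (scale_op c x)) = Re c * g (scale_op \<i> x) - Im c * g x"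
      by (simp add: sci linear_diff[OF g(1)] linear_scale[OF g(1)])
    ultimately show ?thesis by (simp add: f_def complex_eq_iff)
  qed
  have ext: "f x = f0 x" if "x \<in> A" for x
    using gA[OF that] gA[OF Asc[OF that, of \<i>]] scale0[OF that, of \<i>] by (simp add: f_def complex_eq_iff)
  have gid: "g id_blinfun = C" using gA[OF A(2)] unit0 by simp
  have pos: "f x \<in> \<real>\<^sub>\<ge>\<^sub>0" if x: "x \<in> bounded_ops" "op_positive x" for x
  proof -
    have "g (norm x *\<^sub>R id_blinfun - x) \<le> C * norm x"
      using gC[of "norm x *\<^sub>R id_blinfun - x"] mult_left_mono[OF norm_id_minus_positive_le[OF x] C] by linarith
    then have "g x \<ge> 0" by (simp add: linear_diff[OF g(1)] linear_scale[OF g(1)] gid mult.commute)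
    moreover have "g (scale_op c x) \<le> 0" if c: "c = \<i> \<or> c = - \<i>" for c
    proof (rule ccontr)
      define \<gamma> where "\<gamma> = g (scale_op c x)"
      assume "\<not> g (scale_op c x) \<le> 0"
      then have "\<gamma> > 0" by (simp add: \<gamma>_def)
      \<comment> \<open>\<open>t\<close> is chosen so large that \<open>\<gamma> \<le> C * (norm x)\<^sup>2 / (2 * t)\<close>, proved next, is violated.\<close>
      define t where "t = (C * (norm x)\<^sup>2 + 1) / \<gamma>"
      have "t > 0" using C \<open>\<gamma> > 0\<close> by (simp add: t_def add_nonneg_pos)
      have "t * C + \<gamma> = g (t *\<^sub>R id_blinfun + scale_op c x)"
        by (simp add: linear_add[OF g(1)] linear_scale[OF g(1)] gid \<gamma>_def)
      also have "\<dots> \<le> C * sqrt (t\<^sup>2 + (norm x)\<^sup>2)"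
        using gC mult_left_mono[OF norm_rotated_positive_le[OF x c] C] order_trans by blast
      also have "sqrt (t\<^sup>2 + (norm x)\<^sup>2) \<le> t + (norm x)\<^sup>2 / (2 * t)"
      proof (rule real_le_lsqrt)
        show "t\<^sup>2 + (norm x)\<^sup>2 \<le> (t + (norm x)\<^sup>2 / (2 * t))\<^sup>2"
          using \<open>t > 0\<close> by (simp add: power2_sum)
      qed (use \<open>t > 0\<close> in simp)
      then have "C * sqrt (t\<^sup>2 + (norm x)\<^sup>2) \<le> C * (t + (norm x)\<^sup>2 / (2 * t))"
        using C by (rule mult_left_mono)
      finally have "\<gamma> \<le> C * (norm x)\<^sup>2 / (2 * t)" by (simp add: algebra_simps)
      then have "2 * (\<gamma> * t) \<le> C * (norm x)\<^sup>2" using \<open>t > 0\<close> by (simp add: field_simps)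
      moreover have "\<gamma> * t = C * (norm x)\<^sup>2 + 1" using \<open>\<gamma> > 0\<close> by (simp add: t_def)
      moreover have "0 \<le> C * (norm x)\<^sup>2" using C by simp
      ultimately show False by linarith
    qed
    from this[of \<i>] this[of "- \<i>"] have "g (scale_op \<i> x) = 0"
      using sc[of "- \<i>" x] linear_neg[OF g(1), of "scale_op \<i> x"] by simp
    ultimately show ?thesis by (simp add: f_def complex_nonneg_Reals_iff)
  qed
  show ?thesis using add scale ext pos by blast
qed

section \<open>Completely positive maps from positive kernels\<close>

lemma cinner_bounded_on_dense_imp_norm_le:
  fixes w :: "'h::complex_hilbert"
  assumes dense: "closure D = UNIV" and bound: "\<And>x. x \<in> D \<Longrightarrow> cmod (cinner x w) \<le> M * norm x"
    and M: "M \<ge> 0"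
  shows "norm w \<le> M"
proof -
  have "closed {x. cmod (cinner x w) \<le> M * norm x}"
    by (intro closed_Collect_le continuous_intros continuous_on_cinner)
  then have "closure D \<subseteq> {x. cmod (cinner x w) \<le> M * norm x}"
    using bound by (intro closure_minimal) auto
  then have "cmod (cinner w w) \<le> M * norm w" using dense by auto
  then have "norm w * norm w \<le> M * norm w" by (simp add: cinner_self power2_eq_square norm_mult)
  then show ?thesis using M by (cases "w = 0") auto
qed

lemma eq_if_cinner_eq_on_dense_span:
  fixes w w' :: "'h::complex_hilbert" and v :: "'i \<Rightarrow> 'h"
  assumes dense: "closure {(\<Sum>i\<in>F. scaleC (c i) (v i)) | F c. finite F \<and> F \<subseteq> I} = UNIV"
    and eq: "\<And>i. i \<in> I \<Longrightarrow> cinner (v i) w = cinner (v i) w'"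
  shows "w = w'"
proof -
  let ?D = "{(\<Sum>i\<in>F. scaleC (c i) (v i)) | F c. finite F \<and> F \<subseteq> I}"
  have "norm (w - w') \<le> 0"
  proof (rule cinner_bounded_on_dense_imp_norm_le[OF dense])
    fix x assume "x \<in> ?D"
    then obtain F c where F: "F \<subseteq> I" and x: "x = (\<Sum>i\<in>F. scaleC (c i) (v i))" by blast
    have "cinner (v i) (w - w') = 0" if "i \<in> F" for i
      unfolding cinner_diff_right using eq[of i] F that by (simp add: subset_iff)
    then have "cinner x (w - w') = 0" unfolding x cinner_sum_left cinner_scaleC_left by simp
    then show "cmod (cinner x (w - w')) \<le> 0 * norm x" by simp
  qed simp
  then show ?thesis by simp
qed

lemma bounded_ops_eq_on_dense_span:
  fixes S T :: "'h::complex_hilbert \<Rightarrow>\<^sub>L 'h" and v :: "'i \<Rightarrow> 'h"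
  assumes dense: "closure {(\<Sum>i\<in>F. scaleC (c i) (v i)) | F c. finite F \<and> F \<subseteq> I} = UNIV"
    and S: "S \<in> bounded_ops" and T: "T \<in> bounded_ops"
    and eq: "\<And>i j. i \<in> I \<Longrightarrow> j \<in> I \<Longrightarrow> cinner (v i) (blinfun_apply S (v j)) = cinner (v i) (blinfun_apply T (v j))"
  shows "S = T"
proof -
  let ?D = "{(\<Sum>i\<in>F. scaleC (c i) (v i)) | F c. finite F \<and> F \<subseteq> I}"
  have vj: "blinfun_apply S (v j) = blinfun_apply T (v j)" if j: "j \<in> I" for j
    by (rule eq_if_cinner_eq_on_dense_span[OF dense]) (rule eq[OF _ j])
  have "closed {x. blinfun_apply S x = blinfun_apply T x}"
    by (intro closed_Collect_eq continuous_intros)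
  moreover have "?D \<subseteq> {x. blinfun_apply S x = blinfun_apply T x}"
    using vj by (auto simp: blinfun.sum_right bounded_opsD[OF S] bounded_opsD[OF T] subset_iff intro!: sum.cong)
  ultimately have "closure ?D \<subseteq> {x. blinfun_apply S x = blinfun_apply T x}" by (rule closure_minimal[rotated])
  then show ?thesis using dense by (intro blinfun_eqI) auto
qed

lemma complex_add_cnj_Re: "z + cnj z = complex_of_real (2 * Re z)"
  by (simp add: complex_add_cnj)

text \<open>The matrix with rows \<open>(r, a)\<close> and \<open>(a\<^sup>*, r)\<close> is positive for \<open>r \<ge> \<parallel>a\<parallel>\<close>.\<close>

lemma mat_positive_norm_block:
  fixes a :: "'h::complex_hilbert \<Rightarrow>\<^sub>L 'h"
  assumes a: "a \<in> bounded_ops" and r: "r \<ge> norm a"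
  shows "mat_positive 2 (\<lambda>p q. if p = 0 then (if q = 0 then r *\<^sub>R id_blinfun else a)
      else (if q = 0 then adj_op a else r *\<^sub>R id_blinfun))"
  unfolding mat_positive_def
proof
  fix \<xi> :: "nat \<Rightarrow> 'h"
  define x y where "x = \<xi> 0" and "y = \<xi> 1"
  define z where "z = cinner x (blinfun_apply a y)"
  have "cmod z \<le> norm x * norm (blinfun_apply a y)" unfolding z_def by (rule cinner_Cauchy_Schwarz)
  also have "\<dots> \<le> norm x * (r * norm y)"
    using norm_blinfun[of a y] mult_right_mono[OF r norm_ge_zero[of y]] by (intro mult_left_mono) auto
  finally have zle: "\<bar>Re z\<bar> \<le> norm x * (r * norm y)" using abs_Re_le_cmod order_trans by blast
  have r0: "r \<ge> 0" using r norm_ge_zero order_trans by blast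
  have "0 \<le> r * (norm x - norm y)\<^sup>2" using r0 by simp
  also have "\<dots> = r * (norm x)\<^sup>2 - 2 * (norm x * (r * norm y)) + r * (norm y)\<^sup>2"
    by (simp add: power2_diff algebra_simps)
  finally have "0 \<le> r * (norm x)\<^sup>2 + 2 * Re z + r * (norm y)\<^sup>2" using zle by linarith
  moreover have "(\<Sum>i<2. cinner (\<xi> i) (mat_apply 2 (\<lambda>p q. if p = 0 then (if q = 0 then r *\<^sub>R id_blinfun else a)
      else (if q = 0 then adj_op a else r *\<^sub>R id_blinfun)) \<xi> i))
      = r * cinner x x + (z + cnj z) + r * cinner y y"
    by (simp add: mat_apply_def numeral_2_eq_2 x_def[symmetric] y_def[symmetric] z_def
        scaleR_blinfun.rep_eq cinner_add_right cinner_scaleR_right scaleR_conv_of_real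
        cinner_adj_op_right[OF a] cinner_commute[of "blinfun_apply a y" x] y_def[unfolded One_nat_def, symmetric] add_ac)
  ultimately show "(\<Sum>i<2. cinner (\<xi> i) (mat_apply 2 (\<lambda>p q. if p = 0 then (if q = 0 then r *\<^sub>R id_blinfun else a)
      else (if q = 0 then adj_op a else r *\<^sub>R id_blinfun)) \<xi> i)) \<in> \<real>\<^sub>\<ge>\<^sub>0"
    by (simp only: cinner_self complex_add_cnj_Re flip: of_real_mult of_real_add)
       (simp only: nonneg_Reals_of_real_iff)
qed

lemma cinner_lincomb:
  fixes v w :: "'i \<Rightarrow> 'h::complex_hilbert"
  shows "cinner (\<Sum>i\<in>S. scaleC (c i) (v i)) (\<Sum>j\<in>T. scaleC (d j) (w j))
    = (\<Sum>i\<in>S. \<Sum>j\<in>T. cnj (c i) * d j * cinner (v i) (w j))"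
proof -
  have L: "cinner (\<Sum>i\<in>S. scaleC (c i) (v i)) y = (\<Sum>i\<in>S. cnj (c i) * cinner (v i) y)" for y
    by (simp only: cinner_sum_left cinner_scaleC_left)
  have R: "cinner x (\<Sum>j\<in>T. scaleC (d j) (w j)) = (\<Sum>j\<in>T. d j * cinner x (w j))" for x
    by (simp only: cinner_sum_right cinner_scaleC_right)
  show ?thesis by (subst L) (simp only: R sum_distrib_left mult.assoc)
qed

text \<open>The matrix entries of a unital completely positive map with respect to vectors \<open>v i\<close> with dense span
  may be prescribed by a kernel \<open>F a i j\<close> that is linear in \<open>a\<close>, has the Gram matrix of the \<open>v i\<close> as
  value at the identity, and is positive in the matrix sense. No compatibility of \<open>F\<close> with linear relations
  between the \<open>v i\<close> has to be assumed: positivity at the matrix with rows \<open>(\<parallel>a\<parallel>, a)\<close> and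
  \<open>(a\<^sup>*, \<parallel>a\<parallel>)\<close> yields the bound
  \<open>\<bar>\<Sum> cnj c\<^sub>i d\<^sub>j F(a, i, j)\<bar> \<le> \<parallel>a\<parallel> \<parallel>\<Sum> c\<^sub>i v\<^sub>i\<parallel> \<parallel>\<Sum> d\<^sub>j v\<^sub>j\<parallel>\<close>,
  which contains it.\<close>

lemma ucp_map_from_kernel:
  fixes v :: "'i \<Rightarrow> 'h::complex_hilbert"
    and F :: "('k::complex_hilbert \<Rightarrow>\<^sub>L 'k) \<Rightarrow> 'i \<Rightarrow> 'i \<Rightarrow> complex"
  assumes dense: "closure {(\<Sum>i\<in>S. scaleC (c i) (v i)) | S c. finite S \<and> S \<subseteq> I} = UNIV"
    and add: "\<And>a b i j. a \<in> bounded_ops \<Longrightarrow> b \<in> bounded_ops \<Longrightarrow> i \<in> I \<Longrightarrow> j \<in> I \<Longrightarrow> F (a + b) i j = F a i j + F b i j"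
    and scale: "\<And>c a i j. a \<in> bounded_ops \<Longrightarrow> i \<in> I \<Longrightarrow> j \<in> I \<Longrightarrow> F (scale_op c a) i j = c * F a i j"
    and unit: "\<And>i j. i \<in> I \<Longrightarrow> j \<in> I \<Longrightarrow> F id_blinfun i j = cinner (v i) (v j)"
    and pos: "\<And>n a S c. a \<in> mat_over n bounded_ops \<Longrightarrow> mat_positive n a \<Longrightarrow> finite S \<Longrightarrow> S \<subseteq> I \<Longrightarrow>
      (\<Sum>p<n. \<Sum>q<n. \<Sum>i\<in>S. \<Sum>j\<in>S. cnj (c p i) * c q j * F (a p q) i j) \<in> \<real>\<^sub>\<ge>\<^sub>0"
  shows "\<exists>\<Phi>. \<Phi> ` bounded_ops \<subseteq> bounded_ops \<and> linear_on_ops bounded_ops \<Phi> \<and> \<Phi> id_blinfun = id_blinfun \<and>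
    completely_positive_on bounded_ops \<Phi> \<and>
    (\<forall>a\<in>bounded_ops. \<forall>i\<in>I. \<forall>j\<in>I. cinner (v i) (blinfun_apply (\<Phi> a) (v j)) = F a i j)"
proof -
  define comb where "comb S c = (\<Sum>i\<in>S. scaleC (c i) (v i))" for S c
  define Q where "Q a S c T d = (\<Sum>i\<in>S. \<Sum>j\<in>T. cnj (c i) * d j * F a i j)" for a S c T d
  let ?D = "{(\<Sum>i\<in>S. scaleC (c i) (v i)) | S c. finite S \<and> S \<subseteq> I}"
  have ext_comb: "comb S c = comb U (\<lambda>i. if i \<in> S then c i else 0)" if "finite U" "S \<subseteq> U" for S U c
    unfolding comb_def using that by (intro sum.mono_neutral_cong_left) auto
  have ext_Q: "Q a S c T d = Q a U (\<lambda>i. if i \<in> S then c i else 0) U (\<lambda>i. if i \<in> T then d i else 0)"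
    if "finite U" "S \<subseteq> U" "T \<subseteq> U" for a S c T d U
    unfolding Q_def using that
    by (intro sum.mono_neutral_cong_left) (auto intro!: sum.mono_neutral_cong_left)
  have Q_id: "Q id_blinfun S c S c = complex_of_real ((norm (comb S c))\<^sup>2)" if "S \<subseteq> I" for S c
  proof -
    have "Q id_blinfun S c S c = cinner (comb S c) (comb S c)"
      unfolding Q_def comb_def cinner_lincomb
      using that by (intro sum.cong) (auto simp: unit subset_iff)
    then show ?thesis by (simp only: cinner_self)
  qed
  have bound1: "cmod (Q a S c S d) \<le> norm a * norm (comb S c) * norm (comb S d)"
    if a: "a \<in> bounded_ops" and S: "finite S" "S \<subseteq> I" for a S c d
  proof -
    define r where "r = norm a"
    define m where "m = (\<lambda>(p :: nat) (q :: nat). if p = 0 then (if q = 0 then r *\<^sub>R id_blinfun else a)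
      else (if q = 0 then adj_op a else r *\<^sub>R id_blinfun))"
    have m: "mat_positive 2 m" "m \<in> mat_over 2 bounded_ops"
      unfolding m_def
      using mat_positive_norm_block[OF a, of r] a
      by (auto simp: r_def mat_over_def bounded_ops_scaleR bounded_ops_id)
    define B B' where "B = Q a S c S d" and "B' = Q (adj_op a) S d S c"
    define k where "k t = r * (norm (comb S c))\<^sup>2 + (cmod t)\<^sup>2 * (r * (norm (comb S d))\<^sup>2)" for t
    have main: "complex_of_real (k t) + (t * B + cnj t * B') \<in> \<real>\<^sub>\<ge>\<^sub>0" for t
    proof -
      define e where "e = (\<lambda>p :: nat. if p = 0 then c else (\<lambda>i. t * d i))"
      have rid: "F (r *\<^sub>R id_blinfun) i j = r * F id_blinfun i j" if "i \<in> I" "j \<in> I" for i j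
        using scale[OF bounded_ops_id that] by (simp add: scaleR_eq_scale_op)
      have pull: "(\<Sum>i\<in>S. \<Sum>j\<in>S. cnj (x * f i) * (y * g j) * F b i j) = cnj x * y * Q b S f S g" for x y f g b
        by (simp add: Q_def sum_distrib_left mult_ac)
      have pullr: "(\<Sum>i\<in>S. \<Sum>j\<in>S. cnj (f i) * g j * F (r *\<^sub>R id_blinfun) i j) = r * Q id_blinfun S f S g" for f g
        unfolding Q_def sum_distrib_left using S(2)
        by (intro sum.cong) (auto simp: rid subset_iff)
      have "(\<Sum>p<2. \<Sum>q<2. \<Sum>i\<in>S. \<Sum>j\<in>S. cnj (e p i) * e q j * F (m p q) i j)
        = r * Q id_blinfun S c S c + t * B + cnj t * B' + r * Q id_blinfun S (\<lambda>i. t * d i) S (\<lambda>i. t * d i)"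
        using pull[of 1 c t d a] pull[of t d 1 c "adj_op a"] pullr[of "\<lambda>i. t * d i" "\<lambda>i. t * d i"]
        by (simp add: numeral_2_eq_2 e_def m_def B_def B'_def pullr add_ac)
      also have "Q id_blinfun S (\<lambda>i. t * d i) S (\<lambda>i. t * d i) = cnj t * t * Q id_blinfun S d S d"
        using pull[of t d t d id_blinfun] by (simp add: Q_def)
      also have "cnj t * t = complex_of_real ((cmod t)\<^sup>2)"
        by (metis complex_norm_square mult.commute of_real_power)
      finally have "(\<Sum>p<2. \<Sum>q<2. \<Sum>i\<in>S. \<Sum>j\<in>S. cnj (e p i) * e q j * F (m p q) i j)
        = complex_of_real (k t) + (t * B + cnj t * B')"
        by (simp add: Q_id[OF S(2)] k_def mult_ac)
      then show ?thesis using pos[OF m(2,1) S, of e] by simp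
    qed
    have "complex_of_real (k t) + (t * B + cnj t * B') \<in> \<real>" for t
      using main[of t] nonneg_Reals_subset_Reals by blast
    then have im: "Im (t * B + cnj t * B') = 0" for t
      using main[of t] by (simp add: complex_is_Real_iff)
    have B': "B' = cnj B"
      using im[of 1] im[of \<i>] by (simp add: complex_eq_iff)
    have "(cmod B)\<^sup>2 \<le> (r * (norm (comb S c))\<^sup>2) * (r * (norm (comb S d))\<^sup>2)"
    proof (rule quadratic_nonneg_imp_cauchy_schwarz)
      show "0 \<le> r * (norm (comb S c))\<^sup>2 + 2 * Re (t * B) + (cmod t)\<^sup>2 * (r * (norm (comb S d))\<^sup>2)" for t
        using main[of t] by (simp add: B' k_def complex_nonneg_Reals_iff mult.commute add_ac)
    qed (auto simp: r_def)
    also have "\<dots> = (norm a * norm (comb S c) * norm (comb S d))\<^sup>2"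
      by (simp add: r_def power2_eq_square mult_ac)
    finally show ?thesis by (simp add: B_def power2_le_iff_abs_le)
  qed
  have bound: "cmod (Q a S c T d) \<le> norm a * norm (comb S c) * norm (comb T d)"
    if a: "a \<in> bounded_ops" and S: "finite S" "S \<subseteq> I" and T: "finite T" "T \<subseteq> I" for a S c T d
    using bound1[OF a, of "S \<union> T" "\<lambda>i. if i \<in> S then c i else 0" "\<lambda>i. if i \<in> T then d i else 0"] S T
      ext_Q[of "S \<union> T" S T a c d] ext_comb[of "S \<union> T" S c] ext_comb[of "S \<union> T" T d] by simp
  \<comment> \<open>First the adjoint operator is found on each \<open>v i\<close>, as the vector \<open>u i\<close>; then the operator
    itself is found on an arbitrary vector \<open>\<eta>\<close>, as \<open>W \<eta>\<close>.\<close>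
  have "\<exists>T\<in>bounded_ops. \<forall>i\<in>I. \<forall>j\<in>I. cinner (v i) (blinfun_apply T (v j)) = F a i j"
    if a: "a \<in> bounded_ops" for a
  proof -
    have "\<exists>u. \<forall>j\<in>I. cinner (v j) u = cnj (F a i j)" if i: "i \<in> I" for i
    proof (rule riesz_representation_on_family[of "norm a * norm (v i)"])
      fix S d assume S: "finite S" "S \<subseteq> I"
      have "(\<Sum>j\<in>S. cnj (d j) * cnj (F a i j)) = cnj (Q a {i} (\<lambda>_. 1) S d)"
        by (simp add: Q_def)
      then show "cmod (\<Sum>j\<in>S. cnj (d j) * cnj (F a i j)) \<le> norm a * norm (v i) * norm (\<Sum>j\<in>S. scaleC (d j) (v j))"
        using bound[OF a, of "{i}" S "\<lambda>_. 1" d] i S by (simp add: comb_def)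
    qed simp
    then obtain u where u: "\<And>i j. i \<in> I \<Longrightarrow> j \<in> I \<Longrightarrow> cinner (v j) (u i) = cnj (F a i j)" by metis
    have u_norm: "norm (\<Sum>i\<in>S. scaleC (c i) (u i)) \<le> norm a * norm (comb S c)"
      if S: "finite S" "S \<subseteq> I" for S c
    proof (rule cinner_bounded_on_dense_imp_norm_le[OF dense])
      fix x assume "x \<in> ?D"
      then obtain T d where T: "finite T" "T \<subseteq> I" and x: "x = comb T d" by (auto simp: comb_def)
      have "cinner x (\<Sum>i\<in>S. scaleC (c i) (u i)) = (\<Sum>i\<in>S. \<Sum>j\<in>T. cnj (d j) * (c i * cnj (F a i j)))"
        unfolding x comb_def cinner_lincomb
        by (subst sum.swap, intro sum.cong) (use S T u in \<open>auto simp: subset_iff\<close>)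
      also have "\<dots> = cnj (Q a S c T d)" by (simp add: Q_def mult_ac)
      finally show "cmod (cinner x (\<Sum>i\<in>S. scaleC (c i) (u i))) \<le> norm a * norm (comb S c) * norm x"
        using bound[OF a S T, of c d] by (simp add: x)
    qed simp
    have eta: "cmod (\<Sum>i\<in>S. cnj (c i) * cinner (u i) \<eta>) \<le> norm a * norm \<eta> * norm (comb S c)"
      if S: "finite S" "S \<subseteq> I" for S c \<eta>
    proof -
      have "(\<Sum>i\<in>S. cnj (c i) * cinner (u i) \<eta>) = cinner (\<Sum>i\<in>S. scaleC (c i) (u i)) \<eta>"
        by (simp add: cinner_sum_left cinner_scaleC_left)
      also have "cmod \<dots> \<le> norm (\<Sum>i\<in>S. scaleC (c i) (u i)) * norm \<eta>" by (rule cinner_Cauchy_Schwarz)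
      also have "\<dots> \<le> norm a * norm (comb S c) * norm \<eta>" by (intro mult_right_mono u_norm S) simp
      finally show ?thesis by (simp add: mult_ac)
    qed
    have "\<exists>w. \<forall>i\<in>I. cinner (v i) w = cinner (u i) \<eta>" for \<eta>
      by (rule riesz_representation_on_family[of "norm a * norm \<eta>"]) (use eta in \<open>auto simp: comb_def\<close>)
    then obtain W where W: "\<And>\<eta> i. i \<in> I \<Longrightarrow> cinner (v i) (W \<eta>) = cinner (u i) \<eta>" by metis
    have W_norm: "norm (W \<eta>) \<le> norm a * norm \<eta>" for \<eta>
    proof (rule cinner_bounded_on_dense_imp_norm_le[OF dense])
      fix x assume "x \<in> ?D"
      then obtain S c where S: "finite S" "S \<subseteq> I" and x: "x = comb S c" by (auto simp: comb_def)
      have "cinner x (W \<eta>) = (\<Sum>i\<in>S. cnj (c i) * cinner (u i) \<eta>)"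
        unfolding x comb_def cinner_sum_left cinner_scaleC_left
        using S W by (intro sum.cong) auto
      then show "cmod (cinner x (W \<eta>)) \<le> norm a * norm \<eta> * norm x"
        using eta[OF S] x by simp
    qed simp
    note uniq = eq_if_cinner_eq_on_dense_span[OF dense]
    have "\<exists>T\<in>bounded_ops. \<forall>x. blinfun_apply T x = W x"
    proof (rule bounded_op_from_function)
      show "W (x + y) = W x + W y" for x y by (rule uniq) (simp add: W cinner_add_right)
      show "W (scaleC c x) = scaleC c (W x)" for c x by (rule uniq) (simp add: W cinner_scaleC_right)
    qed (rule W_norm)
    then obtain T where T: "T \<in> bounded_ops" "\<And>x. blinfun_apply T x = W x" by blast
    have "cinner (v i) (blinfun_apply T (v j)) = F a i j" if "i \<in> I" "j \<in> I" for i j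
      using W[OF that(1), of "v j"] u[OF that] cinner_commute[of "u i" "v j"] by (simp add: T(2))
    then show ?thesis using T(1) by blast
  qed
  then obtain \<Phi> where \<Phi>B: "\<And>a. a \<in> bounded_ops \<Longrightarrow> \<Phi> a \<in> bounded_ops"
    and \<Phi>F: "\<And>a i j. a \<in> bounded_ops \<Longrightarrow> i \<in> I \<Longrightarrow> j \<in> I \<Longrightarrow> cinner (v i) (blinfun_apply (\<Phi> a) (v j)) = F a i j"
    by metis
  note uniq = bounded_ops_eq_on_dense_span[OF dense]
  have "\<Phi> (a + b) = \<Phi> a + \<Phi> b" if "a \<in> bounded_ops" "b \<in> bounded_ops" for a b
    by (rule uniq) (use that in \<open>auto simp: bounded_ops_add \<Phi>B \<Phi>F add blinfun.add_left cinner_add_right\<close>)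
  moreover have "\<Phi> (scale_op c a) = scale_op c (\<Phi> a)" if "a \<in> bounded_ops" for a c
    by (rule uniq) (use that in \<open>auto simp: bounded_ops_scale_op \<Phi>B \<Phi>F scale scale_op_apply cinner_scaleC_right\<close>)
  ultimately have lin: "linear_on_ops bounded_ops \<Phi>" by (simp add: linear_on_ops_def)
  have id: "\<Phi> id_blinfun = id_blinfun"
    by (rule uniq) (auto simp: bounded_ops_id \<Phi>B \<Phi>F unit)
  have "completely_positive_on bounded_ops \<Phi>"
    unfolding completely_positive_on_def
  proof (intro allI ballI impI)
    fix n and a :: "nat \<Rightarrow> nat \<Rightarrow> ('k \<Rightarrow>\<^sub>L 'k)"
    assume a: "a \<in> mat_over n bounded_ops" "mat_positive n a"
    show "mat_positive n (\<lambda>i j. \<Phi> (a i j))"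
      unfolding mat_positive_def
    proof
      fix \<xi> :: "nat \<Rightarrow> 'h"
      define D where "D = ?D"
      have "\<xi> p \<in> closure D" for p using dense by (simp add: D_def)
      then have "\<exists>x. (\<forall>m. x m \<in> D) \<and> x \<longlonglongrightarrow> \<xi> p" for p
        unfolding closure_sequential by blast
      then obtain x where xD: "\<And>p m. x p m \<in> D" and xlim: "\<And>p. x p \<longlonglongrightarrow> \<xi> p" by metis
      have step: "(\<Sum>p<n. cinner (x p m) (mat_apply n (\<lambda>i j. \<Phi> (a i j)) (\<lambda>p. x p m) p)) \<in> \<real>\<^sub>\<ge>\<^sub>0" for m
      proof -
        have "\<exists>S c. finite S \<and> S \<subseteq> I \<and> x p m = comb S c" for p using xD[of p m] unfolding D_def comb_def by blast
        then obtain S c where S: "\<And>p. finite (S p)" "\<And>p. S p \<subseteq> I" and x: "\<And>p. x p m = comb (S p) (c p)" by metis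
        \<comment> \<open>The approximating vectors are rewritten over one common finite index set.\<close>
        define U where "U = (\<Union>p<n. S p)"
        define e where "e p i = (if i \<in> S p then c p i else 0)" for p i
        have U: "finite U" "U \<subseteq> I" using S by (auto simp: U_def)
        have xe: "x p m = comb U (e p)" if "p < n" for p
        proof -
          have "e p = (\<lambda>i. if i \<in> S p then c p i else 0)" by (simp add: e_def fun_eq_iff)
          moreover have "S p \<subseteq> U" using that by (auto simp: U_def)
          ultimately show ?thesis using ext_comb[OF U(1), of "S p" "c p"] x[of p] by simp
        qed
        have "cinner (x p m) (mat_apply n (\<lambda>i j. \<Phi> (a i j)) (\<lambda>p. x p m) p)
          = (\<Sum>q<n. \<Sum>i\<in>U. \<Sum>j\<in>U. cnj (e p i) * e q j * F (a p q) i j)" if p: "p < n" for p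
        proof -
          have "cinner (x p m) (blinfun_apply (\<Phi> (a p q)) (x q m)) = (\<Sum>i\<in>U. \<Sum>j\<in>U. cnj (e p i) * e q j * F (a p q) i j)"
            if q: "q < n" for q
          proof -
            have apq: "a p q \<in> bounded_ops" using a p q by (simp add: mat_over_def)
            show ?thesis
              unfolding xe[OF p] xe[OF q] comb_def blinfun.sum_right bounded_opsD[OF \<Phi>B[OF apq]]
                cinner_lincomb
              using U apq by (intro sum.cong) (auto simp: \<Phi>F subset_iff)
          qed
          then show ?thesis by (simp add: mat_apply_def cinner_sum_right)
        qed
        then show ?thesis using pos[OF a U, of e] by simp
      qed
      have "(\<lambda>m. \<Sum>p<n. cinner (x p m) (mat_apply n (\<lambda>i j. \<Phi> (a i j)) (\<lambda>p. x p m) p))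
         \<longlonglongrightarrow> (\<Sum>p<n. cinner (\<xi> p) (mat_apply n (\<lambda>i j. \<Phi> (a i j)) \<xi> p))"
        unfolding mat_apply_def
        by (intro tendsto_sum tendsto_cinner xlim blinfun.tendsto tendsto_const)
      from closed_sequentially[OF closed_nonneg_Reals_complex step this]
      show "(\<Sum>p<n. cinner (\<xi> p) (mat_apply n (\<lambda>i j. \<Phi> (a i j)) \<xi> p)) \<in> \<real>\<^sub>\<ge>\<^sub>0" .
    qed
  qed
  then show ?thesis using lin id \<Phi>B \<Phi>F by blast
qed

section \<open>Unitary representations and the group C*-algebra\<close>

lemma unitary_rep_bounded_ops: "unitary_rep G \<pi> \<Longrightarrow> g \<in> carrier G \<Longrightarrow> \<pi> g \<in> bounded_ops"
  unfolding unitary_rep_def hom_def unitary_group_def by auto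

lemma unitary_rep_mult:
  "unitary_rep G \<pi> \<Longrightarrow> g \<in> carrier G \<Longrightarrow> h \<in> carrier G \<Longrightarrow> \<pi> (g \<otimes>\<^bsub>G\<^esub> h) = \<pi> g o\<^sub>L \<pi> h"
  unfolding unitary_rep_def hom_def unitary_group_def by auto

lemma blinfun_compose_id: "id_blinfun o\<^sub>L T = T" "T o\<^sub>L id_blinfun = T"
  by (rule blinfun_eqI, simp)+

lemma blinfun_compose_assoc: "(R o\<^sub>L S) o\<^sub>L T = R o\<^sub>L (S o\<^sub>L T)"
  by (rule blinfun_eqI) simp

lemma unitary_rep_one:
  assumes "group G" "unitary_rep G \<pi>"
  shows "\<pi> \<one>\<^bsub>G\<^esub> = id_blinfun"
proof -
  interpret group G by fact
  let ?U = "\<pi> \<one>\<^bsub>G\<^esub>"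
  have "adj_op ?U o\<^sub>L ?U = id_blinfun"
    using assms(2) unfolding unitary_rep_def hom_def unitary_group_def by auto
  moreover have "?U o\<^sub>L ?U = ?U" using unitary_rep_mult[OF assms(2) one_closed one_closed] by simp
  ultimately show ?thesis by (metis blinfun_compose_assoc blinfun_compose_id(1))
qed

lemma unitary_rep_inv:
  assumes "group G" "unitary_rep G \<pi>" "g \<in> carrier G"
  shows "\<pi> (inv\<^bsub>G\<^esub> g) o\<^sub>L \<pi> g = id_blinfun" "\<pi> g o\<^sub>L \<pi> (inv\<^bsub>G\<^esub> g) = id_blinfun"
    "\<pi> (inv\<^bsub>G\<^esub> g) = adj_op (\<pi> g)"
proof -
  interpret group G by fact
  show 1: "\<pi> (inv\<^bsub>G\<^esub> g) o\<^sub>L \<pi> g = id_blinfun"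
    using unitary_rep_mult[OF assms(2), of "inv\<^bsub>G\<^esub> g" g] assms unitary_rep_one[OF assms(1,2)] by simp
  show "\<pi> g o\<^sub>L \<pi> (inv\<^bsub>G\<^esub> g) = id_blinfun"
    using unitary_rep_mult[OF assms(2), of g "inv\<^bsub>G\<^esub> g"] assms unitary_rep_one[OF assms(1,2)] by simp
  have "\<pi> g o\<^sub>L adj_op (\<pi> g) = id_blinfun"
    using assms unfolding unitary_rep_def hom_def unitary_group_def by auto
  then show "\<pi> (inv\<^bsub>G\<^esub> g) = adj_op (\<pi> g)"
    using 1 by (metis blinfun_compose_assoc blinfun_compose_id)
qed

lemma cinner_unitary_rep_left:
  assumes "group G" "unitary_rep G \<pi>" "g \<in> carrier G"
  shows "cinner (blinfun_apply (\<pi> g) x) y = cinner x (blinfun_apply (\<pi> (inv\<^bsub>G\<^esub> g)) y)"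
  by (simp add: unitary_rep_inv(3)[OF assms] cinner_adj_op_right unitary_rep_bounded_ops[OF assms(2,3)])

lemma gamma_operator_system_bounded_ops:
  assumes "group G" "unitary_rep G \<pi>"
  shows "gamma_operator_system G \<pi> bounded_ops"
proof -
  interpret group G by fact
  show ?thesis
    using unitary_rep_bounded_ops[OF assms(2)]
    by (auto simp: gamma_operator_system_def operator_system_def op_subspace_def closed_bounded_ops
        bounded_ops_zero bounded_ops_add bounded_ops_scale_op bounded_ops_id rep_act_def bounded_ops_compose)
qed

lemma scale_op_add_left: "scale_op (c + d) T = scale_op c T + scale_op d T"
  by (rule blinfun_eqI) (simp add: scale_op_apply blinfun.add_left scaleC_add_left)

lemma scale_op_add_right: "scale_op c (S + T) = scale_op c S + scale_op c T"
  by (rule blinfun_eqI) (simp add: scale_op_apply blinfun.add_left scaleC_add_right)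

lemma scale_op_scale_op: "scale_op c (scale_op d T) = scale_op (c * d) T"
  by (rule blinfun_eqI) (simp add: scale_op_apply scaleC_scaleC)

lemma scale_op_sum: "scale_op c (\<Sum>i\<in>S. f i) = (\<Sum>i\<in>S. scale_op c (f i))"
  by (rule blinfun_eqI) (simp add: scale_op_apply blinfun.sum_left scaleC_sum_right)

lemma scale_op_one: "scale_op 1 T = T"
  by (rule blinfun_eqI) (simp add: scale_op_apply)

lemma norm_scale_op_le: "norm (scale_op c T) \<le> cmod c * norm T"
  by (rule norm_blinfun_bound)
     (simp_all add: scale_op_apply norm_scaleC mult.assoc mult_left_mono norm_blinfun)

lemma bounded_linear_scale_op: "bounded_linear (scale_op c)"
  by (rule bounded_linear_intro[where K = "cmod c"])
     (simp_all add: scale_op_add_right norm_scale_op_le mult.commute scaleR_eq_scale_op scale_op_scale_op)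

lemma unital_cstar_algebra_group_Cstar:
  assumes G: "group G" and \<pi>: "unitary_rep G \<pi>"
  shows "unital_cstar_algebra (group_Cstar G \<pi>)"
    and "g \<in> carrier G \<Longrightarrow> \<pi> g \<in> group_Cstar G \<pi>"
proof -
  interpret group G by fact
  define D where "D = {\<Sum>g\<in>F. scale_op (c g) (\<pi> g) | F c. finite F \<and> F \<subseteq> carrier G}"
  have A: "group_Cstar G \<pi> = closure D" by (simp add: group_Cstar_def D_def)
  have DB: "D \<subseteq> bounded_ops"
    by (auto simp: D_def intro!: bounded_ops_sum bounded_ops_scale_op unitary_rep_bounded_ops[OF \<pi>])
  then have AB: "closure D \<subseteq> bounded_ops" by (rule closure_minimal) (rule closed_bounded_ops)
  have D0: "0 \<in> D" unfolding D_def by (rule CollectI, rule exI[of _ "{}"]) simp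
  have Dadd: "x + y \<in> D" if xy: "x \<in> D" "y \<in> D" for x y
  proof -
    obtain S c T d where S: "finite S" "S \<subseteq> carrier G" "x = (\<Sum>g\<in>S. scale_op (c g) (\<pi> g))"
      and T: "finite T" "T \<subseteq> carrier G" "y = (\<Sum>g\<in>T. scale_op (d g) (\<pi> g))"
      using xy unfolding D_def by blast
    have "x + y = (\<Sum>g\<in>S \<union> T. scale_op ((if g \<in> S then c g else 0) + (if g \<in> T then d g else 0)) (\<pi> g))"
      unfolding S T
      by (rule sum_Un_additive[OF S(1) T(1), of "\<lambda>g a. scale_op a (\<pi> g)", symmetric]) (rule scale_op_add_left)
    then show ?thesis unfolding D_def using S(1,2) T(1,2)
      by (intro CollectI exI[of _ "S \<union> T"]
          exI[of _ "\<lambda>g. (if g \<in> S then c g else 0) + (if g \<in> T then d g else 0)"]) simp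
  qed
  have Dscale: "scale_op k x \<in> D" if x: "x \<in> D" for k x
  proof -
    obtain S c where S: "finite S" "S \<subseteq> carrier G" "x = (\<Sum>g\<in>S. scale_op (c g) (\<pi> g))"
      using x unfolding D_def by blast
    have "scale_op k x = (\<Sum>g\<in>S. scale_op (k * c g) (\<pi> g))" by (simp add: S scale_op_sum scale_op_scale_op)
    then show ?thesis unfolding D_def using S(1,2)
      by (intro CollectI exI[of _ S] exI[of _ "\<lambda>g. k * c g"]) simp
  qed
  have Dgen: "\<pi> g \<in> D" if "g \<in> carrier G" for g
    unfolding D_def using that
    by (intro CollectI exI[of _ "{g}"] exI[of _ "\<lambda>_. 1"]) (simp add: scale_op_one)
  have Dsum: "(\<Sum>i\<in>S. f i) \<in> D" if "\<And>i. i \<in> S \<Longrightarrow> f i \<in> D" for S and f :: "'x \<Rightarrow> _"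
    using that by (induction S rule: infinite_finite_induct) (auto simp: D0 Dadd)
  have Dmult: "x o\<^sub>L y \<in> D" if xy: "x \<in> D" "y \<in> D" for x y
  proof -
    obtain S c T d where S: "finite S" "S \<subseteq> carrier G" "x = (\<Sum>g\<in>S. scale_op (c g) (\<pi> g))"
      and T: "finite T" "T \<subseteq> carrier G" "y = (\<Sum>g\<in>T. scale_op (d g) (\<pi> g))"
      using xy unfolding D_def by blast
    have "x o\<^sub>L y = (\<Sum>g\<in>S. \<Sum>h\<in>T. scale_op (c g) (\<pi> g) o\<^sub>L scale_op (d h) (\<pi> h))"
      unfolding S T
      by (rule blinfun_eqI) (simp add: blinfun.sum_left blinfun.sum_right, rule sum.swap)
    also have "\<dots> = (\<Sum>g\<in>S. \<Sum>h\<in>T. scale_op (c g * d h) (\<pi> (g \<otimes>\<^bsub>G\<^esub> h)))"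
    proof (intro sum.cong refl)
      fix g h assume "g \<in> S" "h \<in> T"
      then have gh: "g \<in> carrier G" "h \<in> carrier G" using S T by auto
      show "scale_op (c g) (\<pi> g) o\<^sub>L scale_op (d h) (\<pi> h) = scale_op (c g * d h) (\<pi> (g \<otimes>\<^bsub>G\<^esub> h))"
        by (rule blinfun_eqI)
          (simp add: scale_op_apply unitary_rep_mult[OF \<pi> gh] scaleC_scaleC
            bounded_opsD[OF unitary_rep_bounded_ops[OF \<pi> gh(1)]])
    qed
    also have "\<dots> \<in> D" using S T by (intro Dsum Dscale Dgen m_closed) auto
    finally show ?thesis .
  qed
  have Dadj: "adj_op x \<in> D" if x: "x \<in> D" for x
  proof -
    obtain S c where S: "finite S" "S \<subseteq> carrier G" "x = (\<Sum>g\<in>S. scale_op (c g) (\<pi> g))"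
      using x unfolding D_def by blast
    have "adj_op x = (\<Sum>g\<in>S. adj_op (scale_op (c g) (\<pi> g)))"
      unfolding S using S by (intro adj_op_sum bounded_ops_scale_op unitary_rep_bounded_ops[OF \<pi>]) auto
    also have "\<dots> = (\<Sum>g\<in>S. scale_op (cnj (c g)) (\<pi> (inv\<^bsub>G\<^esub> g)))"
      using S(2) by (intro sum.cong)
        (auto simp: adj_op_scale_op unitary_rep_bounded_ops[OF \<pi>] unitary_rep_inv(3)[OF G \<pi>] subset_iff)
    also have "\<dots> \<in> D" using S by (intro Dsum Dscale Dgen) auto
    finally show ?thesis .
  qed
  have cl2: "\<exists>f. (\<forall>n. f n \<in> D) \<and> f \<longlonglongrightarrow> x" if "x \<in> closure D" for x
    using that closure_sequential[of x D] by simp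
  have clI: "x \<in> closure D" if "\<And>n. f n \<in> D" "f \<longlonglongrightarrow> x" for f x
    using that closure_sequential[of x D] by blast
  have "operator_system (closure D)"
    unfolding operator_system_def op_subspace_def
  proof (intro conjI ballI allI)
    show "closure D \<subseteq> bounded_ops" by (rule AB)
    show "0 \<in> closure D" using D0 closure_subset by blast
    show "id_blinfun \<in> closure D"
      using Dgen[OF one_closed] closure_subset unitary_rep_one[OF G \<pi>] by auto
    show "closed (closure D)" by simp
  next
    fix x y assume "x \<in> closure D" "y \<in> closure D"
    then obtain f h where "\<forall>n. f n \<in> D" "f \<longlonglongrightarrow> x" "\<forall>n. h n \<in> D" "h \<longlonglongrightarrow> y" using cl2 by metis
    then show "x + y \<in> closure D" by (intro clI[of "\<lambda>n. f n + h n"] tendsto_add Dadd) auto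
  next
    fix c x assume "x \<in> closure D"
    then obtain f where "\<forall>n. f n \<in> D" "f \<longlonglongrightarrow> x" using cl2 by metis
    then show "scale_op c x \<in> closure D"
      by (intro clI[of "\<lambda>n. scale_op c (f n)"] bounded_linear.tendsto[OF bounded_linear_scale_op] Dscale) auto
  next
    fix x assume x: "x \<in> closure D"
    then obtain f where "\<forall>n. f n \<in> D" "f \<longlonglongrightarrow> x" using cl2 by metis
    then show "adj_op x \<in> closure D"
      using DB AB x by (intro clI[of "\<lambda>n. adj_op (f n)"] tendsto_adj_op Dadj) auto
  qed
  moreover have "x o\<^sub>L y \<in> closure D" if xy: "x \<in> closure D" "y \<in> closure D" for x y
  proof -
    obtain f h where "\<forall>n. f n \<in> D" "f \<longlonglongrightarrow> x" "\<forall>n. h n \<in> D" "h \<longlonglongrightarrow> y" using cl2 xy by metis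
    then show ?thesis
      by (intro clI[of "\<lambda>n. f n o\<^sub>L h n"] bounded_bilinear.tendsto[OF bounded_bilinear_blinfun_compose] Dmult) auto
  qed
  ultimately show "unital_cstar_algebra (group_Cstar G \<pi>)" by (simp add: unital_cstar_algebra_def A)
  show "g \<in> carrier G \<Longrightarrow> \<pi> g \<in> group_Cstar G \<pi>" using Dgen closure_subset A by blast
qed

section \<open>Orthogonal families of cyclic subspaces\<close>

lemma subspace_closure:
  fixes S :: "'a::real_normed_vector set"
  assumes S: "subspace S"
  shows "subspace (closure S)"
  unfolding subspace_def
proof (intro conjI ballI allI)
  show "0 \<in> closure S" using subspace_0[OF S] closure_subset by blast
next
  fix x y assume "x \<in> closure S" "y \<in> closure S"
  then obtain f h where "\<forall>n. f n \<in> S" "f \<longlonglongrightarrow> x" "\<forall>n. h n \<in> S" "h \<longlonglongrightarrow> y"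
    unfolding closure_sequential by blast
  then have "(\<forall>n. f n + h n \<in> S) \<and> (\<lambda>n. f n + h n) \<longlonglongrightarrow> x + y"
    using subspace_add[OF S] tendsto_add by blast
  then show "x + y \<in> closure S"
    unfolding closure_sequential by (intro exI[of _ "\<lambda>n. f n + h n"])
next
  fix c :: real and x assume "x \<in> closure S"
  then obtain f where "\<forall>n. f n \<in> S" "f \<longlonglongrightarrow> x" unfolding closure_sequential by blast
  then have "(\<forall>n. c *\<^sub>R f n \<in> S) \<and> (\<lambda>n. c *\<^sub>R f n) \<longlonglongrightarrow> c *\<^sub>R x"
    using subspace_scale[OF S] tendsto_scaleR[OF tendsto_const] by blast
  then show "c *\<^sub>R x \<in> closure S"
    unfolding closure_sequential by (intro exI[of _ "\<lambda>n. c *\<^sub>R f n"])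
qed

text \<open>The span is closed under complex scalars, so orthogonality for the real inner product improves to
  orthogonality for the complex one.\<close>

lemma complex_orthogonal_complement:
  fixes v :: "'i \<Rightarrow> 'h::complex_hilbert"
  assumes "closure {(\<Sum>i\<in>S. scaleC (c i) (v i)) | S c. finite S \<and> S \<subseteq> I} \<noteq> UNIV"
  shows "\<exists>w. w \<noteq> 0 \<and> (\<forall>i\<in>I. cinner (v i) w = 0)"
proof -
  define D where "D = {(\<Sum>i\<in>S. scaleC (c i) (v i)) | S c. finite S \<and> S \<subseteq> I}"
  have "D = fst ` {(\<Sum>i\<in>S. scaleC (c i) (v i), Re (\<Sum>i\<in>S. cnj (c i) * 0)) | S c. finite S \<and> S \<subseteq> I}"
    unfolding D_def by force
  then have "subspace D"
    using linear_subspace_image[OF bounded_linear.linear[OF bounded_linear_fst]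
        linear_combinations_subspace[of v "\<lambda>_. 0" I]] by simp
  then have sub: "subspace (closure D)" by (rule subspace_closure)
  obtain x where x: "x \<notin> closure D" using assms unfolding D_def by blast
  obtain m where m: "m \<in> closure D" "\<And>u. u \<in> closure D \<Longrightarrow> Re (cinner u (x - m)) = 0"
    using orthogonal_projection_exists[OF sub closed_closure] by blast
  have *: "Re (cnj a * cinner (v i) (x - m)) = 0" if i: "i \<in> I" for a i
  proof -
    have "scaleC a (v i) \<in> D"
      unfolding D_def using i by (intro CollectI exI[of _ "{i}"] exI[of _ "\<lambda>_. a"]) simp
    then have "scaleC a (v i) \<in> closure D" using closure_subset by blast
    from m(2)[OF this] show ?thesis by (simp only: cinner_scaleC_left)
  qed
  have "cinner (v i) (x - m) = 0" if "i \<in> I" for i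
    using *[OF that, of 1] *[OF that, of "\<i>"] by (simp add: complex_eq_iff)
  moreover have "x - m \<noteq> 0" using x m by auto
  ultimately show ?thesis by blast
qed

text \<open>A maximal set \<open>X\<close> generating pairwise orthogonal cyclic subspaces is total. The zero vector is not
  excluded from \<open>X\<close>.\<close>

lemma cyclic_decomposition:
  fixes \<pi> :: "'g \<Rightarrow> ('h::complex_hilbert \<Rightarrow>\<^sub>L 'h)"
  assumes G: "group G" and \<pi>: "unitary_rep G \<pi>"
  shows "\<exists>X. (\<forall>x\<in>X. \<forall>y\<in>X. x \<noteq> y \<longrightarrow> (\<forall>g\<in>carrier G. cinner (blinfun_apply (\<pi> g) x) y = 0)) \<and>
    closure {(\<Sum>i\<in>S. scaleC (c i) (blinfun_apply (\<pi> (fst i)) (snd i))) | S c. finite S \<and> S \<subseteq> carrier G \<times> X} = UNIV"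
proof -
  interpret group G by fact
  define P where "P = {X. \<forall>x\<in>X. \<forall>y\<in>X. x \<noteq> y \<longrightarrow> (\<forall>g\<in>carrier G. cinner (blinfun_apply (\<pi> g) x) y = 0)}"
  have "\<exists>M\<in>P. \<forall>X\<in>P. M \<subseteq> X \<longrightarrow> X = M"
  proof (rule subset_Zorn_nonempty)
    show "P \<noteq> {}" by (auto simp: P_def)
    fix C assume "C \<noteq> {}" and C: "subset.chain P C"
    show "\<Union>C \<in> P"
      unfolding P_def
    proof (intro CollectI ballI impI)
      fix x y g assume "x \<in> \<Union>C" "y \<in> \<Union>C" and xy: "x \<noteq> y" and g: "g \<in> carrier G"
      then obtain A B where "A \<in> C" "B \<in> C" "x \<in> A" "y \<in> B" by blast
      moreover have "A \<subseteq> B \<or> B \<subseteq> A" using C \<open>A \<in> C\<close> \<open>B \<in> C\<close> by (auto simp: subset_chain_def)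
      ultimately obtain D where "D \<in> C" "x \<in> D" "y \<in> D" by blast
      moreover have "D \<in> P" using \<open>D \<in> C\<close> C by (auto simp: subset_chain_def)
      ultimately show "cinner (blinfun_apply (\<pi> g) x) y = 0" using xy g by (simp add: P_def)
    qed
  qed
  then obtain X where X: "X \<in> P" and max: "\<And>Y. Y \<in> P \<Longrightarrow> X \<subseteq> Y \<Longrightarrow> Y = X" by blast
  have "closure {(\<Sum>i\<in>S. scaleC (c i) (blinfun_apply (\<pi> (fst i)) (snd i))) | S c. finite S \<and> S \<subseteq> carrier G \<times> X} = UNIV"
  proof (rule ccontr)
    assume "\<not> ?thesis"
    from complex_orthogonal_complement[OF this]
    obtain w where w0: "w \<noteq> 0" and w: "\<And>g x. g \<in> carrier G \<Longrightarrow> x \<in> X \<Longrightarrow> cinner (blinfun_apply (\<pi> g) x) w = 0"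
      by fastforce
    have w': "cinner (blinfun_apply (\<pi> g) w) x = 0" if "g \<in> carrier G" "x \<in> X" for g x
      using w[of "inv\<^bsub>G\<^esub> g" x] that cinner_commute
      by (metis cinner_unitary_rep_left[OF G \<pi>] complex_cnj_zero inv_closed)
    \<comment> \<open>A nonzero vector orthogonal to the whole span could be added to \<open>X\<close>.\<close>
    have "insert w X \<in> P"
      using X w w' by (auto simp: P_def)
    then have "w \<in> X" using max[of "insert w X"] by blast
    then have "cinner w w = 0"
      using w[of "\<one>\<^bsub>G\<^esub>" w] unitary_rep_one[OF G \<pi>] by simp
    then show False using w0 by (simp add: cinner_self_eq_0)
  qed
  then show ?thesis using X unfolding P_def by blast
qed

section \<open>Equivariant maps from weak containment\<close>

lemma nonneg_Reals_sum: "(\<And>x. x \<in> A \<Longrightarrow> f x \<in> \<real>\<^sub>\<ge>\<^sub>0) \<Longrightarrow> (\<Sum>x\<in>A. f x) \<in> (\<real>\<^sub>\<ge>\<^sub>0 :: complex set)"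
  by (induction A rule: infinite_finite_induct) (auto intro: nonneg_Reals_add_I)

text \<open>The kernel \<open>F\<close> below is positive because, for each \<open>x\<close>, a positive matrix \<open>(a\<^sub>p\<^sub>q)\<close> compressed
  by operators \<open>b\<^sub>p\<close> in the span of \<open>\<sigma>(\<Gamma>)\<close> gives a positive operator
  \<open>T x = \<Sum> b\<^sub>p\<^sup>* a\<^sub>p\<^sub>q b\<^sub>q\<close>, to which the positive functional \<open>f x\<close> is applied.\<close>

lemma gamma_map_from_weak_containment:
  fixes \<pi> :: "'g \<Rightarrow> ('h::complex_hilbert \<Rightarrow>\<^sub>L 'h)" and \<sigma> :: "'g \<Rightarrow> ('k::complex_hilbert \<Rightarrow>\<^sub>L 'k)"
  assumes G: "group G" and \<pi>: "unitary_rep G \<pi>" and \<sigma>: "unitary_rep G \<sigma>" and wc: "weakly_contained G \<pi> \<sigma>"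
  shows "\<exists>\<Phi>. gamma_map G \<sigma> bounded_ops \<pi> bounded_ops \<Phi>"
proof -
  interpret group G by fact
  note \<sigma>B = unitary_rep_bounded_ops[OF \<sigma>]
  let ?A = "group_Cstar G \<sigma>" and ?B = "group_Cstar G \<pi>"
  have A: "unital_cstar_algebra ?A" and Agen: "\<And>g. g \<in> carrier G \<Longrightarrow> \<sigma> g \<in> ?A"
    using unital_cstar_algebra_group_Cstar[OF G \<sigma>] by blast+
  have BB: "?B \<subseteq> bounded_ops"
    using unital_cstar_algebra_group_Cstar(1)[OF G \<pi>]
    by (simp add: unital_cstar_algebra_def operator_system_def op_subspace_def)
  have Asub: "op_subspace ?A" "id_blinfun \<in> ?A"
    using A by (auto simp: unital_cstar_algebra_def operator_system_def)
  obtain \<rho> where \<rho>: "star_homomorphism ?A ?B \<rho>" and \<rho>\<sigma>: "\<And>g. g \<in> carrier G \<Longrightarrow> \<rho> (\<sigma> g) = \<pi> g"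
    using wc by (auto simp: weakly_contained_def)
  have \<rho>id: "\<rho> id_blinfun = id_blinfun"
    using \<rho>\<sigma>[OF one_closed] by (simp add: unitary_rep_one[OF G \<sigma>] unitary_rep_one[OF G \<pi>])
  note \<rho>norm = star_homomorphism_norm_le[OF A BB \<rho> \<rho>id]
  have "\<exists>f. (\<forall>x y. f (x + y) = f x + f y) \<and> (\<forall>c x. f (scale_op c x) = c * f x) \<and>
    (\<forall>a\<in>?A. f a = cinner x (blinfun_apply (\<rho> a) x)) \<and> (\<forall>a\<in>bounded_ops. op_positive a \<longrightarrow> f a \<in> \<real>\<^sub>\<ge>\<^sub>0)" for x
  proof (rule positive_functional_extension[OF Asub, of "(norm x)\<^sup>2"])
    show "cmod (cinner x (blinfun_apply (\<rho> a) x)) \<le> (norm x)\<^sup>2 * norm a" if a: "a \<in> ?A" for a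
    proof -
      have "cmod (cinner x (blinfun_apply (\<rho> a) x)) \<le> norm x * norm (blinfun_apply (\<rho> a) x)"
        by (rule cinner_Cauchy_Schwarz)
      also have "\<dots> \<le> norm x * (norm (\<rho> a) * norm x)" by (intro mult_left_mono norm_blinfun) simp
      also have "\<dots> \<le> norm x * (norm a * norm x)"
        using \<rho>norm[OF a] by (intro mult_left_mono mult_right_mono) auto
      finally show ?thesis by (simp add: power2_eq_square mult_ac)
    qed
  qed (use \<rho> in \<open>auto simp: star_homomorphism_def linear_on_ops_def blinfun.add_left cinner_add_right
        scale_op_apply cinner_scaleC_right \<rho>id cinner_self\<close>)
  then obtain f where f_add: "\<And>x a b. f x (a + b) = f x a + f x b"
    and f_scale: "\<And>x c a. f x (scale_op c a) = c * f x a"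
    and f_ext: "\<And>x a. a \<in> ?A \<Longrightarrow> f x a = cinner x (blinfun_apply (\<rho> a) x)"
    and f_pos: "\<And>x a. a \<in> bounded_ops \<Longrightarrow> op_positive a \<Longrightarrow> f x a \<in> \<real>\<^sub>\<ge>\<^sub>0"
    by metis
  have f_zero: "f x 0 = 0" for x using f_add[of x 0 0] by simp
  have f_sum: "f x (\<Sum>i\<in>S. a i) = (\<Sum>i\<in>S. f x (a i))" for x S and a :: "'z \<Rightarrow> _"
    by (induction S rule: infinite_finite_induct) (auto simp: f_zero f_add)
  obtain X where X0: "\<forall>x\<in>X. \<forall>y\<in>X. x \<noteq> y \<longrightarrow> (\<forall>g\<in>carrier G. cinner (blinfun_apply (\<pi> g) x) y = 0)"
    and dense: "closure {(\<Sum>i\<in>S. scaleC (c i) (blinfun_apply (\<pi> (fst i)) (snd i))) | S c. finite S \<and> S \<subseteq> carrier G \<times> X} = UNIV"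
    using cyclic_decomposition[OF G \<pi>] by (elim exE conjE) (rule that)
  have X: "cinner (blinfun_apply (\<pi> g) x) y = 0" if "x \<in> X" "y \<in> X" "x \<noteq> y" "g \<in> carrier G" for x y g
    using X0 that by simp
  \<comment> \<open>An index \<open>(g, x)\<close> stands for the vector \<open>\<pi>(g) x\<close>.\<close>
  define I where "I = carrier G \<times> X"
  define v where "v i = blinfun_apply (\<pi> (fst i)) (snd i)" for i :: "'g \<times> 'h"
  define K where "K a i j = \<sigma> (inv\<^bsub>G\<^esub> (fst i)) o\<^sub>L a o\<^sub>L \<sigma> (fst j)" for a and i j :: "'g \<times> 'h"
  define F where "F a i j = (if snd i = snd j then f (snd i) (K a i j) else 0)" for a i j
  have K_add: "K (a + b) i j = K a i j + K b i j" for a b i j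
    unfolding K_def by (rule blinfun_eqI) (simp add: blinfun.add_left blinfun.add_right)
  have K_scale: "K (scale_op c a) i j = scale_op c (K a i j)" if "i \<in> I" for c a i j
    unfolding K_def using that
    by (intro blinfun_eqI) (auto simp: I_def scale_op_apply bounded_opsD[OF \<sigma>B])
  have "\<exists>\<Phi>. \<Phi> ` bounded_ops \<subseteq> bounded_ops \<and> linear_on_ops bounded_ops \<Phi> \<and> \<Phi> id_blinfun = id_blinfun \<and>
    completely_positive_on bounded_ops \<Phi> \<and>
    (\<forall>a\<in>bounded_ops. \<forall>i\<in>I. \<forall>j\<in>I. cinner (v i) (blinfun_apply (\<Phi> a) (v j)) = F a i j)"
  proof (rule ucp_map_from_kernel)
    show "closure {(\<Sum>i\<in>S. scaleC (c i) (v i)) | S c. finite S \<and> S \<subseteq> I} = UNIV"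
      using dense unfolding v_def I_def .
    show "F (a + b) i j = F a i j + F b i j" for a b i j by (simp add: F_def K_add f_add)
    show "F (scale_op c a) i j = c * F a i j" if "i \<in> I" for c a i j
      by (simp add: F_def K_scale[OF that] f_scale)
    show "F id_blinfun i j = cinner (v i) (v j)" if ij: "i \<in> I" "j \<in> I" for i j
    proof -
      obtain g x h y where i: "i = (g, x)" "g \<in> carrier G" "x \<in> X" and j: "j = (h, y)" "h \<in> carrier G" "y \<in> X"
        using ij by (auto simp: I_def)
      have K: "K id_blinfun i j = \<sigma> (inv\<^bsub>G\<^esub> g \<otimes>\<^bsub>G\<^esub> h)"
        using i j by (simp add: K_def unitary_rep_mult[OF \<sigma>] blinfun_compose_id)
      have "cinner (v i) (v j) = cinner x (blinfun_apply (\<pi> (inv\<^bsub>G\<^esub> g \<otimes>\<^bsub>G\<^esub> h)) y)"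
        using i j by (simp add: v_def cinner_unitary_rep_left[OF G \<pi>] unitary_rep_mult[OF \<pi>])
      also have "\<dots> = F id_blinfun i j"
      proof (cases "x = y")
        case True
        then show ?thesis unfolding F_def K using i j by (simp add: f_ext Agen \<rho>\<sigma>)
      next
        case False
        have "cinner x (blinfun_apply (\<pi> (inv\<^bsub>G\<^esub> g \<otimes>\<^bsub>G\<^esub> h)) y)
            = cnj (cinner (blinfun_apply (\<pi> (inv\<^bsub>G\<^esub> g \<otimes>\<^bsub>G\<^esub> h)) y) x)"
          by (rule cinner_commute)
        also have "\<dots> = 0" using X[of y x] i j False by simp
        finally show ?thesis using False i j by (simp add: F_def)
      qed
      finally show ?thesis by simp
    qed
    fix n and a :: "nat \<Rightarrow> nat \<Rightarrow> ('k \<Rightarrow>\<^sub>L 'k)" and S and c :: "nat \<Rightarrow> 'g \<times> 'h \<Rightarrow> complex"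
    assume a: "a \<in> mat_over n bounded_ops" "mat_positive n a" and S: "finite S" "S \<subseteq> I"
    \<comment> \<open>The part of the coefficients that belongs to the cyclic subspace of \<open>x\<close>.\<close>
    define e where "e x p i = (if snd i = x then c p i else 0)" for x p i
    define T where "T x = (\<Sum>p<n. \<Sum>q<n. \<Sum>i\<in>S. \<Sum>j\<in>S. scale_op (cnj (e x p i) * e x q j) (K (a p q) i j))" for x
    have aB: "a p q \<in> bounded_ops" if "p < n" "q < n" for p q using a(1) that by (simp add: mat_over_def)
    have SG: "fst i \<in> carrier G" if "i \<in> S" for i using S(2) that by (auto simp: I_def)
    have TB: "T x \<in> bounded_ops" for x
      unfolding T_def K_def
      by (intro bounded_ops_sum bounded_ops_scale_op bounded_ops_compose aB \<sigma>B SG inv_closed) auto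
    have Tpos: "op_positive (T x)" for x
      unfolding op_positive_def
    proof
      fix w
      define b where "b p = (\<Sum>i\<in>S. scaleC (e x p i) (blinfun_apply (\<sigma> (fst i)) w))" for p
      have "cinner (b p) (blinfun_apply (a p q) (b q))
        = (\<Sum>i\<in>S. \<Sum>j\<in>S. cnj (e x p i) * e x q j * cinner w (blinfun_apply (K (a p q) i j) w))"
        if pq: "p < n" "q < n" for p q
      proof -
        have "blinfun_apply (a p q) (b q) = (\<Sum>j\<in>S. scaleC (e x q j) (blinfun_apply (a p q) (blinfun_apply (\<sigma> (fst j)) w)))"
          unfolding b_def by (simp add: blinfun.sum_right bounded_opsD[OF aB[OF pq]])
        then have "cinner (b p) (blinfun_apply (a p q) (b q))
          = (\<Sum>i\<in>S. \<Sum>j\<in>S. cnj (e x p i) * e x q j *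
              cinner (blinfun_apply (\<sigma> (fst i)) w) (blinfun_apply (a p q) (blinfun_apply (\<sigma> (fst j)) w)))"
          unfolding b_def by (simp only: cinner_lincomb)
        also have "\<dots> = (\<Sum>i\<in>S. \<Sum>j\<in>S. cnj (e x p i) * e x q j * cinner w (blinfun_apply (K (a p q) i j) w))"
          by (intro sum.cong) (auto simp: K_def cinner_unitary_rep_left[OF G \<sigma>] SG)
        finally show ?thesis .
      qed
      then have "(\<Sum>p<n. cinner (b p) (mat_apply n a b p)) = cinner w (blinfun_apply (T x) w)"
        by (simp add: mat_apply_def T_def cinner_sum_right blinfun.sum_left scale_op_apply cinner_scaleC_right)
      then show "cinner w (blinfun_apply (T x) w) \<in> \<real>\<^sub>\<ge>\<^sub>0"
        using a(2) unfolding mat_positive_def by metis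
    qed
    have "(\<Sum>x\<in>snd ` S. f x (T x)) \<in> \<real>\<^sub>\<ge>\<^sub>0"
      by (intro nonneg_Reals_sum f_pos TB Tpos)
    also have "(\<Sum>x\<in>snd ` S. f x (T x))
      = (\<Sum>x\<in>snd ` S. \<Sum>p<n. \<Sum>q<n. \<Sum>i\<in>S. \<Sum>j\<in>S. cnj (e x p i) * e x q j * f x (K (a p q) i j))"
      by (simp add: T_def f_sum f_scale)
    also have "\<dots> = (\<Sum>p<n. \<Sum>q<n. \<Sum>i\<in>S. \<Sum>j\<in>S. \<Sum>x\<in>snd ` S. cnj (e x p i) * e x q j * f x (K (a p q) i j))"
      by (simp only: sum.swap[of _ _ "snd ` S"])
    also have "\<dots> = (\<Sum>p<n. \<Sum>q<n. \<Sum>i\<in>S. \<Sum>j\<in>S. cnj (c p i) * c q j * F (a p q) i j)"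
    proof (intro sum.cong refl)
      fix p q i j assume ij: "i \<in> S" "j \<in> S"
      have "(\<Sum>x\<in>snd ` S. cnj (e x p i) * e x q j * f x (K (a p q) i j))
        = (\<Sum>x\<in>snd ` S. if snd i = x then cnj (c p i) * c q j * F (a p q) i j else 0)"
        by (intro sum.cong) (auto simp: e_def F_def)
      also have "\<dots> = cnj (c p i) * c q j * F (a p q) i j"
        using S(1) ij by (simp add: sum.delta)
      finally show "(\<Sum>x\<in>snd ` S. cnj (e x p i) * e x q j * f x (K (a p q) i j)) = cnj (c p i) * c q j * F (a p q) i j" .
    qed
    finally show "(\<Sum>p<n. \<Sum>q<n. \<Sum>i\<in>S. \<Sum>j\<in>S. cnj (c p i) * c q j * F (a p q) i j) \<in> \<real>\<^sub>\<ge>\<^sub>0" .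
  qed
  then obtain \<Phi> where \<Phi>B: "\<Phi> ` bounded_ops \<subseteq> bounded_ops" and lin: "linear_on_ops bounded_ops \<Phi>"
    and id: "\<Phi> id_blinfun = id_blinfun" and cp: "completely_positive_on bounded_ops \<Phi>"
    and \<Phi>F: "\<And>a i j. a \<in> bounded_ops \<Longrightarrow> i \<in> I \<Longrightarrow> j \<in> I \<Longrightarrow> cinner (v i) (blinfun_apply (\<Phi> a) (v j)) = F a i j"
    by blast
  have "\<Phi> (rep_act G \<sigma> s a) = rep_act G \<pi> s (\<Phi> a)" if s: "s \<in> carrier G" and a: "a \<in> bounded_ops" for s a
  proof (rule bounded_ops_eq_on_dense_span[OF dense])
    have act: "rep_act G \<sigma> s a \<in> bounded_ops"
      using s a by (simp add: rep_act_def bounded_ops_compose \<sigma>B)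
    then show "\<Phi> (rep_act G \<sigma> s a) \<in> bounded_ops" using \<Phi>B by blast
    show "rep_act G \<pi> s (\<Phi> a) \<in> bounded_ops"
      using s a \<Phi>B by (auto simp: rep_act_def bounded_ops_compose unitary_rep_bounded_ops[OF \<pi>])
    fix i j assume ij: "i \<in> carrier G \<times> X" "j \<in> carrier G \<times> X"
    obtain g x h y where i: "i = (g, x)" "g \<in> carrier G" "x \<in> X" and j: "j = (h, y)" "h \<in> carrier G" "y \<in> X"
      using ij by auto
    \<comment> \<open>The action of \<open>s\<close> on operators amounts to translating both indices by the inverse of \<open>s\<close>.\<close>
    define i' j' where "i' = (inv\<^bsub>G\<^esub> s \<otimes>\<^bsub>G\<^esub> g, x)" and "j' = (inv\<^bsub>G\<^esub> s \<otimes>\<^bsub>G\<^esub> h, y)"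
    have i'j': "i' \<in> I" "j' \<in> I" using i j s by (auto simp: i'_def j'_def I_def)
    have "K (rep_act G \<sigma> s a) i j = K a i' j'"
      using i j s
      by (simp add: K_def i'_def j'_def rep_act_def unitary_rep_mult[OF \<sigma>] inv_mult_group blinfun_compose_assoc)
    then have "F (rep_act G \<sigma> s a) i j = F a i' j'"
      unfolding F_def by (simp only:) (simp add: i j i'_def j'_def)
    then have "cinner (v i) (blinfun_apply (\<Phi> (rep_act G \<sigma> s a)) (v j)) = cinner (v i') (blinfun_apply (\<Phi> a) (v j'))"
      using ij i'j' act a by (simp add: \<Phi>F I_def)
    also have "\<dots> = cinner (v i) (blinfun_apply (rep_act G \<pi> s (\<Phi> a)) (v j))"
      using i j s by (simp add: v_def i'_def j'_def rep_act_def unitary_rep_mult[OF \<pi>]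
          cinner_unitary_rep_left[OF G \<pi>])
    finally show "cinner (blinfun_apply (\<pi> (fst i)) (snd i)) (blinfun_apply (\<Phi> (rep_act G \<sigma> s a)) (blinfun_apply (\<pi> (fst j)) (snd j)))
      = cinner (blinfun_apply (\<pi> (fst i)) (snd i)) (blinfun_apply (rep_act G \<pi> s (\<Phi> a)) (blinfun_apply (\<pi> (fst j)) (snd j)))"
      by (simp add: v_def)
  qed
  then show ?thesis
    using \<Phi>B lin id cp gamma_operator_system_bounded_ops[OF G \<pi>] gamma_operator_system_bounded_ops[OF G \<sigma>]
    unfolding gamma_map_def by blast
qed

section \<open>Completely positive maps are completely contractive\<close>

lemma mat_apply_norm_le:
  "\<exists>K\<ge>0. \<forall>\<xi>. L2_set (\<lambda>i. norm (mat_apply n a \<xi> i)) {..<n} \<le> K * L2_set (\<lambda>j. norm (\<xi> j)) {..<n}"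
proof (intro exI conjI allI)
  show "0 \<le> (\<Sum>i<n. \<Sum>j<n. norm (a i j))" by (intro sum_nonneg) auto
  fix \<xi>
  have "L2_set (\<lambda>i. norm (mat_apply n a \<xi> i)) {..<n} \<le> (\<Sum>i<n. norm (mat_apply n a \<xi> i))"
    by (rule L2_set_le_sum) auto
  also have "\<dots> \<le> (\<Sum>i<n. \<Sum>j<n. norm (a i j) * L2_set (\<lambda>j. norm (\<xi> j)) {..<n})"
    unfolding mat_apply_def
  proof (intro sum_mono order_trans[OF norm_sum])
    fix i j assume "j \<in> {..<n}"
    then have "norm (\<xi> j) \<le> L2_set (\<lambda>j. norm (\<xi> j)) {..<n}" by (intro member_le_L2_set) auto
    then show "norm (blinfun_apply (a i j) (\<xi> j)) \<le> norm (a i j) * L2_set (\<lambda>j. norm (\<xi> j)) {..<n}"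
      by (meson mult_left_mono norm_blinfun norm_ge_zero order_trans)
  qed
  finally show "L2_set (\<lambda>i. norm (mat_apply n a \<xi> i)) {..<n}
      \<le> (\<Sum>i<n. \<Sum>j<n. norm (a i j)) * L2_set (\<lambda>j. norm (\<xi> j)) {..<n}"
    by (simp add: sum_distrib_right)
qed

lemma mat_norm_le:
  assumes "r \<ge> 0" and "\<And>\<xi>. L2_set (\<lambda>i. norm (mat_apply n a \<xi> i)) {..<n} \<le> r * L2_set (\<lambda>j. norm (\<xi> j)) {..<n}"
  shows "mat_norm n a \<le> r"
  unfolding mat_norm_def
proof (rule cSUP_least)
  have "(\<lambda>_. 0) \<in> {\<xi>. L2_set (\<lambda>j. norm (\<xi> j :: 'a)) {..<n} \<le> 1}" by (simp add: L2_set_def)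
  then show "{\<xi>. L2_set (\<lambda>j. norm (\<xi> j :: 'a)) {..<n} \<le> 1} \<noteq> {}" by (metis empty_iff)
  fix \<xi> :: "nat \<Rightarrow> 'a" assume "\<xi> \<in> {\<xi>. L2_set (\<lambda>j. norm (\<xi> j)) {..<n} \<le> 1}"
  then have "r * L2_set (\<lambda>j. norm (\<xi> j)) {..<n} \<le> r * 1" using assms(1) by (intro mult_left_mono) auto
  then show "L2_set (\<lambda>i. norm (mat_apply n a \<xi> i)) {..<n} \<le> r" using assms(2)[of \<xi>] by simp
qed

lemma mat_norm_upper:
  fixes \<xi> :: "nat \<Rightarrow> 'a::complex_hilbert"
  assumes "L2_set (\<lambda>j. norm (\<xi> j)) {..<n} \<le> 1"
  shows "L2_set (\<lambda>i. norm (mat_apply n a \<xi> i)) {..<n} \<le> mat_norm n a"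
  unfolding mat_norm_def
proof (rule cSUP_upper)
  show "\<xi> \<in> {\<xi>. L2_set (\<lambda>j. norm (\<xi> j)) {..<n} \<le> 1}" using assms by simp
  obtain K where K: "K \<ge> 0"
    "\<forall>\<xi>. L2_set (\<lambda>i. norm (mat_apply n a \<xi> i)) {..<n} \<le> K * L2_set (\<lambda>j. norm (\<xi> j)) {..<n}"
    using mat_apply_norm_le[of n a] by (elim exE conjE) (rule that)
  show "bdd_above ((\<lambda>\<xi>. L2_set (\<lambda>i. norm (mat_apply n a \<xi> i)) {..<n}) ` {\<xi>. L2_set (\<lambda>j. norm (\<xi> j)) {..<n} \<le> 1})"
  proof (rule bdd_aboveI2)
    fix \<zeta> :: "nat \<Rightarrow> 'a" assume "\<zeta> \<in> {\<xi>. L2_set (\<lambda>j. norm (\<xi> j)) {..<n} \<le> 1}"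
    then have "K * L2_set (\<lambda>j. norm (\<zeta> j)) {..<n} \<le> K * 1" using K(1) by (intro mult_left_mono) auto
    then show "L2_set (\<lambda>i. norm (mat_apply n a \<zeta> i)) {..<n} \<le> K"
      using K(2)[rule_format, of \<zeta>] by simp
  qed
qed

lemma mat_norm_nonneg: "mat_norm n a \<ge> 0"
  using mat_norm_upper[of "\<lambda>_. 0" n a] by (simp add: L2_set_def mat_apply_def)

lemma mat_norm_bound:
  "L2_set (\<lambda>i. norm (mat_apply n a \<xi> i)) {..<n} \<le> mat_norm n a * L2_set (\<lambda>j. norm (\<xi> j)) {..<n}"
proof -
  define l where "l = L2_set (\<lambda>j. norm (\<xi> j)) {..<n}"
  define m where "m = L2_set (\<lambda>i. norm (mat_apply n a \<xi> i)) {..<n}"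
  have scaled: "L2_set (\<lambda>j. norm (t *\<^sub>R \<xi> j)) {..<n} = \<bar>t\<bar> * l"
    "L2_set (\<lambda>i. norm (mat_apply n a (\<lambda>j. t *\<^sub>R \<xi> j) i)) {..<n} = \<bar>t\<bar> * m" for t
    by (simp_all add: l_def m_def L2_set_right_distrib mat_apply_def blinfun.scaleR_right
        flip: scaleR_sum_right)
  have l0: "l \<ge> 0" by (simp add: l_def)
  have le: "\<bar>t\<bar> * m \<le> mat_norm n a" if "\<bar>t\<bar> * l \<le> 1" for t
    using mat_norm_upper[of "\<lambda>j. t *\<^sub>R \<xi> j" n a] that by (simp only: scaled)
  show ?thesis
  proof (cases "l = 0")
    case True
    have "m \<le> 0"
    proof (rule ccontr)
      assume "\<not> m \<le> 0"
      then show False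
        using le[of "(mat_norm n a + 1) / m"] True mat_norm_nonneg[of n a] by (simp add: field_simps)
    qed
    then show ?thesis using True by (simp add: l_def m_def)
  next
    case False
    then have "m \<le> mat_norm n a * l" using le[of "1 / l"] l0 by (simp add: field_simps)
    then show ?thesis by (simp only: l_def m_def)
  qed
qed

lemma sum_lessThan_add: "(\<Sum>i<n + m. f i) = (\<Sum>i<n. f i) + (\<Sum>i<m. f (n + i :: nat))" for f :: "nat \<Rightarrow> 'a::comm_monoid_add"
  by (induction m) (simp_all add: add.assoc)

text \<open>The \<open>2n \<times> 2n\<close> block matrix with diagonal blocks \<open>r\<close> and off-diagonal blocks \<open>a\<close> and \<open>b\<close>.\<close>

definition block_mat ::
  "nat \<Rightarrow> real \<Rightarrow> (nat \<Rightarrow> nat \<Rightarrow> ('h::complex_hilbert \<Rightarrow>\<^sub>L 'h)) \<Rightarrow> (nat \<Rightarrow> nat \<Rightarrow> ('h \<Rightarrow>\<^sub>L 'h)) \<Rightarrow> nat \<Rightarrow> nat \<Rightarrow> ('h \<Rightarrow>\<^sub>L 'h)" where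
  "block_mat n r a b i j =
    (if i < n then (if j < n then (if i = j then r *\<^sub>R id_blinfun else 0) else a i (j - n))
     else (if j < n then b (i - n) j else (if i = j then r *\<^sub>R id_blinfun else 0)))"

lemma block_mat_form:
  "(\<Sum>i<n + n. cinner (\<xi> i) (mat_apply (n + n) (block_mat n r a b) \<xi> i)) =
    r * (\<Sum>i<n. cinner (\<xi> i) (\<xi> i)) + (\<Sum>i<n. cinner (\<xi> i) (mat_apply n a (\<lambda>j. \<xi> (n + j)) i))
     + (\<Sum>i<n. cinner (\<xi> (n + i)) (mat_apply n b \<xi> i)) + r * (\<Sum>i<n. cinner (\<xi> (n + i)) (\<xi> (n + i)))"
proof -
  have diag: "(\<Sum>j<n. blinfun_apply (if i = j then r *\<^sub>R id_blinfun else 0) (\<eta> j)) = r *\<^sub>R \<eta> i"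
    if "i < n" for i and \<eta> :: "nat \<Rightarrow> 'a"
  proof -
    have "(\<Sum>j<n. blinfun_apply (if i = j then r *\<^sub>R id_blinfun else 0) (\<eta> j)) = (\<Sum>j<n. if i = j then r *\<^sub>R \<eta> j else 0)"
      by (intro sum.cong) (auto simp: scaleR_blinfun.rep_eq)
    then show ?thesis using that by simp
  qed
  have 1: "mat_apply (n + n) (block_mat n r a b) \<xi> i = r *\<^sub>R \<xi> i + mat_apply n a (\<lambda>j. \<xi> (n + j)) i" if "i < n" for i
    using that diag[OF that, of \<xi>] by (simp add: mat_apply_def sum_lessThan_add block_mat_def)
  have 2: "mat_apply (n + n) (block_mat n r a b) \<xi> (n + i) = mat_apply n b \<xi> i + r *\<^sub>R \<xi> (n + i)" if "i < n" for i
    using that diag[OF that, of "\<lambda>j. \<xi> (n + j)"] by (simp add: mat_apply_def sum_lessThan_add block_mat_def)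
  show ?thesis
    by (simp add: sum_lessThan_add 1 2 cinner_add_right cinner_scaleR_right scaleR_conv_of_real sum.distrib sum_distrib_left)
qed

lemma adjoint_mat_form:
  assumes "a \<in> mat_over n bounded_ops"
  shows "(\<Sum>i<n. cinner (y i) (mat_apply n (\<lambda>i j. adj_op (a j i)) x i)) = cnj (\<Sum>i<n. cinner (x i) (mat_apply n a y i))"
proof -
  have "(\<Sum>i<n. cinner (y i) (mat_apply n (\<lambda>i j. adj_op (a j i)) x i))
    = (\<Sum>i<n. \<Sum>j<n. cinner (y i) (blinfun_apply (adj_op (a j i)) (x j)))"
    by (simp add: mat_apply_def cinner_sum_right)
  also have "\<dots> = (\<Sum>i<n. \<Sum>j<n. cnj (cinner (x j) (blinfun_apply (a j i) (y i))))"
    using assms by (intro sum.cong) (auto simp: mat_over_def cinner_adj_op_right cinner_commute[of "blinfun_apply _ _"])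
  also have "\<dots> = cnj (\<Sum>i<n. cinner (x i) (mat_apply n a y i))"
    by (subst sum.swap) (simp add: mat_apply_def cinner_sum_right)
  finally show ?thesis .
qed

lemma cinner_sum_Cauchy_Schwarz:
  "cmod (\<Sum>i\<in>A. cinner (x i) (y i)) \<le> L2_set (\<lambda>i. norm (x i)) A * L2_set (\<lambda>i. norm (y i)) A"
proof -
  have "cmod (\<Sum>i\<in>A. cinner (x i) (y i)) \<le> (\<Sum>i\<in>A. \<bar>norm (x i)\<bar> * \<bar>norm (y i)\<bar>)"
    using cinner_Cauchy_Schwarz by (intro order_trans[OF norm_sum] sum_mono) auto
  then show ?thesis using L2_set_mult_ineq[of "\<lambda>i. norm (x i)" "\<lambda>i. norm (y i)" A] by simp
qed

lemma L2_set_norm_sq: "(L2_set (\<lambda>i. norm (x i)) {..<n})\<^sup>2 = (\<Sum>i<n. (norm (x i))\<^sup>2)"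
  by (simp add: L2_set_def sum_nonneg)

lemma sum_cinner_self: "(\<Sum>i<n. cinner (x i) (x i)) = complex_of_real ((L2_set (\<lambda>i. norm (x i)) {..<n})\<^sup>2)"
  by (simp add: L2_set_norm_sq cinner_self)

lemma block_mat_positive:
  assumes a: "a \<in> mat_over n bounded_ops" and r: "r \<ge> 0"
    and bound: "\<And>\<xi>. L2_set (\<lambda>i. norm (mat_apply n a \<xi> i)) {..<n} \<le> r * L2_set (\<lambda>j. norm (\<xi> j)) {..<n}"
  shows "mat_positive (n + n) (block_mat n r a (\<lambda>i j. adj_op (a j i)))"
  unfolding mat_positive_def
proof
  fix \<xi> :: "nat \<Rightarrow> 'a"
  define y where "y i = \<xi> (n + i)" for i
  define z where "z = (\<Sum>i<n. cinner (\<xi> i) (mat_apply n a y i))"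
  define p q where "p = L2_set (\<lambda>i. norm (\<xi> i)) {..<n}" and "q = L2_set (\<lambda>i. norm (y i)) {..<n}"
  have "cmod z \<le> p * L2_set (\<lambda>i. norm (mat_apply n a y i)) {..<n}"
    unfolding z_def p_def by (rule cinner_sum_Cauchy_Schwarz)
  also have "\<dots> \<le> p * (r * q)"
    unfolding q_def using bound[of y] by (intro mult_left_mono) (auto simp: p_def L2_set_nonneg)
  finally have zle: "\<bar>Re z\<bar> \<le> p * (r * q)" using abs_Re_le_cmod order_trans by blast
  have "0 \<le> r * (p - q)\<^sup>2" using r by simp
  also have "\<dots> = r * p\<^sup>2 - 2 * (p * (r * q)) + r * q\<^sup>2" by (simp add: power2_diff algebra_simps)
  finally have "0 \<le> r * p\<^sup>2 + 2 * Re z + r * q\<^sup>2" using zle by linarith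
  moreover have "(\<Sum>i<n + n. cinner (\<xi> i) (mat_apply (n + n) (block_mat n r a (\<lambda>i j. adj_op (a j i))) \<xi> i))
    = complex_of_real (r * p\<^sup>2 + 2 * Re z + r * q\<^sup>2)"
    unfolding block_mat_form y_def[symmetric] adjoint_mat_form[OF a] sum_cinner_self
      z_def[symmetric] p_def[symmetric] q_def[symmetric]
    by (simp add: complex_eq_iff)
  ultimately show "(\<Sum>i<n + n. cinner (\<xi> i) (mat_apply (n + n) (block_mat n r a (\<lambda>i j. adj_op (a j i))) \<xi> i)) \<in> \<real>\<^sub>\<ge>\<^sub>0"
    by (simp only: nonneg_Reals_of_real_iff)
qed

text \<open>The converse of \<open>block_mat_positive\<close>: positivity is tested on the vectors \<open>(t a y, y)\<close>.\<close>

lemma block_mat_positive_imp_bound: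
  assumes a: "a \<in> mat_over n bounded_ops" and r: "r \<ge> 0"
    and pos: "mat_positive (n + n) (block_mat n r a (\<lambda>i j. adj_op (a j i)))"
  shows "L2_set (\<lambda>i. norm (mat_apply n a y i)) {..<n} \<le> r * L2_set (\<lambda>j. norm (y j)) {..<n}"
proof -
  define z where "z = mat_apply n a y"
  define p q where "p = L2_set (\<lambda>i. norm (z i)) {..<n}" and "q = L2_set (\<lambda>i. norm (y i)) {..<n}"
  have pq: "p \<ge> 0" "q \<ge> 0" by (simp_all add: p_def q_def L2_set_nonneg)
  have "(cmod (complex_of_real (p\<^sup>2)))\<^sup>2 \<le> (r * q\<^sup>2) * (r * p\<^sup>2)"
  proof (rule quadratic_nonneg_imp_cauchy_schwarz)
    fix t :: complex
    define \<xi> where "\<xi> i = (if i < n then scaleC (cnj t) (z i) else y (i - n))" for i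
    have x: "(\<Sum>i<n. cinner (\<xi> i) (\<xi> i)) = complex_of_real ((cmod t)\<^sup>2 * p\<^sup>2)"
    proof -
      have "(\<Sum>i<n. cinner (\<xi> i) (\<xi> i)) = (\<Sum>i<n. complex_of_real ((cmod t)\<^sup>2) * cinner (z i) (z i))"
        by (intro sum.cong) (auto simp: \<xi>_def cinner_self norm_scaleC power_mult_distrib)
      also have "\<dots> = complex_of_real ((cmod t)\<^sup>2) * complex_of_real (p\<^sup>2)"
        by (simp only: sum_distrib_left[symmetric] sum_cinner_self p_def)
      finally show ?thesis by simp
    qed
    have y: "(\<lambda>j. \<xi> (n + j)) = y" by (simp add: \<xi>_def)
    have c: "(\<Sum>i<n. cinner (\<xi> i) (mat_apply n a y i)) = t * complex_of_real (p\<^sup>2)"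
    proof -
      have "(\<Sum>i<n. cinner (\<xi> i) (mat_apply n a y i)) = (\<Sum>i<n. t * cinner (z i) (z i))"
        by (intro sum.cong) (auto simp: \<xi>_def z_def[symmetric] cinner_scaleC_left)
      then show ?thesis by (simp only: sum_distrib_left[symmetric] sum_cinner_self p_def)
    qed
    have yy: "(\<Sum>i<n. cinner (\<xi> (n + i)) (\<xi> (n + i))) = complex_of_real (q\<^sup>2)"
      using sum_cinner_self[of y n] by (simp add: \<xi>_def q_def)
    have cc: "(\<Sum>i<n. cinner (\<xi> (n + i)) (mat_apply n (\<lambda>i j. adj_op (a j i)) \<xi> i)) = cnj (t * complex_of_real (p\<^sup>2))"
      using adjoint_mat_form[OF a, of "\<lambda>i. \<xi> (n + i)" \<xi>] by (simp only: y c)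
    have "(\<Sum>i<n + n. cinner (\<xi> i) (mat_apply (n + n) (block_mat n r a (\<lambda>i j. adj_op (a j i))) \<xi> i)) \<in> \<real>\<^sub>\<ge>\<^sub>0"
      using pos by (simp add: mat_positive_def)
    then have "r * complex_of_real ((cmod t)\<^sup>2 * p\<^sup>2) + t * complex_of_real (p\<^sup>2) + cnj (t * complex_of_real (p\<^sup>2))
        + r * complex_of_real (q\<^sup>2) \<in> \<real>\<^sub>\<ge>\<^sub>0"
      unfolding block_mat_form x y c cc yy .
    then have "0 \<le> Re (r * complex_of_real ((cmod t)\<^sup>2 * p\<^sup>2) + t * complex_of_real (p\<^sup>2) + cnj (t * complex_of_real (p\<^sup>2))
        + r * complex_of_real (q\<^sup>2))"
      unfolding complex_nonneg_Reals_iff by blast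
    then show "0 \<le> r * q\<^sup>2 + 2 * Re (t * complex_of_real (p\<^sup>2)) + (cmod t)\<^sup>2 * (r * p\<^sup>2)"
      by (simp add: mult_ac)
  qed (use r in auto)
  then have "(p * p) * (p * p) \<le> (r * q) * (r * q) * (p * p)"
    by (simp add: power2_eq_square norm_mult mult_ac)
  then have "p = 0 \<or> p * p \<le> (r * q) * (r * q)"
    using pq by (metis mult_le_cancel_right mult_pos_pos order_le_less not_less)
  then have "p \<le> r * q"
  proof
    assume "p * p \<le> (r * q) * (r * q)"
    then have "p\<^sup>2 \<le> (r * q)\<^sup>2" by (simp add: power2_eq_square)
    then show ?thesis by (rule power2_le_imp_le) (use r pq in simp)
  qed (use r pq in simp)
  then show ?thesis by (simp add: p_def q_def z_def)
qed

lemma ucp_adj_op: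
  fixes \<phi> :: "('h::complex_hilbert \<Rightarrow>\<^sub>L 'h) \<Rightarrow> ('k::complex_hilbert \<Rightarrow>\<^sub>L 'k)"
  assumes S: "operator_system S" and lin: "linear_on_ops S \<phi>" and unit: "\<phi> id_blinfun = id_blinfun"
    and cp: "completely_positive_on S \<phi>" and B: "\<phi> ` S \<subseteq> bounded_ops" and x: "x \<in> S"
  shows "\<phi> (adj_op x) = adj_op (\<phi> x)"
proof -
  have xB: "x \<in> bounded_ops" "id_blinfun \<in> S" "adj_op x \<in> S"
    using S x by (auto simp: operator_system_def op_subspace_def)
  have scS: "scale_op c y \<in> S" if "y \<in> S" for c y using S that by (auto simp: operator_system_def op_subspace_def)
  define r where "r = norm x"
  have rid: "\<phi> (r *\<^sub>R id_blinfun) = r *\<^sub>R id_blinfun"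
    using lin xB(2) unit by (simp add: linear_on_ops_def scaleR_eq_scale_op)
  define m where "m = (\<lambda>(p :: nat) (q :: nat). if p = 0 then (if q = 0 then r *\<^sub>R id_blinfun else x)
      else (if q = 0 then adj_op x else r *\<^sub>R id_blinfun))"
  have "mat_positive 2 m" using mat_positive_norm_block[OF xB(1), of r] by (simp add: m_def r_def)
  moreover have "m \<in> mat_over 2 S"
    using x xB scS by (simp add: m_def mat_over_def scaleR_eq_scale_op)
  ultimately have pos: "mat_positive 2 (\<lambda>i j. \<phi> (m i j))"
    using cp unfolding completely_positive_on_def by blast
  have "cinner w (blinfun_apply (\<phi> (adj_op x)) v) = cnj (cinner v (blinfun_apply (\<phi> x) w))" for v w
  proof -
    define b where "b = cinner v (blinfun_apply (\<phi> x) w)"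
    define b' where "b' = cinner w (blinfun_apply (\<phi> (adj_op x)) v)"
    have im: "Im (c * b + cnj c * b') = 0" for c
    proof -
      define \<xi> where "\<xi> = (\<lambda>i :: nat. if i = 0 then v else scaleC c w)"
      have "(\<Sum>i<2. cinner (\<xi> i) (mat_apply 2 (\<lambda>i j. \<phi> (m i j)) \<xi> i))
        = r * cinner v v + (c * b + cnj c * b') + r * cinner (scaleC c w) (scaleC c w)"
        using B x by (simp add: mat_apply_def numeral_2_eq_2 \<xi>_def m_def rid b_def b'_def cinner_add_right
            scaleR_blinfun.rep_eq cinner_scaleR_right scaleR_conv_of_real bounded_opsD image_subset_iff
            cinner_scaleC_right cinner_scaleC_left add_ac)
      moreover have "Im (\<Sum>i<2. cinner (\<xi> i) (mat_apply 2 (\<lambda>i j. \<phi> (m i j)) \<xi> i)) = 0"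
        using pos unfolding mat_positive_def complex_nonneg_Reals_iff by blast
      ultimately show ?thesis by (simp add: cinner_self)
    qed
    show ?thesis using im[of 1] im[of \<i>] by (simp add: complex_eq_iff b_def b'_def)
  qed
  then have "adj_op (\<phi> x) = \<phi> (adj_op x)"
    using B x by (intro adj_op_eqI) (auto simp: image_subset_iff cinner_commute[of "blinfun_apply _ _"])
  then show ?thesis by simp
qed

text \<open>The entrywise image of the positive block matrix of \<open>a\<close> is the block matrix of the entrywise image of
  \<open>a\<close>, since the map is unital and respects adjoints.\<close>

lemma ucp_mat_bound:
  fixes \<phi> :: "('h::complex_hilbert \<Rightarrow>\<^sub>L 'h) \<Rightarrow> ('k::complex_hilbert \<Rightarrow>\<^sub>L 'k)"
  assumes S: "operator_system S" and lin: "linear_on_ops S \<phi>" and unit: "\<phi> id_blinfun = id_blinfun"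
    and cp: "completely_positive_on S \<phi>" and B: "\<phi> ` S \<subseteq> bounded_ops"
    and a: "a \<in> mat_over n S" and r: "r \<ge> 0"
    and bound: "\<And>\<xi>. L2_set (\<lambda>i. norm (mat_apply n a \<xi> i)) {..<n} \<le> r * L2_set (\<lambda>j. norm (\<xi> j)) {..<n}"
  shows "L2_set (\<lambda>i. norm (mat_apply n (\<lambda>i j. \<phi> (a i j)) \<xi> i)) {..<n} \<le> r * L2_set (\<lambda>j. norm (\<xi> j)) {..<n}"
proof (rule block_mat_positive_imp_bound[OF _ r])
  have SB: "S \<subseteq> bounded_ops" "id_blinfun \<in> S" "0 \<in> S" "\<And>x. x \<in> S \<Longrightarrow> adj_op x \<in> S"
    "\<And>c x. x \<in> S \<Longrightarrow> scale_op c x \<in> S"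
    using S by (auto simp: operator_system_def op_subspace_def)
  show "(\<lambda>i j. \<phi> (a i j)) \<in> mat_over n bounded_ops" using a B by (auto simp: mat_over_def)
  have aB: "a \<in> mat_over n bounded_ops" using a SB by (auto simp: mat_over_def)
  have "block_mat n r a (\<lambda>i j. adj_op (a j i)) \<in> mat_over (n + n) S"
    using a SB by (auto simp: mat_over_def block_mat_def scaleR_eq_scale_op)
  then have pos: "mat_positive (n + n) (\<lambda>i j. \<phi> (block_mat n r a (\<lambda>i j. adj_op (a j i)) i j))"
    using cp block_mat_positive[OF aB r bound] unfolding completely_positive_on_def by blast
  have rid: "\<phi> (r *\<^sub>R id_blinfun) = r *\<^sub>R id_blinfun"
    using lin SB(2) unit by (simp add: linear_on_ops_def scaleR_eq_scale_op)
  have \<phi>0: "\<phi> 0 = 0"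
  proof -
    have "\<phi> (0 + 0) = \<phi> 0 + \<phi> 0" using lin SB(3) unfolding linear_on_ops_def by blast
    then show ?thesis by simp
  qed
  have "\<phi> (block_mat n r a (\<lambda>i j. adj_op (a j i)) i j) = block_mat n r (\<lambda>i j. \<phi> (a i j)) (\<lambda>i j. adj_op (\<phi> (a j i))) i j"
    if "i < n + n" "j < n + n" for i j
    using that a ucp_adj_op[OF S lin unit cp B] by (auto simp: block_mat_def rid \<phi>0 mat_over_def)
  then have "mat_apply (n + n) (\<lambda>i j. \<phi> (block_mat n r a (\<lambda>i j. adj_op (a j i)) i j)) \<xi> i
    = mat_apply (n + n) (block_mat n r (\<lambda>i j. \<phi> (a i j)) (\<lambda>i j. adj_op (\<phi> (a j i)))) \<xi> i" if "i < n + n" for \<xi> i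
    using that by (simp add: mat_apply_def)
  then show "mat_positive (n + n) (block_mat n r (\<lambda>i j. \<phi> (a i j)) (\<lambda>i j. adj_op (\<phi> (a j i))))"
    using pos by (simp add: mat_positive_def)
qed

lemma ucp_mat_norm_le:
  fixes \<phi> :: "('h::complex_hilbert \<Rightarrow>\<^sub>L 'h) \<Rightarrow> ('k::complex_hilbert \<Rightarrow>\<^sub>L 'k)"
  assumes "operator_system S" "linear_on_ops S \<phi>" "\<phi> id_blinfun = id_blinfun"
    "completely_positive_on S \<phi>" "\<phi> ` S \<subseteq> bounded_ops" "a \<in> mat_over n S"
  shows "mat_norm n (\<lambda>i j. \<phi> (a i j)) \<le> mat_norm n a"
  by (rule mat_norm_le[OF mat_norm_nonneg ucp_mat_bound[OF assms mat_norm_nonneg mat_norm_bound]])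

lemma ucp_norm_le:
  fixes \<phi> :: "('h::complex_hilbert \<Rightarrow>\<^sub>L 'h) \<Rightarrow> ('k::complex_hilbert \<Rightarrow>\<^sub>L 'k)"
  assumes "operator_system S" "linear_on_ops S \<phi>" "\<phi> id_blinfun = id_blinfun"
    "completely_positive_on S \<phi>" "\<phi> ` S \<subseteq> bounded_ops" and x: "x \<in> S"
  shows "norm (\<phi> x) \<le> norm x"
proof (rule norm_blinfun_bound)
  fix v
  have "L2_set (\<lambda>i. norm (mat_apply 1 (\<lambda>i j. \<phi> x) (\<lambda>_. v) i)) {..<1} \<le> norm x * L2_set (\<lambda>j. norm v) {..<1 :: nat}"
    by (rule ucp_mat_bound[OF assms(1-5), where a = "\<lambda>_ _. x" and \<xi> = "\<lambda>_. v" and r = "norm x"])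
      (simp_all add: x norm_blinfun mat_over_def mat_apply_def L2_set_def)
  then show "norm (blinfun_apply (\<phi> x) v) \<le> norm x * norm v"
    by (simp add: L2_set_def mat_apply_def)
qed simp

section \<open>Equivariant maps and minimality\<close>

lemma gamma_map_compose:
  assumes "gamma_map G \<pi> S \<sigma> T \<phi>" "gamma_map G \<sigma> T \<tau> U \<psi>"
  shows "gamma_map G \<pi> S \<tau> U (\<psi> \<circ> \<phi>)"
proof -
  have \<phi>T: "\<phi> x \<in> T" if "x \<in> S" for x using assms(1) that by (auto simp: gamma_map_def)
  have "completely_positive_on S (\<psi> \<circ> \<phi>)"
    unfolding completely_positive_on_def
  proof (intro allI ballI impI)
    fix n a assume a: "a \<in> mat_over n S" "mat_positive n a"
    then have "mat_positive n (\<lambda>i j. \<phi> (a i j))"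
      using assms(1) by (simp add: gamma_map_def completely_positive_on_def)
    moreover have "(\<lambda>i j. \<phi> (a i j)) \<in> mat_over n T" using a(1) \<phi>T by (simp add: mat_over_def)
    ultimately have "mat_positive n (\<lambda>i j. \<psi> (\<phi> (a i j)))"
      using assms(2) unfolding gamma_map_def completely_positive_on_def by blast
    then show "mat_positive n (\<lambda>i j. (\<psi> \<circ> \<phi>) (a i j))" by simp
  qed
  moreover have "linear_on_ops S (\<psi> \<circ> \<phi>)"
    using assms \<phi>T by (simp add: gamma_map_def linear_on_ops_def)
  ultimately show ?thesis
    using assms \<phi>T by (auto simp: gamma_map_def)
qed

lemma gamma_map_restrict:
  assumes \<phi>: "gamma_map G \<pi> S \<sigma> T \<phi>" and S': "gamma_operator_system G \<pi> S'" "S' \<subseteq> S"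
    and T': "gamma_operator_system G \<sigma> T'" "\<phi> ` S' \<subseteq> T'"
  shows "gamma_map G \<pi> S' \<sigma> T' \<phi>"
proof -
  have "completely_positive_on S' \<phi>"
    unfolding completely_positive_on_def
  proof (intro allI ballI impI)
    fix n a assume a: "a \<in> mat_over n S'" "mat_positive n a"
    then have "a \<in> mat_over n S" using S'(2) by (auto simp: mat_over_def)
    then show "mat_positive n (\<lambda>i j. \<phi> (a i j))"
      using \<phi> a(2) by (simp add: gamma_map_def completely_positive_on_def)
  qed
  moreover have "linear_on_ops S' \<phi>"
    using \<phi> S'(2) by (simp add: gamma_map_def linear_on_ops_def subset_iff)
  ultimately show ?thesis
    using \<phi> S' T' by (auto simp: gamma_map_def)
qed

lemma gamma_map_ucp:
  assumes "gamma_map G \<pi> S \<sigma> T \<phi>"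
  shows "operator_system S" "linear_on_ops S \<phi>" "\<phi> id_blinfun = id_blinfun" "completely_positive_on S \<phi>"
    "\<phi> ` S \<subseteq> bounded_ops"
  using assms by (auto simp: gamma_map_def gamma_operator_system_def operator_system_def op_subspace_def)

lemma gamma_map_norm_le: "gamma_map G \<pi> S \<sigma> T \<phi> \<Longrightarrow> x \<in> S \<Longrightarrow> norm (\<phi> x) \<le> norm x"
  using ucp_norm_le[OF gamma_map_ucp] .

lemma gamma_map_diff:
  assumes \<phi>: "gamma_map G \<pi> S \<sigma> T \<phi>" and xy: "x \<in> S" "y \<in> S"
  shows "\<phi> (x - y) = \<phi> x - \<phi> y"
proof -
  have "op_subspace S" using gamma_map_ucp(1)[OF \<phi>] by (simp add: operator_system_def)
  then have "x - y \<in> S" using xy op_subspace_subspace subspace_diff by blast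
  then have "\<phi> ((x - y) + y) = \<phi> (x - y) + \<phi> y"
    using gamma_map_ucp(2)[OF \<phi>] xy(2) unfolding linear_on_ops_def by blast
  then show ?thesis by (simp add: algebra_simps)
qed

lemma gamma_map_average:
  fixes \<pi> :: "'g \<Rightarrow> ('h::complex_hilbert \<Rightarrow>\<^sub>L 'h)"
  assumes N: "N > 0" and \<phi>: "\<And>k. k < N \<Longrightarrow> gamma_map G \<pi> bounded_ops \<pi> bounded_ops (\<phi> k)"
  shows "gamma_map G \<pi> bounded_ops \<pi> bounded_ops (\<lambda>x. (1 / real N) *\<^sub>R (\<Sum>k<N. \<phi> k x))"
proof -
  let ?A = "\<lambda>x. (1 / real N) *\<^sub>R (\<Sum>k<N. \<phi> k x)"
  have sys: "gamma_operator_system G \<pi> bounded_ops" using \<phi>[OF N] by (simp add: gamma_map_def)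
  have B: "\<phi> k x \<in> bounded_ops" if "k < N" "x \<in> bounded_ops" for k x
    using \<phi>[OF that(1)] that(2) by (auto simp: gamma_map_def)
  have "?A ` bounded_ops \<subseteq> bounded_ops"
    by (auto intro!: bounded_ops_scaleR bounded_ops_sum B)
  moreover have "linear_on_ops bounded_ops ?A"
    using \<phi> unfolding gamma_map_def linear_on_ops_def
    by (simp add: sum.distrib scale_op_add_right scale_op_sum[symmetric] scaleR_eq_scale_op scale_op_scale_op mult.commute)
  moreover have "?A id_blinfun = id_blinfun"
  proof -
    have "(\<Sum>k<N. \<phi> k id_blinfun) = (\<Sum>k<N. id_blinfun)"
      by (rule sum.cong) (use \<phi> in \<open>auto simp: gamma_map_def\<close>)
    then show ?thesis using N by (simp add: sum_constant_scaleR)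
  qed
  moreover have "completely_positive_on bounded_ops ?A"
    unfolding completely_positive_on_def mat_positive_def
  proof (intro allI ballI impI)
    fix n and a :: "nat \<Rightarrow> nat \<Rightarrow> ('h \<Rightarrow>\<^sub>L 'h)" and \<xi> assume a: "a \<in> mat_over n bounded_ops"
      and pos: "\<forall>\<xi>. (\<Sum>i<n. cinner (\<xi> i) (mat_apply n a \<xi> i)) \<in> \<real>\<^sub>\<ge>\<^sub>0"
    have each: "(\<Sum>i<n. cinner (\<xi> i) (mat_apply n (\<lambda>i j. \<phi> k (a i j)) \<xi> i)) \<in> \<real>\<^sub>\<ge>\<^sub>0" if "k < N" for k
      using \<phi>[OF that] a pos unfolding gamma_map_def completely_positive_on_def mat_positive_def by blast
    have "mat_apply n (\<lambda>i j. ?A (a i j)) \<xi> i = (1 / real N) *\<^sub>R (\<Sum>k<N. mat_apply n (\<lambda>i j. \<phi> k (a i j)) \<xi> i)" for i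
      unfolding mat_apply_def
      by (subst sum.swap) (simp add: scaleR_blinfun.rep_eq blinfun.sum_left scaleR_sum_right)
    then have "(\<Sum>i<n. cinner (\<xi> i) (mat_apply n (\<lambda>i j. ?A (a i j)) \<xi> i))
      = (1 / real N) *\<^sub>R (\<Sum>i<n. \<Sum>k<N. cinner (\<xi> i) (mat_apply n (\<lambda>i j. \<phi> k (a i j)) \<xi> i))"
      by (simp only: cinner_scaleR_right cinner_sum_right scaleR_sum_right)
    also have "\<dots> = complex_of_real (1 / real N) * (\<Sum>k<N. \<Sum>i<n. cinner (\<xi> i) (mat_apply n (\<lambda>i j. \<phi> k (a i j)) \<xi> i))"
      by (subst sum.swap) (simp only: scaleR_conv_of_real)
    also have "\<dots> \<in> \<real>\<^sub>\<ge>\<^sub>0"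
      by (intro nonneg_Reals_mult_I nonneg_Reals_sum each) auto
    finally show "(\<Sum>i<n. cinner (\<xi> i) (mat_apply n (\<lambda>i j. ?A (a i j)) \<xi> i)) \<in> \<real>\<^sub>\<ge>\<^sub>0" .
  qed
  moreover have "?A (rep_act G \<pi> g x) = rep_act G \<pi> g (?A x)" if "g \<in> carrier G" "x \<in> bounded_ops" for g x
  proof -
    have "(\<Sum>k<N. \<phi> k (rep_act G \<pi> g x)) = (\<Sum>k<N. rep_act G \<pi> g (\<phi> k x))"
      by (rule sum.cong) (use \<phi> that in \<open>auto simp: gamma_map_def\<close>)
    also have "(1 / real N) *\<^sub>R \<dots> = rep_act G \<pi> g (?A x)"
      unfolding rep_act_def
      by (rule blinfun_eqI) (simp add: scaleR_blinfun.rep_eq blinfun.sum_left blinfun.sum_right blinfun.scaleR_right)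
    finally show ?thesis .
  qed
  ultimately show ?thesis using sys unfolding gamma_map_def by blast
qed

text \<open>Hamana's averaging argument. With \<open>\<kappa> = \<phi> \<tau>\<close> the averages
  \<open>A\<^sub>N = (1 / N) \<Sum>\<^sub>k\<^sub><\<^sub>N \<kappa>\<^sup>k \<phi>\<close> are \<open>\<Gamma>\<close>-maps with \<open>\<parallel>A\<^sub>N z\<parallel> \<le> \<parallel>\<phi> z\<parallel>\<close>, so minimality gives
  \<open>\<parallel>\<phi> z\<parallel> \<le> \<parallel>A\<^sub>N z\<parallel>\<close> for all \<open>N > 0\<close>. For \<open>z = y - \<tau> \<phi> y\<close> the sum telescopes and the bound tends to \<open>0\<close>,
  so \<open>\<phi> z = 0\<close>. Idempotency of \<open>\<phi>\<close> is the case where \<open>\<tau>\<close> is the identity.\<close>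

lemma minimal_gamma_map_absorbs:
  fixes \<pi> :: "'g \<Rightarrow> ('h::complex_hilbert \<Rightarrow>\<^sub>L 'h)"
  assumes min: "minimal_gamma_map G \<pi> \<phi>" and \<tau>: "gamma_map G \<pi> bounded_ops \<pi> bounded_ops \<tau>"
    and y: "y \<in> bounded_ops"
  shows "\<phi> (\<tau> (\<phi> y)) = \<phi> y"
proof -
  let ?\<Gamma> = "gamma_map G \<pi> bounded_ops \<pi> bounded_ops"
  have \<phi>: "?\<Gamma> \<phi>" and least: "\<And>\<psi>. ?\<Gamma> \<psi> \<Longrightarrow> norm_below \<psi> \<phi> \<Longrightarrow> norm_below \<phi> \<psi>"
    using min by (auto simp: minimal_gamma_map_def gamma_self_maps_def)
  define \<kappa> where "\<kappa> = \<phi> \<circ> \<tau>"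
  have \<kappa>: "?\<Gamma> \<kappa>" unfolding \<kappa>_def by (rule gamma_map_compose[OF \<tau> \<phi>])
  have pow: "?\<Gamma> ((\<kappa> ^^ k) \<circ> \<phi>)" for k
  proof (induction k)
    case (Suc k)
    have "(\<kappa> ^^ Suc k) \<circ> \<phi> = \<kappa> \<circ> ((\<kappa> ^^ k) \<circ> \<phi>)" by (simp add: o_assoc)
    then show ?case using gamma_map_compose[OF Suc \<kappa>] by (simp only:)
  qed (simp add: \<phi>)
  have powB: "(\<kappa> ^^ k) (\<phi> x) \<in> bounded_ops" if "x \<in> bounded_ops" for k x
    using pow[of k] that by (auto simp: gamma_map_def)
  have pow_norm: "norm ((\<kappa> ^^ k) (\<phi> x)) \<le> norm (\<phi> x)" if x: "x \<in> bounded_ops" for k x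
  proof (induction k)
    case (Suc k)
    then show ?case using gamma_map_norm_le[OF \<kappa> powB[OF x, of k]] by simp
  qed simp
  define x where "x = y - \<tau> (\<phi> y)"
  have B: "\<phi> y \<in> bounded_ops" "\<tau> (\<phi> y) \<in> bounded_ops"
    using \<phi> \<tau> y by (auto simp: gamma_map_def)
  have xB: "x \<in> bounded_ops" by (simp add: x_def bounded_ops_diff y B)
  have bound: "norm (\<phi> x) \<le> 2 * norm (\<phi> y) / real N" if N: "N > 0" for N
  proof -
    let ?A = "\<lambda>x. (1 / real N) *\<^sub>R (\<Sum>k<N. ((\<kappa> ^^ k) \<circ> \<phi>) x)"
    have "norm_below ?A \<phi>"
      unfolding norm_below_def
    proof
      fix z :: "'h \<Rightarrow>\<^sub>L 'h" assume z: "z \<in> bounded_ops"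
      have "norm (\<Sum>k<N. ((\<kappa> ^^ k) \<circ> \<phi>) z) \<le> (\<Sum>k<N. norm (\<phi> z))"
        using pow_norm[OF z] by (intro order_trans[OF norm_sum] sum_mono) auto
      then show "norm (?A z) \<le> norm (\<phi> z)" using N by (simp add: field_simps)
    qed
    then have "norm (\<phi> x) \<le> norm (?A x)"
      using least[OF gamma_map_average[OF N pow]] xB by (simp add: norm_below_def)
    also have "?A x = (1 / real N) *\<^sub>R (\<Sum>k<N. (\<kappa> ^^ k) (\<phi> y) - (\<kappa> ^^ Suc k) (\<phi> y))"
    proof -
      have "((\<kappa> ^^ k) \<circ> \<phi>) x = (\<kappa> ^^ k) (\<phi> y) - (\<kappa> ^^ Suc k) (\<phi> y)" for k
        unfolding x_def gamma_map_diff[OF pow y B(2)] by (simp add: \<kappa>_def funpow_swap1)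
      then show ?thesis by simp
    qed
    also have "(\<Sum>k<N. (\<kappa> ^^ k) (\<phi> y) - (\<kappa> ^^ Suc k) (\<phi> y)) = \<phi> y - (\<kappa> ^^ N) (\<phi> y)"
      using sum_lessThan_telescope'[of "\<lambda>k. (\<kappa> ^^ k) (\<phi> y)" N] by simp
    also have "norm ((1 / real N) *\<^sub>R (\<phi> y - (\<kappa> ^^ N) (\<phi> y))) \<le> (1 / real N) * (norm (\<phi> y) + norm (\<phi> y))"
      using norm_triangle_ineq4[of "\<phi> y" "(\<kappa> ^^ N) (\<phi> y)"] pow_norm[OF y, of N]
      by (simp add: divide_right_mono)
    finally show ?thesis by simp
  qed
  have "norm (\<phi> x) \<le> 0"
  proof (rule LIMSEQ_le_const)
    show "(\<lambda>n. 2 * norm (\<phi> y) / real n) \<longlonglongrightarrow> 0" by (rule lim_const_over_n)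
    show "\<exists>N. \<forall>n\<ge>N. norm (\<phi> x) \<le> 2 * norm (\<phi> y) / real n" using bound by (intro exI[of _ 1]) auto
  qed
  then show ?thesis using gamma_map_diff[OF \<phi> y B(2)] by (simp add: x_def)
qed

lemma gamma_map_id:
  "gamma_operator_system G \<pi> S \<Longrightarrow> gamma_map G \<pi> S \<pi> S (\<lambda>x. x)"
  by (auto simp: gamma_map_def linear_on_ops_def completely_positive_on_def)

lemma minimal_gamma_map_image_system:
  fixes \<pi> :: "'g \<Rightarrow> ('h::complex_hilbert \<Rightarrow>\<^sub>L 'h)"
  assumes min: "minimal_gamma_map G \<pi> \<phi>"
  shows "gamma_operator_system G \<pi> (\<phi> ` bounded_ops)"
proof -
  have \<phi>: "gamma_map G \<pi> bounded_ops \<pi> bounded_ops \<phi>"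
    using min by (simp add: minimal_gamma_map_def gamma_self_maps_def)
  then have sys: "gamma_operator_system G \<pi> bounded_ops" by (simp add: gamma_map_def)
  have idem: "\<phi> (\<phi> y) = \<phi> y" if "y \<in> bounded_ops" for y
    using minimal_gamma_map_absorbs[OF min gamma_map_id[OF sys] that] .
  have \<phi>B: "\<phi> x \<in> bounded_ops" if "x \<in> bounded_ops" for x using \<phi> that by (auto simp: gamma_map_def)
  have fixed: "x \<in> \<phi> ` bounded_ops \<longleftrightarrow> x \<in> bounded_ops \<and> \<phi> x = x" for x
  proof
    show "x \<in> \<phi> ` bounded_ops \<Longrightarrow> x \<in> bounded_ops \<and> \<phi> x = x" using idem \<phi>B by blast
    show "x \<in> bounded_ops \<and> \<phi> x = x \<Longrightarrow> x \<in> \<phi> ` bounded_ops" by (rule image_eqI[of _ _ x]) auto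
  qed
  note lin = gamma_map_ucp(2)[OF \<phi>, unfolded linear_on_ops_def]
  show ?thesis
    unfolding gamma_operator_system_def operator_system_def op_subspace_def
  proof (intro conjI ballI allI)
    show "\<phi> ` bounded_ops \<subseteq> bounded_ops" using \<phi>B by blast
    show "0 \<in> \<phi> ` bounded_ops"
      using gamma_map_diff[OF \<phi> bounded_ops_zero bounded_ops_zero] by (simp add: fixed bounded_ops_zero)
    show "id_blinfun \<in> \<phi> ` bounded_ops" using gamma_map_ucp(3)[OF \<phi>] by (simp add: fixed bounded_ops_id)
    show "closed (\<phi> ` bounded_ops)"
      unfolding closed_sequential_limits
    proof (intro allI impI, elim conjE)
      fix f l assume f: "\<forall>n. f n \<in> \<phi> ` bounded_ops" and lim: "f \<longlonglongrightarrow> l"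
      have fB: "f n \<in> bounded_ops" "\<phi> (f n) = f n" for n using f fixed by auto
      have lB: "l \<in> bounded_ops" using closed_sequentially[OF closed_bounded_ops] fB lim by blast
      have "norm (f n - \<phi> l) \<le> norm (f n - l)" for n
        using gamma_map_norm_le[OF \<phi> bounded_ops_diff[OF fB(1) lB], of n] gamma_map_diff[OF \<phi> fB(1) lB] fB(2)
        by simp
      then have "\<forall>\<^sub>F n in sequentially. norm (f n - \<phi> l) \<le> norm (f n - l)" by (rule always_eventually[OF allI])
      then have "(\<lambda>n. f n - \<phi> l) \<longlonglongrightarrow> 0"
        by (rule Lim_null_comparison) (rule tendsto_norm_zero[OF LIM_zero[OF lim]])
      then have "f \<longlonglongrightarrow> \<phi> l" by (rule LIM_zero_cancel)
      then have "\<phi> l = l" using lim LIMSEQ_unique by blast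
      then show "l \<in> \<phi> ` bounded_ops" using lB fixed by simp
    qed
  next
    fix x y assume "x \<in> \<phi> ` bounded_ops" "y \<in> \<phi> ` bounded_ops"
    then show "x + y \<in> \<phi> ` bounded_ops" using lin by (simp add: fixed bounded_ops_add)
  next
    fix c x assume "x \<in> \<phi> ` bounded_ops"
    then show "scale_op c x \<in> \<phi> ` bounded_ops" using lin by (simp add: fixed bounded_ops_scale_op)
  next
    fix x assume "x \<in> \<phi> ` bounded_ops"
    then show "adj_op x \<in> \<phi> ` bounded_ops"
      using ucp_adj_op[OF gamma_map_ucp[OF \<phi>]] by (simp add: fixed)
  next
    fix g x assume "g \<in> carrier G" "x \<in> \<phi> ` bounded_ops"
    then show "rep_act G \<pi> g x \<in> \<phi> ` bounded_ops"
      using \<phi> sys by (simp add: fixed gamma_map_def gamma_operator_system_def)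
  qed
qed

theorem corollary3p18:
  fixes G :: "('g, 'm) monoid_scheme"
    and \<pi> :: "'g \<Rightarrow> ('h::complex_hilbert \<Rightarrow>\<^sub>L 'h)"
    and \<sigma> :: "'g \<Rightarrow> ('k::complex_hilbert \<Rightarrow>\<^sub>L 'k)"
    and B\<^sub>\<pi> :: "('h \<Rightarrow>\<^sub>L 'h) set"
    and B\<^sub>\<sigma> :: "('k \<Rightarrow>\<^sub>L 'k) set"
  assumes "group G"
    and "unitary_rep G \<pi>" and "unitary_rep G \<sigma>"
    and "weakly_contained G \<pi> \<sigma>" and "weakly_contained G \<sigma> \<pi>"
    and "is_FH_boundary G \<pi> B\<^sub>\<pi>" and "is_FH_boundary G \<sigma> B\<^sub>\<sigma>"
  shows "\<exists>\<theta>. gamma_isomorphism G \<pi> B\<^sub>\<pi> \<sigma> B\<^sub>\<sigma> \<theta>"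
proof -
  obtain \<phi> where min\<phi>: "minimal_gamma_map G \<pi> \<phi>" and B\<pi>: "B\<^sub>\<pi> = \<phi> ` bounded_ops"
    using assms(6) by (auto simp: is_FH_boundary_def)
  obtain \<psi> where min\<psi>: "minimal_gamma_map G \<sigma> \<psi>" and B\<sigma>: "B\<^sub>\<sigma> = \<psi> ` bounded_ops"
    using assms(7) by (auto simp: is_FH_boundary_def)
  obtain \<Phi> where \<Phi>: "gamma_map G \<sigma> bounded_ops \<pi> bounded_ops \<Phi>"
    using gamma_map_from_weak_containment[OF assms(1-4)] by blast
  obtain \<Psi> where \<Psi>: "gamma_map G \<pi> bounded_ops \<sigma> bounded_ops \<Psi>"
    using gamma_map_from_weak_containment[OF assms(1,3,2,5)] by blast
  have \<phi>: "gamma_map G \<pi> bounded_ops \<pi> bounded_ops \<phi>" and \<psi>: "gamma_map G \<sigma> bounded_ops \<sigma> bounded_ops \<psi>"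
    using min\<phi> min\<psi> by (simp_all add: minimal_gamma_map_def gamma_self_maps_def)
  have sys: "gamma_operator_system G \<pi> B\<^sub>\<pi>" "gamma_operator_system G \<sigma> B\<^sub>\<sigma>"
    unfolding B\<pi> B\<sigma> using min\<phi> min\<psi> by (simp_all add: minimal_gamma_map_image_system)
  have sub: "B\<^sub>\<pi> \<subseteq> bounded_ops" "B\<^sub>\<sigma> \<subseteq> bounded_ops"
    using sys by (auto simp: gamma_operator_system_def operator_system_def op_subspace_def)
  define \<alpha> where "\<alpha> = \<psi> \<circ> \<Psi>"
  define \<beta> where "\<beta> = \<phi> \<circ> \<Phi>"
  have \<alpha>: "gamma_map G \<pi> B\<^sub>\<pi> \<sigma> B\<^sub>\<sigma> \<alpha>"
    unfolding \<alpha>_def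
  proof (rule gamma_map_restrict[OF gamma_map_compose[OF \<Psi> \<psi>] sys(1) sub(1) sys(2)])
    show "(\<psi> \<circ> \<Psi>) ` B\<^sub>\<pi> \<subseteq> B\<^sub>\<sigma>" using \<Psi> sub(1) by (auto simp: gamma_map_def B\<sigma>)
  qed
  have \<beta>: "gamma_map G \<sigma> B\<^sub>\<sigma> \<pi> B\<^sub>\<pi> \<beta>"
    unfolding \<beta>_def
  proof (rule gamma_map_restrict[OF gamma_map_compose[OF \<Phi> \<phi>] sys(2) sub(2) sys(1)])
    show "(\<phi> \<circ> \<Phi>) ` B\<^sub>\<sigma> \<subseteq> B\<^sub>\<pi>" using \<Phi> sub(2) by (auto simp: gamma_map_def B\<pi>)
  qed
  have \<beta>\<alpha>: "\<beta> (\<alpha> x) = x" if x: "x \<in> B\<^sub>\<pi>" for x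
  proof -
    obtain y where y: "y \<in> bounded_ops" "x = \<phi> y" using x B\<pi> by blast
    have "gamma_map G \<pi> bounded_ops \<pi> bounded_ops (\<Phi> \<circ> (\<psi> \<circ> \<Psi>))"
      by (rule gamma_map_compose[OF gamma_map_compose[OF \<Psi> \<psi>] \<Phi>])
    from minimal_gamma_map_absorbs[OF min\<phi> this y(1)] show ?thesis
      by (simp add: \<alpha>_def \<beta>_def y(2))
  qed
  have \<alpha>\<beta>: "\<alpha> (\<beta> x) = x" if x: "x \<in> B\<^sub>\<sigma>" for x
  proof -
    obtain y where y: "y \<in> bounded_ops" "x = \<psi> y" using x B\<sigma> by blast
    have "gamma_map G \<sigma> bounded_ops \<sigma> bounded_ops (\<Psi> \<circ> (\<phi> \<circ> \<Phi>))"
      by (rule gamma_map_compose[OF gamma_map_compose[OF \<Phi> \<phi>] \<Psi>])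
    from minimal_gamma_map_absorbs[OF min\<psi> this y(1)] show ?thesis
      by (simp add: \<alpha>_def \<beta>_def y(2))
  qed
  have "bij_betw \<alpha> B\<^sub>\<pi> B\<^sub>\<sigma>"
    by (rule bij_betw_byWitness[of _ \<beta>]) (use \<beta>\<alpha> \<alpha>\<beta> \<alpha> \<beta> in \<open>auto simp: gamma_map_def\<close>)
  moreover have "completely_isometric_on B\<^sub>\<pi> \<alpha>"
    unfolding completely_isometric_on_def
  proof (intro allI ballI antisym)
    fix n a assume a: "a \<in> mat_over n B\<^sub>\<pi>"
    show "mat_norm n (\<lambda>i j. \<alpha> (a i j)) \<le> mat_norm n a"
      by (rule ucp_mat_norm_le[OF gamma_map_ucp[OF \<alpha>] a])
    have "(\<lambda>i j. \<alpha> (a i j)) \<in> mat_over n B\<^sub>\<sigma>" using a \<alpha> by (auto simp: mat_over_def gamma_map_def)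
    from ucp_mat_norm_le[OF gamma_map_ucp[OF \<beta>] this]
    have "mat_norm n (\<lambda>i j. \<beta> (\<alpha> (a i j))) \<le> mat_norm n (\<lambda>i j. \<alpha> (a i j))" .
    moreover have "mat_norm n (\<lambda>i j. \<beta> (\<alpha> (a i j))) = mat_norm n a"
    proof -
      have "mat_apply n (\<lambda>i j. \<beta> (\<alpha> (a i j))) \<xi> i = mat_apply n a \<xi> i" if "i < n" for \<xi> i
        using a that by (simp add: mat_apply_def mat_over_def \<beta>\<alpha>)
      then show ?thesis by (simp add: mat_norm_def L2_set_def)
    qed
    ultimately show "mat_norm n a \<le> mat_norm n (\<lambda>i j. \<alpha> (a i j))" by simp
  qed
  ultimately show ?thesis using \<alpha> by (auto simp: gamma_isomorphism_def)
qed

end
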